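(* Let $k$ be an algebraically closed field of characteristic $0$ and let $a,b,c\in k$ be such that $X^8+aX^6+bX^4+cX^2+1$ has no repeated roots. Let $\mathcal X$ be the genus 3 hyperelliptic curve $Y^2=X^8+aX^6+bX^4+cX^2+1$, with dihedral invariants $$\mathfrak s_2=ac,\qquad \mathfrak s_3=(a^2+c^2)\,b,\qquad \mathfrak s_4=a^4+c^4,$$ and assume that $16\mathfrak s_2^3-40\mathfrak s_2^2+8\mathfrak s_2\mathfrak s_4-3\mathfrak s_3^2-20\mathfrak s_4\neq 0$. Suppose that $\mathcal X$ has $(2,4,4)$-split Jacobian, that is, the genus 2 quotient curve $C: y^2=x(x^4+ax^3+bx^2+cx+1)$ of $\mathcal X$ (via $x=X^2$, $y=YX$) has the property that the Klein 4-group embeds in $\mathrm{Aut}(C)$. Then at least one of the following holds: (i) $\mathbb Z_2^3$ embeds in $\mathrm{Aut}(\mathcal X)$; (ii) $\mathbb Z_2\times\mathbb Z_4$ embeds in $\mathrm{Aut}(\mathcal X)$; (iii) $\mathcal X$ lies in the locus $\mathcal T_3$, i.e. $F_1(\mathfrak s_2,\mathfrak s_3,\mathfrak s_4)=0$, where $F_1$ is the explicit polynomial given in the context.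
   Context: All automorphism groups are groups of automorphisms over $k$ of the smooth projective curves. The polynomial $F_1(p,q,r)\in\mathbb Z[p,q,r]$ (evaluated at $p=\mathfrak s_2$, $q=\mathfrak s_3$, $r=\mathfrak s_4$) is $$\begin{aligned} F_1(p,q,r)={}&1024p^{13}-256p^{12}q+1536p^{12}-8448p^{11}q+2560p^{11}r+1664p^{10}q^2\\ &-512p^{10}qr+64p^9q^3+33600p^{11}-48720p^{10}q+10752p^{10}r+37696p^9q^2\\ &-20928p^9qr+2560p^9r^2-4448p^8q^3+3008p^8q^2r-384p^8qr^2-432p^7q^4\\ &+96p^7q^3r-4p^6q^5+20000p^{10}-140000p^9q+84000p^9r+172600p^8q^2\\ &-139200p^8qr+21120p^8r^2-71680p^7q^3+78368p^7q^2r-20736p^7qr^2\\ &+1280p^7r^3+2288p^6q^4-6200p^6q^3r+2016p^6q^2r^2-128p^6qr^3+1256p^5q^5\\ &-568p^5q^4r+48p^5q^3r^2+26p^4q^6-4p^4q^5r+50000p^8r+80000p^7q^2\\ &-280000p^7qr+84000p^7r^2-140000p^6q^3+345500p^6q^2r-156600p^6qr^2\\ &+19200p^6r^3+30000p^5q^4-107520p^5q^3r+61008p^5q^2r^2-10272p^5qr^3\\ &+320p^5r^4+8060p^4q^5-204p^4q^4r-2628p^4q^3r^2+592p^4q^2r^3-16p^4qr^4\\ &-1464p^3q^6+1256p^3q^5r-244p^3q^4r^2+8p^3q^3r^3-72p^2q^7+21p^2q^6r\\ &-p^2q^5r^2+50000p^6r^2+120000p^5q^2r-210000p^5qr^2+42000p^5r^3+40000p^4q^4\\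 &-210000p^4q^3r+259350p^4q^2r^2-87000p^4qr^3+9120p^4r^4+30000p^3q^4r\\ &-53760p^3q^3r^2+21080p^3q^2r^3-2544p^3qr^4+32p^3r^5-3600p^2q^6+8060p^2q^5r\\ &-1920p^2q^4r^2-202p^2q^3r^3+64p^2q^2r^4-732pq^6r+314pq^5r^2-34pq^4r^3\\ &+81q^8-36q^7r+4q^6r^2+25000p^4r^3+60000p^3q^2r^2-70000p^3qr^3+10500p^3r^4\\ &+40000p^2q^4r-105000p^2q^3r^2+86525p^2q^2r^3-23925p^2qr^4+2208p^2r^5\\ &+7500pq^4r^2-8960pq^3r^3+2728pq^2r^4-252pqr^5-1800q^6r+2015q^5r^2\\ &-623q^4r^3+59q^3r^4+6250p^2r^4+10000pq^2r^3-8750pqr^4+1050pr^5+10000q^4r^2\\ &-17500q^3r^3+10825q^2r^4-2610qr^5+216r^6+625r^5. \end{aligned}$$ *)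

theory Defs
  imports
    "HOL-Analysis.Abstract_Topology"
    "HOL-Algebra.Bij"
    "HOL-Algebra.Elementary_Groups"
    "HOL-Computational_Algebra.Polynomial"
begin

section \<open>Smooth projective hyperelliptic curves\<close>

text \<open>
  Let \<open>f\<close> be a polynomial of degree \<open>2 g + 1\<close> or \<open>2 g + 2\<close> without repeated roots over an
  algebraically closed field of characteristic 0. The smooth projective curve \<open>y\<^sup>2 = f(x)\<close> of
  genus \<open>g\<close> is obtained by gluing the smooth affine plane curves
    \<open>y\<^sup>2 = f(x)\<close>  and  \<open>v\<^sup>2 = u ^ (2 g + 2) f(1/u)\<close>
  along \<open>u = 1 / x\<close>, \<open>v = y / x ^ (g + 1)\<close>. (Equivalently, it is the curve
  \<open>Y\<^sup>2 = Z ^ (2 g + 2) f(X/Z)\<close> in the weighted projective plane \<open>P(1, g + 1, 1)\<close>.)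
  Its points are the points \<open>(x, y)\<close> of the first affine curve together with the points
  \<open>(u, v) = (0, v)\<close> of the second one, for which the equation reads
  \<open>v\<^sup>2 = coeff f (2 g + 2)\<close>: two points at infinity in even degree, one in odd degree.
\<close>

datatype 'k hpoint = Affine 'k 'k | AtInfinity 'k

definition hyp_points :: "nat \<Rightarrow> 'k::field poly \<Rightarrow> 'k hpoint set" where
  "hyp_points g f =
     {Affine x y | x y. y ^ 2 = poly f x} \<union> {AtInfinity v | v. v ^ 2 = coeff f (2 * g + 2)}"

fun chart_finite :: "'k::field hpoint \<Rightarrow> ('k \<times> 'k) option" where
  "chart_finite (Affine x y) = Some (x, y)"
| "chart_finite (AtInfinity v) = None"

fun chart_infinity :: "nat \<Rightarrow> 'k::field hpoint \<Rightarrow> ('k \<times> 'k) option" where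
  "chart_infinity g (Affine x y) = (if x = 0 then None else Some (1 / x, y / x ^ (g + 1)))"
| "chart_infinity g (AtInfinity v) = Some (0, v)"

definition charts :: "nat \<Rightarrow> ('k::field hpoint \<Rightarrow> ('k \<times> 'k) option) set" where
  "charts g = {chart_finite, chart_infinity g}"

text \<open>
  A polynomial in two variables is an element \<open>F\<close> of \<open>k[x][y]\<close>; its value at \<open>(x, y)\<close>:
\<close>

definition poly2 :: "'k::comm_ring_1 poly poly \<Rightarrow> 'k \<times> 'k \<Rightarrow> 'k" where
  "poly2 F z = poly (poly F [:snd z:]) (fst z)"

definition nonvanishing ::
    "('k::field hpoint \<Rightarrow> ('k \<times> 'k) option) \<Rightarrow> 'k poly poly \<Rightarrow> 'k hpoint set" where
  "nonvanishing \<chi> G = {P. \<exists>z. \<chi> P = Some z \<and> poly2 G z \<noteq> 0}"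

definition zariski :: "nat \<Rightarrow> 'k::field poly \<Rightarrow> 'k hpoint topology" where
  "zariski g f =
     topology_generated_by {hyp_points g f \<inter> nonvanishing \<chi> G | \<chi> G. \<chi> \<in> charts g}"

text \<open>
  A \<open>k\<close>-valued function is regular on an open set \<open>U\<close> if locally, in the coordinates of one
  of the charts, it is a quotient of polynomials. Only the values of \<open>h\<close> on \<open>U\<close> matter.
\<close>

definition regular_on ::
    "nat \<Rightarrow> 'k::field poly \<Rightarrow> 'k hpoint set \<Rightarrow> ('k hpoint \<Rightarrow> 'k) \<Rightarrow> bool" where
  "regular_on g f U h \<longleftrightarrow>
     (\<forall>P\<in>U. \<exists>V. openin (zariski g f) V \<and> P \<in> V \<and> V \<subseteq> U \<and>
        (\<exists>\<chi>\<in>charts g. \<exists>F G. V \<subseteq> nonvanishing \<chi> G \<and>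
           (\<forall>Q\<in>V. h Q = poly2 F (the (\<chi> Q)) / poly2 G (the (\<chi> Q)))))"

text \<open>
  Morphisms over \<open>k\<close>: Zariski continuous maps which pull back regular functions to regular
  functions.
\<close>

definition hyp_morphism ::
    "nat \<Rightarrow> 'k::field poly \<Rightarrow> nat \<Rightarrow> 'k poly \<Rightarrow> ('k hpoint \<Rightarrow> 'k hpoint) \<Rightarrow> bool" where
  "hyp_morphism g f g' f' \<phi> \<longleftrightarrow>
     continuous_map (zariski g f) (zariski g' f') \<phi> \<and>
     (\<forall>V h. openin (zariski g' f') V \<longrightarrow> regular_on g' f' V h \<longrightarrow>
        regular_on g f {P \<in> hyp_points g f. \<phi> P \<in> V} (h \<circ> \<phi>))"

definition hyp_automorphisms ::
    "nat \<Rightarrow> 'k::field poly \<Rightarrow> ('k hpoint \<Rightarrow> 'k hpoint) set" where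
  "hyp_automorphisms g f =
     {\<phi> \<in> Bij (hyp_points g f).
        hyp_morphism g f g f \<phi> \<and> hyp_morphism g f g f (inv_into (hyp_points g f) \<phi>)}"

definition hyp_Aut :: "nat \<Rightarrow> 'k::field poly \<Rightarrow> ('k hpoint \<Rightarrow> 'k hpoint) monoid" where
  "hyp_Aut g f = BijGroup (hyp_points g f) \<lparr>carrier := hyp_automorphisms g f\<rparr>"

lemma openin_zariski_subset: "openin (zariski g f) U \<Longrightarrow> U \<subseteq> hyp_points g f"
proof -
  assume "openin (zariski g f) U"
  then have "generate_topology_on
      {hyp_points g f \<inter> nonvanishing \<chi> G | \<chi> G. \<chi> \<in> charts g} U"
    by (simp add: zariski_def openin_topology_generated_by_iff)
  then show ?thesis
    by (induction rule: generate_topology_on.induct) auto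
qed

lemma topspace_zariski [simp]: "topspace (zariski g f) = hyp_points g f"
proof
  show "topspace (zariski g f) \<subseteq> hyp_points g f"
    by (rule openin_zariski_subset) simp
  show "hyp_points g f \<subseteq> topspace (zariski g f)"
  proof
    fix P assume P: "P \<in> hyp_points g f"
    obtain \<chi> z where \<chi>: "\<chi> \<in> charts g" "\<chi> P = Some z"
    proof (cases P)
      case (Affine x y)
      then show ?thesis using that[of chart_finite "(x, y)"] by (simp add: charts_def)
    next
      case (AtInfinity v)
      then show ?thesis using that[of "chart_infinity g" "(0, v)"] by (simp add: charts_def)
    qed
    have "openin (zariski g f) (hyp_points g f \<inter> nonvanishing \<chi> 1)"
      unfolding zariski_def using \<chi>(1) by (intro topology_generated_by_Basis) blast
    moreover have "P \<in> hyp_points g f \<inter> nonvanishing \<chi> 1"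
      using P \<chi>(2) by (auto simp: nonvanishing_def poly2_def)
    ultimately show "P \<in> topspace (zariski g f)"
      by (meson openin_subset subsetD)
  qed
qed

lemma regular_on_cong:
  assumes "regular_on g f U h" "\<And>P. P \<in> U \<Longrightarrow> h P = h' P"
  shows "regular_on g f U h'"
  unfolding regular_on_def
proof
  fix P assume "P \<in> U"
  with assms(1) obtain V \<chi> F G where *: "openin (zariski g f) V" "P \<in> V" "V \<subseteq> U"
      "\<chi> \<in> charts g" "V \<subseteq> nonvanishing \<chi> G"
      "\<forall>Q\<in>V. h Q = poly2 F (the (\<chi> Q)) / poly2 G (the (\<chi> Q))"
    unfolding regular_on_def by meson
  moreover have "\<forall>Q\<in>V. h' Q = poly2 F (the (\<chi> Q)) / poly2 G (the (\<chi> Q))"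
    using * assms(2) by (metis subsetD)
  ultimately show "\<exists>V. openin (zariski g f) V \<and> P \<in> V \<and> V \<subseteq> U \<and>
        (\<exists>\<chi>\<in>charts g. \<exists>F G. V \<subseteq> nonvanishing \<chi> G \<and>
           (\<forall>Q\<in>V. h' Q = poly2 F (the (\<chi> Q)) / poly2 G (the (\<chi> Q))))"
    by blast
qed

lemma hyp_morphism_cong:
  assumes "hyp_morphism g f g' f' \<phi>" "\<And>P. P \<in> hyp_points g f \<Longrightarrow> \<phi> P = \<psi> P"
  shows "hyp_morphism g f g' f' \<psi>"
proof -
  have *: "{P \<in> hyp_points g f. \<psi> P \<in> V} = {P \<in> hyp_points g f. \<phi> P \<in> V}" for V
    using assms(2) by auto
  have "continuous_map (zariski g f) (zariski g' f') \<psi>"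
    using assms by (auto simp: hyp_morphism_def intro: continuous_map_eq)
  moreover have "regular_on g f {P \<in> hyp_points g f. \<psi> P \<in> V} (h \<circ> \<psi>)"
    if "openin (zariski g' f') V" "regular_on g' f' V h" for V h
  proof -
    have "regular_on g f {P \<in> hyp_points g f. \<phi> P \<in> V} (h \<circ> \<phi>)"
      using assms(1) that unfolding hyp_morphism_def by blast
    then show ?thesis
      unfolding * by (rule regular_on_cong) (simp add: assms(2))
  qed
  ultimately show ?thesis by (simp add: hyp_morphism_def)
qed

lemma hyp_morphism_id: "hyp_morphism g f g f (\<lambda>P. P)"
proof -
  have "{P \<in> hyp_points g f. P \<in> V} = V" if "openin (zariski g f) V" for V
    using openin_zariski_subset[OF that] by auto
  then show ?thesis by (simp add: hyp_morphism_def o_def)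
qed

lemma hyp_morphism_comp:
  assumes "hyp_morphism g f g' f' \<phi>" "hyp_morphism g' f' g'' f'' \<psi>"
  shows "hyp_morphism g f g'' f'' (\<psi> \<circ> \<phi>)"
proof -
  have c: "continuous_map (zariski g f) (zariski g' f') \<phi>"
      "continuous_map (zariski g' f') (zariski g'' f'') \<psi>"
    using assms by (auto simp: hyp_morphism_def)
  have "regular_on g f {P \<in> hyp_points g f. (\<psi> \<circ> \<phi>) P \<in> V} (h \<circ> (\<psi> \<circ> \<phi>))"
    if V: "openin (zariski g'' f'') V" "regular_on g'' f'' V h" for V h
  proof -
    let ?W = "{P \<in> hyp_points g' f'. \<psi> P \<in> V}"
    have "openin (zariski g' f') ?W" "regular_on g' f' ?W (h \<circ> \<psi>)"
      using assms(2) c(2) V by (auto simp: hyp_morphism_def continuous_map_def)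
    then have "regular_on g f {P \<in> hyp_points g f. \<phi> P \<in> ?W} ((h \<circ> \<psi>) \<circ> \<phi>)"
      using assms(1) unfolding hyp_morphism_def by blast
    moreover have "{P \<in> hyp_points g f. \<phi> P \<in> ?W} = {P \<in> hyp_points g f. (\<psi> \<circ> \<phi>) P \<in> V}"
      using c(1) by (auto simp: continuous_map_def)
    ultimately show ?thesis by (simp add: comp_assoc)
  qed
  with c show ?thesis by (auto simp: hyp_morphism_def intro: continuous_map_compose)
qed

lemma group_hyp_Aut: "group (hyp_Aut g f)"
proof -
  let ?X = "hyp_points g f"
  interpret B: group "BijGroup ?X" by (rule group_BijGroup)
  have inv: "inv\<^bsub>BijGroup ?X\<^esub> \<phi> = restrict (inv_into ?X \<phi>) ?X" if "\<phi> \<in> Bij ?X" for \<phi>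
    using inv_BijGroup[OF that] by simp
  have inv_inv: "inv_into ?X (restrict (inv_into ?X \<phi>) ?X) P = \<phi> P"
    if "\<phi> \<in> Bij ?X" "P \<in> ?X" for \<phi> P
  proof -
    have b: "bij_betw \<phi> ?X ?X" using that by (simp add: Bij_def)
    have "bij_betw (inv_into ?X \<phi>) ?X ?X" using b by (rule bij_betw_inv_into)
    then have "bij_betw (restrict (inv_into ?X \<phi>) ?X) ?X ?X" by simp
    moreover have "\<phi> P \<in> ?X" using b that by (auto simp: bij_betw_def)
    moreover have "restrict (inv_into ?X \<phi>) ?X (\<phi> P) = P"
      using b that \<open>\<phi> P \<in> ?X\<close> by (simp add: bij_betw_inv_into_left)
    ultimately show ?thesis
      using that(2) by (metis bij_betw_inv_into_left)
  qed
  have "subgroup (hyp_automorphisms g f) (BijGroup ?X)"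
  proof (rule B.subgroupI)
    show "hyp_automorphisms g f \<subseteq> carrier (BijGroup ?X)"
      by (auto simp: hyp_automorphisms_def BijGroup_def)
    have "(\<lambda>P\<in>?X. P) \<in> hyp_automorphisms g f"
    proof -
      have "inv_into ?X (\<lambda>P\<in>?X. P) P = P" if "P \<in> ?X" for P
        using inv_into_f_f[of "\<lambda>P\<in>?X. P" ?X P] that by (simp add: inj_on_def)
      then show ?thesis
        using hyp_morphism_cong[OF hyp_morphism_id, of g f "\<lambda>P\<in>?X. P"]
          hyp_morphism_cong[OF hyp_morphism_id, of g f "inv_into ?X (\<lambda>P\<in>?X. P)"]
        by (simp add: hyp_automorphisms_def id_Bij)
    qed
    then show "hyp_automorphisms g f \<noteq> {}" by blast
  next
    fix \<phi> assume \<phi>: "\<phi> \<in> hyp_automorphisms g f"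
    then have b: "\<phi> \<in> Bij ?X" by (simp add: hyp_automorphisms_def)
    have "hyp_morphism g f g f (restrict (inv_into ?X \<phi>) ?X)"
      by (rule hyp_morphism_cong[of g f g f "inv_into ?X \<phi>"])
        (use \<phi> in \<open>simp_all add: hyp_automorphisms_def\<close>)
    moreover have "hyp_morphism g f g f (inv_into ?X (restrict (inv_into ?X \<phi>) ?X))"
      by (rule hyp_morphism_cong[of g f g f \<phi>])
        (use \<phi> inv_inv[OF b] in \<open>simp_all add: hyp_automorphisms_def\<close>)
    ultimately show "inv\<^bsub>BijGroup ?X\<^esub> \<phi> \<in> hyp_automorphisms g f"
      using b restrict_inv_into_Bij[OF b] by (simp add: inv hyp_automorphisms_def)
  next
    fix \<phi> \<psi> assume \<phi>: "\<phi> \<in> hyp_automorphisms g f" and \<psi>: "\<psi> \<in> hyp_automorphisms g f"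
    then have b: "\<phi> \<in> Bij ?X" "\<psi> \<in> Bij ?X" by (auto simp: hyp_automorphisms_def)
    then have bb: "bij_betw \<phi> ?X ?X" "bij_betw \<psi> ?X ?X" by (auto simp: Bij_def)
    have *: "inv_into ?X (compose ?X \<phi> \<psi>) P = (inv_into ?X \<psi> \<circ> inv_into ?X \<phi>) P"
      if "P \<in> ?X" for P
    proof -
      let ?Q = "inv_into ?X \<psi> (inv_into ?X \<phi> P)"
      have Q: "inv_into ?X \<phi> P \<in> ?X" "?Q \<in> ?X"
        using bb that by (metis bij_betw_def inv_into_into)+
      have "compose ?X \<phi> \<psi> ?Q = P"
        using Q bb that by (simp add: compose_eq bij_betw_inv_into_right)
      moreover have "bij_betw (compose ?X \<phi> \<psi>) ?X ?X"
        using compose_Bij[OF b] by (simp add: Bij_def)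
      ultimately show ?thesis
        using Q by (metis bij_betw_inv_into_left comp_apply)
    qed
    have "hyp_morphism g f g f (inv_into ?X \<psi> \<circ> inv_into ?X \<phi>)"
      by (rule hyp_morphism_comp[of g f g f _ g f])
        (use \<phi> \<psi> in \<open>simp_all add: hyp_automorphisms_def\<close>)
    then have 1: "hyp_morphism g f g f (inv_into ?X (compose ?X \<phi> \<psi>))"
      by (rule hyp_morphism_cong) (simp add: *)
    have "hyp_morphism g f g f (\<phi> \<circ> \<psi>)"
      by (rule hyp_morphism_comp[of g f g f _ g f])
        (use \<phi> \<psi> in \<open>simp_all add: hyp_automorphisms_def\<close>)
    then have "hyp_morphism g f g f (compose ?X \<phi> \<psi>)"
      by (rule hyp_morphism_cong) (simp add: compose_eq)
    with 1 show "\<phi> \<otimes>\<^bsub>BijGroup ?X\<^esub> \<psi> \<in> hyp_automorphisms g f"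
      using b compose_Bij[OF b] by (simp add: BijGroup_def hyp_automorphisms_def)
  qed
  then show ?thesis
    unfolding hyp_Aut_def by (rule B.subgroup_imp_group)
qed


section \<open>Embeddings of small groups\<close>

definition embeds_in :: "('a, 'c) monoid_scheme \<Rightarrow> ('b, 'd) monoid_scheme \<Rightarrow> bool" where
  "embeds_in G H \<longleftrightarrow> mon G H \<noteq> {}"

abbreviation Klein_four_group :: "(int \<times> int) monoid" where
  "Klein_four_group \<equiv> integer_mod_group 2 \<times>\<times> integer_mod_group 2"

abbreviation Z2_cubed :: "(int \<times> int \<times> int) monoid" where
  "Z2_cubed \<equiv> integer_mod_group 2 \<times>\<times> (integer_mod_group 2 \<times>\<times> integer_mod_group 2)"

abbreviation Z2_times_Z4 :: "(int \<times> int) monoid" where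
  "Z2_times_Z4 \<equiv> integer_mod_group 2 \<times>\<times> integer_mod_group 4"


section \<open>The genus 3 curves and their dihedral invariants\<close>

definition octic :: "'k::field \<Rightarrow> 'k \<Rightarrow> 'k \<Rightarrow> 'k poly" where
  "octic a b c = monom 1 8 + monom a 6 + monom b 4 + monom c 2 + 1"

definition quintic :: "'k::field \<Rightarrow> 'k \<Rightarrow> 'k \<Rightarrow> 'k poly" where
  "quintic a b c = monom 1 1 * (monom 1 4 + monom a 3 + monom b 2 + monom c 1 + 1)"

text \<open>
  The curve \<open>X\<close> is \<open>Y\<^sup>2 = octic\<close> of genus 3. The curve \<open>C\<close> is \<open>y\<^sup>2 = quintic\<close> of genus 2, the
  quotient of \<open>X\<close> by the involution \<open>(X, Y) \<mapsto> (- X, - Y)\<close> via \<open>x = X\<^sup>2\<close>, \<open>y = Y X\<close>.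
\<close>

definition Aut_X :: "'k::field \<Rightarrow> 'k \<Rightarrow> 'k \<Rightarrow> ('k hpoint \<Rightarrow> 'k hpoint) monoid" where
  "Aut_X a b c = hyp_Aut 3 (octic a b c)"

definition Aut_C :: "'k::field \<Rightarrow> 'k \<Rightarrow> 'k \<Rightarrow> ('k hpoint \<Rightarrow> 'k hpoint) monoid" where
  "Aut_C a b c = hyp_Aut 2 (quintic a b c)"

definition split_Jacobian_244 :: "'k::field \<Rightarrow> 'k \<Rightarrow> 'k \<Rightarrow> bool" where
  "split_Jacobian_244 a b c \<longleftrightarrow> embeds_in Klein_four_group (Aut_C a b c)"

definition inv_s2 :: "'k::field \<Rightarrow> 'k \<Rightarrow> 'k \<Rightarrow> 'k" where
  "inv_s2 a b c = a * c"

definition inv_s3 :: "'k::field \<Rightarrow> 'k \<Rightarrow> 'k \<Rightarrow> 'k" where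
  "inv_s3 a b c = (a ^ 2 + c ^ 2) * b"

definition inv_s4 :: "'k::field \<Rightarrow> 'k \<Rightarrow> 'k \<Rightarrow> 'k" where
  "inv_s4 a b c = a ^ 4 + c ^ 4"

definition F1 :: "'k::comm_ring_1 \<Rightarrow> 'k \<Rightarrow> 'k \<Rightarrow> 'k" where
  "F1 p q r =
    1024*p^13 - 256*p^12*q + 1536*p^12 - 8448*p^11*q + 2560*p^11*r + 1664*p^10*q^2
    - 512*p^10*q*r + 64*p^9*q^3 + 33600*p^11 - 48720*p^10*q + 10752*p^10*r + 37696*p^9*q^2
    - 20928*p^9*q*r + 2560*p^9*r^2 - 4448*p^8*q^3 + 3008*p^8*q^2*r - 384*p^8*q*r^2
    - 432*p^7*q^4 + 96*p^7*q^3*r - 4*p^6*q^5 + 20000*p^10 - 140000*p^9*q + 84000*p^9*r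
    + 172600*p^8*q^2 - 139200*p^8*q*r + 21120*p^8*r^2 - 71680*p^7*q^3 + 78368*p^7*q^2*r
    - 20736*p^7*q*r^2 + 1280*p^7*r^3 + 2288*p^6*q^4 - 6200*p^6*q^3*r + 2016*p^6*q^2*r^2
    - 128*p^6*q*r^3 + 1256*p^5*q^5 - 568*p^5*q^4*r + 48*p^5*q^3*r^2 + 26*p^4*q^6
    - 4*p^4*q^5*r + 50000*p^8*r + 80000*p^7*q^2 - 280000*p^7*q*r + 84000*p^7*r^2
    - 140000*p^6*q^3 + 345500*p^6*q^2*r - 156600*p^6*q*r^2 + 19200*p^6*r^3 + 30000*p^5*q^4
    - 107520*p^5*q^3*r + 61008*p^5*q^2*r^2 - 10272*p^5*q*r^3 + 320*p^5*r^4 + 8060*p^4*q^5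
    - 204*p^4*q^4*r - 2628*p^4*q^3*r^2 + 592*p^4*q^2*r^3 - 16*p^4*q*r^4 - 1464*p^3*q^6
    + 1256*p^3*q^5*r - 244*p^3*q^4*r^2 + 8*p^3*q^3*r^3 - 72*p^2*q^7 + 21*p^2*q^6*r
    - p^2*q^5*r^2 + 50000*p^6*r^2 + 120000*p^5*q^2*r - 210000*p^5*q*r^2 + 42000*p^5*r^3
    + 40000*p^4*q^4 - 210000*p^4*q^3*r + 259350*p^4*q^2*r^2 - 87000*p^4*q*r^3 + 9120*p^4*r^4
    + 30000*p^3*q^4*r - 53760*p^3*q^3*r^2 + 21080*p^3*q^2*r^3 - 2544*p^3*q*r^4 + 32*p^3*r^5
    - 3600*p^2*q^6 + 8060*p^2*q^5*r - 1920*p^2*q^4*r^2 - 202*p^2*q^3*r^3 + 64*p^2*q^2*r^4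
    - 732*p*q^6*r + 314*p*q^5*r^2 - 34*p*q^4*r^3 + 81*q^8 - 36*q^7*r + 4*q^6*r^2
    + 25000*p^4*r^3 + 60000*p^3*q^2*r^2 - 70000*p^3*q*r^3 + 10500*p^3*r^4 + 40000*p^2*q^4*r
    - 105000*p^2*q^3*r^2 + 86525*p^2*q^2*r^3 - 23925*p^2*q*r^4 + 2208*p^2*r^5
    + 7500*p*q^4*r^2 - 8960*p*q^3*r^3 + 2728*p*q^2*r^4 - 252*p*q*r^5 - 1800*q^6*r
    + 2015*q^5*r^2 - 623*q^4*r^3 + 59*q^3*r^4 + 6250*p^2*r^4 + 10000*p*q^2*r^3 - 8750*p*q*r^4
    + 1050*p*r^5 + 10000*q^4*r^2 - 17500*q^3*r^3 + 10825*q^2*r^4 - 2610*q*r^5 + 216*r^6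
    + 625*r^5"

end

theory Submission
  imports Defs
begin

text \<open>
  An automorphism of \<open>C\<close> commutes with the hyperelliptic involution: if \<open>u = x \<circ> \<phi>\<close> were not in \<open>k(x)\<close>,
  the relation of bidegree \<open>(2, 2)\<close> between \<open>x\<close> and \<open>u\<close> would have a discriminant of degree at most 4
  in \<open>x\<close> that is a square times the quintic. Hence \<open>u\<close> is a Moebius transformation permuting the six
  branch points. A Klein four-group contains an involution \<open>\<phi>\<close> that is neither the identity nor the
  hyperelliptic involution; its Moebius transformation is an involution without fixed branch points.
  If it exchanges \<open>0\<close> and \<open>\<infinity>\<close>, then \<open>a = c\<close> or \<open>a = - c\<close>, and the sign changes together with
  \<open>(X, Y) \<mapsto> (\<mu> / X, Y / X\<^sup>4)\<close>, where \<open>\<mu>\<^sup>4 = 1\<close>, generate a group \<open>\<int>\<^sub>2\<^sup>3\<close> of automorphisms of \<open>X\<close>.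
  Otherwise it exchanges \<open>0\<close> with a root \<open>p\<close> and \<open>\<infinity>\<close> with a root \<open>q\<close> of the quartic, and the two
  remaining roots with each other. This is a polynomial condition on the root \<open>e = pq + 1/(pq)\<close> of the
  resolvent cubic, and \<open>F\<^sub>1\<close> is \<open>(a\<^sup>2 + c\<^sup>2)\<^sup>8\<close> times the resultant of the two polynomials.
\<close>

section \<open>Involutions of the branch points\<close>

text \<open>What shapes the proof is the distance between geometry and algebra: an automorphism is a
  map of points that is Zariski continuous and pulls back regular functions, and the function field
  is not at hand as a field. Its elements are represented by functions on the affine curve, compared
  up to finitely many points. As the quintic has odd degree, p^2 - q^2 f vanishes only for p = q =
  0, so p + q y is determined by its generic values and can be inverted. A sign is decisive: a
  Moebius involution may lift to C with order 4. Since \<phi> itself has order 2, the sextic form is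
  multiplied by exactly (\<alpha>^2 + \<beta>\<gamma>)^3, and this is why no branch point is fixed.
  In the elimination W stands for a^2 + c^2, so that s3 = W b and s4 = W^2 - 2 s2^2. The resultant
  is a polynomial in s2, b and W in which every monomial b^i W^j has i at most 8 and i + j even; the
  factor W^8 is what makes it a polynomial in s2, s3, s4.\<close>

lemma F1_eq_resultant:
  fixes p b W :: "'k::field_char_0"
  shows "F1 p (W*b) (W^2 - 2*p^2) = W^8 *
    (81*b^8 - 36*b^7*W + 5*b^6*p^2 - 732*b^6*p + 4*b^6*W^2 - 1800*b^6 - b^5*p^2*W + 314*b^5*p*W
     + 2015*b^5*W - 40*b^4*p^3 + 1818*b^4*p^2 - 34*b^4*p*W^2 + 7500*b^4*p - 623*b^4*W^2 + 10000*b^4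
     + 8*b^3*p^3*W - 674*b^3*p^2*W - 8960*b^3*p*W + 59*b^3*W^3 - 17500*b^3*W + 80*b^2*p^4
     - 744*b^2*p^3 + 64*b^2*p^2*W^2 - 75*b^2*p^2 + 2728*b^2*p*W^2 + 10000*b^2*p + 10825*b^2*W^2
     - 16*b*p^4*W - 24*b*p^3*W + 2175*b*p^2*W - 252*b*p*W^3 - 8750*b*p*W - 2610*b*W^3
     + 32*p^3*W^2 - 384*p^2*W^2 + 1050*p*W^2 + 216*W^4 + 625*W^2)"
  unfolding F1_def by algebra

lemma resultant_eq_0:
  fixes p b W e :: "'k::field_char_0"
  assumes "e^3 - b*e^2 + (p - 4)*e - (W - 4*b) = 0"
    and "e*(2*e - b)*(3*e^2 - 2*b*e + p) + (b - e)^2 = 0"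
  shows "81*b^8 - 36*b^7*W + 5*b^6*p^2 - 732*b^6*p + 4*b^6*W^2 - 1800*b^6 - b^5*p^2*W + 314*b^5*p*W
     + 2015*b^5*W - 40*b^4*p^3 + 1818*b^4*p^2 - 34*b^4*p*W^2 + 7500*b^4*p - 623*b^4*W^2 + 10000*b^4
     + 8*b^3*p^3*W - 674*b^3*p^2*W - 8960*b^3*p*W + 59*b^3*W^3 - 17500*b^3*W + 80*b^2*p^4
     - 744*b^2*p^3 + 64*b^2*p^2*W^2 - 75*b^2*p^2 + 2728*b^2*p*W^2 + 10000*b^2*p + 10825*b^2*W^2
     - 16*b*p^4*W - 24*b*p^3*W + 2175*b*p^2*W - 252*b*p*W^3 - 8750*b*p*W - 2610*b*W^3
     + 32*p^3*W^2 - 384*p^2*W^2 + 1050*p*W^2 + 216*W^4 + 625*W^2 = 0" (is "?R = 0")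
proof -
  \<comment> \<open>Column \<open>j\<close> holds the coefficients of \<open>e ^ j\<close> times the second polynomial modulo the cubic, so
    \<open>(1, e, e\<^sup>2)\<close> is in the left kernel; the determinant is the resultant.\<close>
  let ?M00 = "5*b^2 - b*W" and ?M10 = "6*W - 30*b" and ?M20 = "b^2 - 4*p + 25"
  let ?M01 = "b^2*W - 4*b^3 + 16*b*p - 100*b - 4*p*W + 25*W"
  let ?M11 = "9*b^2 - b^2*p - b*W + 4*p^2 - 41*p + 100"
  let ?M21 = "b^3 - 4*b*p - 5*b + 6*W"
  let ?M02 = "b^3*W - 4*b^4 + 16*b^2*p + 20*b^2 - 4*b*p*W - 29*b*W + 6*W^2"
  let ?M12 = "b^2*W - b^3*p + 4*b*p^2 + 5*b*p - 120*b - 10*p*W + 49*W"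
  let ?M22 = "b^4 - 5*b^2*p + 4*b^2 + 5*b*W + 4*p^2 - 41*p + 100"
  have r0: "?M00 + ?M10*e + ?M20*e^2 = 0" using assms by algebra
  have r1: "?M01 + ?M11*e + ?M21*e^2 = 0" using assms(1) r0 by algebra
  have r2: "?M02 + ?M12*e + ?M22*e^2 = 0" using assms(1) r1 by algebra
  have "?R = ?M00*(?M11*?M22 - ?M12*?M21) - ?M01*(?M10*?M22 - ?M12*?M20) + ?M02*(?M10*?M21 - ?M11*?M20)"
    by algebra
  also have "\<dots> = (?M00 + ?M10*e + ?M20*e^2)*(?M11*?M22 - ?M12*?M21)
     - (?M01 + ?M11*e + ?M21*e^2)*(?M10*?M22 - ?M12*?M20)
     + (?M02 + ?M12*e + ?M22*e^2)*(?M10*?M21 - ?M11*?M20)"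
    by algebra
  finally show ?thesis unfolding r0 r1 r2 by simp
qed


text \<open>\<open>p\<close> and \<open>q\<close> are the roots exchanged with \<infinity> and 0,
  and \<open>s\<close>, \<open>t\<close> are the sum and the product of the other two; t + pq = sp
  says that these are exchanged too. The cubic for e is the resolvent of the quartic for this
  partition of its roots. The second equation is (u s^2)(t w^2) = (s w)^2, which holds as ut = 1;
  each of u s^2, t w^2 and s w is a polynomial in e.\<close>

lemma F1_eq_0_of_partition:
  fixes a b c p q s t :: "'k::field_char_0"
  assumes a: "a = - (p + q + s)" and b: "b = p*q + t + (p + q)*s" and c: "c = - (p*q*s + (p + q)*t)"
    and t: "p*q*t = 1" and s: "t + p*q = s*p"
  shows "F1 (a*c) ((a^2 + c^2)*b) (a^4 + c^4) = 0"
proof -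
  define u w where "u = p*q" and "w = p + q"
  define e where "e = u + t"
  have abc: "a = - (w + s)" "b = e + w*s" "c = - (u*s + w*t)" and ut: "u*t = 1"
    using assms by (simp_all add: u_def w_def e_def)
  have cubic: "e^3 - b*e^2 + (a*c - 4)*e - ((a^2 + c^2) - 4*b) = 0"
    unfolding abc e_def using ut by algebra
  \<comment> \<open>Since e = sp and p is a root of X^2 - w X + u, multiplying by s^2 leaves an
    equation in which p occurs only through symmetric functions.\<close>
  have e: "e^2 - e*s*w + u*s^2 = 0"
    unfolding e_def u_def w_def using s by algebra
  have us: "u*s^2 = - (2*e^2 - b*e)"
    using e abc(2) by algebra
  have tw: "t*w^2 = a*c - e*(b - e) - u*s^2"
    unfolding abc e_def by algebra
  have "(u*s^2)*(t*w^2) = (b - e)^2"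
    using ut abc(2) by algebra
  then have "e*(2*e - b)*(3*e^2 - 2*b*e + a*c) + (b - e)^2 = 0"
    unfolding tw us by algebra
  from resultant_eq_0[OF cubic this] F1_eq_resultant[of "a*c" "a^2 + c^2" b]
  have "F1 (a*c) ((a^2 + c^2)*b) ((a^2 + c^2)^2 - 2*(a*c)^2) = 0"
    by simp
  moreover have "(a^2 + c^2)^2 - 2*(a*c)^2 = a^4 + c^4" by algebra
  ultimately show ?thesis by simp
qed

section \<open>Involutions of the line that preserve the binary sextic\<close>

lemma poly_eqI_infinite:
  fixes P Q :: "'k::idom poly"
  assumes "infinite {x. poly P x = poly Q x}"
  shows "P = Q"
proof (rule ccontr)
  assume "P \<noteq> Q"
  then have "finite {x. poly (P - Q) x = 0}" by (intro poly_roots_finite) simp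
  with assms show False by simp
qed

text \<open>Leaving out 0 allows a factor x to be cancelled first; the resulting identity can then
  be evaluated at 0 itself.\<close>

lemma poly_eqI_nonzero:
  fixes P Q :: "'k::field_char_0 poly"
  assumes "\<And>x. x \<noteq> 0 \<Longrightarrow> poly P x = poly Q x"
  shows "P = Q"
proof (rule poly_eqI_infinite)
  have "infinite (UNIV - {0 :: 'k})" by (simp add: infinite_UNIV_char_0)
  then show "infinite {x. poly P x = poly Q x}"
    by (rule infinite_super[rotated]) (use assms in auto)
qed

text \<open>The six branch points of \<open>C\<close>, including \<open>\<infinity>\<close>, are the zeros of this binary sextic.\<close>

definition sextic_form :: "'k::field \<Rightarrow> 'k \<Rightarrow> 'k \<Rightarrow> 'k \<Rightarrow> 'k \<Rightarrow> 'k" where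
  "sextic_form a b c x z = x * z * (x^4 + a * x^3 * z + b * x^2 * z^2 + c * x * z^3 + z^4)"

lemma sextic_form_scale: "sextic_form a b c (r*x) (r*z) = r^6 * sextic_form a b c x z"
  unfolding sextic_form_def by algebra

lemma poly_quintic: "poly (quintic a b c) x = sextic_form a b c x 1"
  by (simp add: quintic_def sextic_form_def poly_monom algebra_simps)

text \<open>The hypothesis speaks of the points (x : 1) only. Scaling covers z \<noteq> 0, and in
  the coordinate y at infinity both sides are polynomials agreeing for y \<noteq> 0, hence also at y
  = 0.\<close>

lemma involution_sextic_homogeneous:
  fixes a b c \<alpha> \<beta> \<gamma> D x z :: "'k::field_char_0"
  assumes "\<And>x. sextic_form a b c (\<alpha>*x + \<beta>) (\<gamma>*x - \<alpha>) = D * sextic_form a b c x 1"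
  shows "sextic_form a b c (\<alpha>*x + \<beta>*z) (\<gamma>*x - \<alpha>*z) = D * sextic_form a b c x z"
proof (cases "z = 0")
  case False
  have "sextic_form a b c (\<alpha>*x + \<beta>*z) (\<gamma>*x - \<alpha>*z) =
      sextic_form a b c (z*(\<alpha>*(x/z) + \<beta>)) (z*(\<gamma>*(x/z) - \<alpha>))"
    using False by (simp add: algebra_simps)
  also have "\<dots> = D * sextic_form a b c (z * (x/z)) (z * 1)"
    unfolding sextic_form_scale assms by simp
  finally show ?thesis using False by simp
next
  case True
  have *: "sextic_form a b c (\<alpha> + \<beta>*y) (\<gamma> - \<alpha>*y) = D * sextic_form a b c 1 y" if "y \<noteq> 0" for y
  proof -
    have "sextic_form a b c (\<alpha> + \<beta>*y) (\<gamma> - \<alpha>*y) =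
        sextic_form a b c (y*(\<alpha>*(1/y) + \<beta>)) (y*(\<gamma>*(1/y) - \<alpha>))"
      using that by (simp add: algebra_simps)
    also have "\<dots> = D * sextic_form a b c (y * (1/y)) (y * 1)"
      unfolding sextic_form_scale assms by simp
    finally show ?thesis using that by simp
  qed
  let ?n = "[:\<alpha>, \<beta>:]" and ?w = "[:\<gamma>, -\<alpha>:]" and ?z = "[:0, 1::'k:]"
  have "?n*?w*(?n^4 + [:a:]*?n^3*?w + [:b:]*?n^2*?w^2 + [:c:]*?n*?w^3 + ?w^4) =
      [:D:]*?z*(1 + [:a:]*?z + [:b:]*?z^2 + [:c:]*?z^3 + ?z^4)" (is "?P = ?Q")
    by (rule poly_eqI_nonzero) (use * in \<open>simp add: sextic_form_def algebra_simps\<close>)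
  then have "poly ?P 0 = poly ?Q 0" by simp
  then have "sextic_form a b c \<alpha> \<gamma> = 0" by (simp add: sextic_form_def algebra_simps)
  then show ?thesis
    unfolding True using sextic_form_scale[of a b c x \<alpha> \<gamma>]
    by (simp add: mult.commute) (simp add: sextic_form_def)
qed

text \<open>With D = \<alpha>^2 + \<beta>\<gamma>, the trace-zero substitution multiplies a
  quadratic form with exchanged roots by D and the form of its two fixed points by -D. So the
  multiplier D^3 means that the six branch points form three exchanged pairs.\<close>

lemma sextic_involution_cases:
  fixes a b c \<alpha> \<beta> \<gamma> :: "'k::field_char_0"
  assumes D0: "\<alpha>^2 + \<beta>*\<gamma> \<noteq> 0"
    and S1: "\<And>x. sextic_form a b c (\<alpha>*x + \<beta>) (\<gamma>*x - \<alpha>) =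
      (\<alpha>^2 + \<beta>*\<gamma>)^3 * sextic_form a b c x 1"
  shows "a = c \<or> a = - c \<or> F1 (a*c) ((a^2 + c^2)*b) (a^4 + c^4) = 0"
proof -
  let ?D = "(\<alpha>^2 + \<beta>*\<gamma>)^3"
  have S: "sextic_form a b c (\<alpha>*x + \<beta>*z) (\<gamma>*x - \<alpha>*z) = ?D * sextic_form a b c x z" for x z
    using S1 by (rule involution_sextic_homogeneous)
  show ?thesis
  proof (cases "\<alpha> = 0")
    case True
    let ?z = "[:0, 1::'k:]"
    have bg: "\<beta> \<noteq> 0" "\<gamma> \<noteq> 0" using D0 True by auto
    \<comment> \<open>Here x goes to \<beta> / (\<gamma> x), so 0 and \<infinity> are exchanged and
      the coefficients of the quartic are reversed up to scaling.\<close>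
    have "[:\<beta>^4:] + [:a*\<beta>^3*\<gamma>:]*?z + [:b*\<beta>^2*\<gamma>^2:]*?z^2 + [:c*\<beta>*\<gamma>^3:]*?z^3 + [:\<gamma>^4:]*?z^4 =
        [:\<beta>^2*\<gamma>^2:]*(1 + [:c:]*?z + [:b:]*?z^2 + [:a:]*?z^3 + ?z^4)" (is "?P = ?Q")
    proof (rule poly_eqI_nonzero)
      fix x :: 'k assume x: "x \<noteq> 0"
      have "sextic_form a b c \<beta> (\<gamma>*x) = \<beta>^3*\<gamma>^3 * sextic_form a b c x 1"
        using S1[of x] True by (simp add: power_mult_distrib)
      then have "\<beta>*\<gamma>*x * (poly ?P x - poly ?Q x) = 0"
        by (simp add: sextic_form_def) algebra
      then show "poly ?P x = poly ?Q x" using x bg by simp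
    qed
    then have "coeff ?P i = coeff ?Q i" for i by simp
    from this[of 0] this[of 1] this[of 3]
    have "\<beta>^4 = \<beta>^2*\<gamma>^2" "a*\<beta>^3*\<gamma> = \<beta>^2*\<gamma>^2*c"
      by (simp_all add: numeral_eq_Suc)
    then have "\<beta>^2 = \<gamma>^2" "a*\<beta> = c*\<gamma>"
      using bg by (simp_all add: power_numeral_reduce)
    then have "\<gamma>^2*(a^2 - c^2) = 0" by algebra
    then have "a^2 = c^2" using bg by simp
    then show ?thesis unfolding power2_eq_iff by blast
  next
    case \<alpha>: False
    \<comment> \<open>For \<gamma> = 0 the branch point \<infinity> is fixed. Cancelling the factor
      that vanishes there and evaluating gives -\<alpha>^6 = \<alpha>^6. The argument for \<beta> =
      0 is the same at the branch point 0.\<close>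
    have \<gamma>: "\<gamma> \<noteq> 0"
    proof
      assume \<gamma>: "\<gamma> = 0"
      let ?n = "[:\<alpha>, \<beta>:]" and ?z = "[:0, 1::'k:]"
      have "[:-\<alpha>:]*?n*(?n^4 - [:a*\<alpha>:]*?n^3*?z + [:b*\<alpha>^2:]*?n^2*?z^2 - [:c*\<alpha>^3:]*?n*?z^3 + [:\<alpha>^4:]*?z^4)
         = [:\<alpha>^6:]*(1 + [:a:]*?z + [:b:]*?z^2 + [:c:]*?z^3 + ?z^4)" (is "?P = ?Q")
      proof (rule poly_eqI_nonzero)
        fix x :: 'k assume x: "x \<noteq> 0"
        have "sextic_form a b c (\<alpha> + \<beta>*x) (- \<alpha>*x) = \<alpha>^6 * sextic_form a b c 1 x"
          using S[of 1 x] \<gamma> by simp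
        then have "x * (poly ?P x - poly ?Q x) = 0"
          by (simp add: sextic_form_def) algebra
        then show "poly ?P x = poly ?Q x" using x by simp
      qed
      then have "poly ?P 0 = poly ?Q 0" by simp
      then have "2*\<alpha>^6 = 0" by simp algebra
      then show False using \<alpha> by simp
    qed
    have \<beta>: "\<beta> \<noteq> 0"
    proof
      assume \<beta>: "\<beta> = 0"
      let ?w = "[:-\<alpha>, \<gamma>:]" and ?x = "[:0, 1::'k:]"
      have "[:\<alpha>:]*?w*([:\<alpha>^4:]*?x^4 + [:a*\<alpha>^3:]*?x^3*?w + [:b*\<alpha>^2:]*?x^2*?w^2 + [:c*\<alpha>:]*?x*?w^3 + ?w^4)
         = [:\<alpha>^6:]*(?x^4 + [:a:]*?x^3 + [:b:]*?x^2 + [:c:]*?x + 1)" (is "?P = ?Q")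
      proof (rule poly_eqI_nonzero)
        fix x :: 'k assume x: "x \<noteq> 0"
        have "sextic_form a b c (\<alpha>*x) (\<gamma>*x - \<alpha>) = \<alpha>^6 * sextic_form a b c x 1"
          using S1[of x] \<beta> by simp
        then have "x * (poly ?P x - poly ?Q x) = 0"
          by (simp add: sextic_form_def) algebra
        then show "poly ?P x = poly ?Q x" using x by simp
      qed
      then have "poly ?P 0 = poly ?Q 0" by simp
      then have "2*\<alpha>^6 = 0" by simp algebra
      then show False using \<alpha> by simp
    qed
    \<comment> \<open>The images of \<infinity> and of 0.\<close>
    define p q where "p = \<alpha>/\<gamma>" and "q = - \<beta>/\<alpha>"
    have p0: "p \<noteq> 0" and q0: "q \<noteq> 0" using \<alpha> \<beta> \<gamma> by (simp_all add: p_def q_def)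
    have \<alpha>p: "\<alpha> = \<gamma>*p" and \<beta>q: "\<beta> = - (\<gamma>*p*q)" using \<alpha> \<gamma> by (simp_all add: p_def q_def)
    have pq: "p \<noteq> q" using D0 unfolding \<alpha>p \<beta>q by (auto simp: power2_eq_square)
    have "sextic_form a b c p 1 = 0"
      using S[of 1 0] sextic_form_scale[of a b c \<gamma> p 1] \<gamma> \<alpha>p
      by (simp add: sextic_form_def[of a b c 1 0])
    then have gp: "p^4 + a*p^3 + b*p^2 + c*p + 1 = 0" using p0 by (simp add: sextic_form_def)
    have "sextic_form a b c q 1 = 0"
      using S[of 0 1] sextic_form_scale[of a b c "-\<alpha>" q 1] \<alpha>
      by (simp add: sextic_form_def[of a b c 0 1] q_def)
    then have gq: "q^4 + a*q^3 + b*q^2 + c*q + 1 = 0" using q0 by (simp add: sextic_form_def)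
    define s t where "s = - a - p - q" and "t = 1/(p*q)"
    have t: "p*q*t = 1" using p0 q0 by (simp add: t_def)
    \<comment> \<open>?B x^2 + ?C x + (1 - pqt) is the quartic minus (x - p)(x - q)(x^2 - s x + t).
      Its constant term is zero, and the linear polynomial ?B x + ?C has two distinct roots p and
      q.\<close>
    let ?B = "b - (p*q + t + (p + q)*s)" and ?C = "c + (p*q*s + (p + q)*t)"
    have "p*(?B*p + ?C) = (p^4 + a*p^3 + b*p^2 + c*p + 1) - (1 - p*q*t)"
        "q*(?B*q + ?C) = (q^4 + a*q^3 + b*q^2 + c*q + 1) - (1 - p*q*t)"
      unfolding s_def by algebra+
    then have "p*(?B*p + ?C) = 0" "q*(?B*q + ?C) = 0"
      unfolding gp gq t by simp_all
    then have BC: "?B*p + ?C = 0" "?B*q + ?C = 0" using p0 q0 by auto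
    then have "?B*(p - q) = 0" by algebra
    then have B: "?B = 0" using pq by simp
    with BC(1) have C: "?C = 0" by simp
    have S': "sextic_form a b c (p*(x - q)) (x - p) = (p*(p - q))^3 * sextic_form a b c x 1" for x
    proof -
      have n: "\<alpha>*x + \<beta> = \<gamma>*(p*(x - q))" and w: "\<gamma>*x - \<alpha> = \<gamma>*(x - p)"
        by (simp_all add: \<alpha>p \<beta>q algebra_simps)
      have "\<alpha>^2 + \<beta>*\<gamma> = \<gamma>^2*(p*(p - q))"
        by (simp add: \<alpha>p \<beta>q algebra_simps power2_eq_square)
      then have D: "?D = \<gamma>^6*(p*(p - q))^3"
        by (simp only: power_mult_distrib power_mult[symmetric]) simp
      have "\<gamma>^6 * sextic_form a b c (p*(x - q)) (x - p) = \<gamma>^6 * ((p*(p - q))^3 * sextic_form a b c x 1)"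
        using S1[of x] unfolding n w sextic_form_scale D by (simp only: mult.assoc)
      moreover have "\<gamma>^6 \<noteq> 0" using \<gamma> by simp
      ultimately show ?thesis using mult_left_cancel by blast
    qed
    have fac: "sextic_form a b c x z = x*z*(x - p*z)*(x - q*z)*(x^2 - s*x*z + t*z^2)" for x z
    proof -
      have "a = - (p + q + s)" "b = p*q + t + (p + q)*s" "c = - (p*q*s + (p + q)*t)"
        using B C by (simp_all only: right_minus_eq eq_neg_iff_add_eq_0) (simp_all add: s_def)
      then have "sextic_form a b c x z =
          x*z*((x - p*z)*(x - q*z)*(x^2 - s*x*z + t*z^2) + (1 - p*q*t)*z^4)"
        unfolding sextic_form_def by algebra
      then show ?thesis by (simp add: t)
    qed
    \<comment> \<open>The involution is x -> p(x - q)/(x - p). Once the four known linear factors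
      are cancelled, it must multiply the remaining quadratic by p(p - q).\<close>
    let ?n = "[:-(p*q), p:]" and ?w = "[:-p, 1:]" and ?x = "[:0, 1::'k:]"
    have "?n^2 - [:s:]*?n*?w + [:t:]*?w^2 = [:p*(p - q):]*(?x^2 - [:s:]*?x + [:t:])" (is "?P = ?Q")
    proof (rule poly_eqI_infinite)
      have inf: "infinite (UNIV - {0, p, q})" by (simp add: infinite_UNIV_char_0)
      have "poly ?P x = poly ?Q x" if "x \<in> UNIV - {0, p, q}" for x
      proof -
        have 0: "p^2*(p - q)^2*x*(x - q)*(x - p) * (poly ?P x - poly ?Q x) = 0"
        proof -
          have f1: "sextic_form a b c x 1 = x*(x - p)*(x - q)*(x^2 - s*x + t)"
            using fac[of x 1] by simp
          have f2: "p*(x - q) - p*(x - p) = p*(p - q)" "p*(x - q) - q*(x - p) = (p - q)*x"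
            by (simp_all add: algebra_simps)
          have main: "p*(x - q)*(x - p)*(p*(p - q))*((p - q)*x) *
              ((p*(x - q))^2 - s*(p*(x - q))*(x - p) + t*(x - p)^2) =
              (p*(p - q))^3 * (x*(x - p)*(x - q)*(x^2 - s*x + t))"
            using S'[of x] by (simp only: fac[of "p*(x - q)"] f1 f2)
          have eqs: "poly ?P x = (p*(x - q))^2 - s*(p*(x - q))*(x - p) + t*(x - p)^2"
              "poly ?Q x = p*(p - q)*(x^2 - s*x + t)"
            by (simp_all add: algebra_simps)
          have gen: "p^2*d^2*x*A*B*(N - p*d*M) = 0"
            if "p*A*B*(p*d)*(d*x)*N = (p*d)^3*(x*B*A*M)" for A B N M d :: 'k
          proof -
            have "p^2*d^2*x*A*B*(N - p*d*M) = p*A*B*(p*d)*(d*x)*N - (p*d)^3*(x*B*A*M)"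
              by algebra
            with that show ?thesis by simp
          qed
          show ?thesis unfolding eqs by (rule gen) (rule main)
        qed
        have nz: "p^2*(p - q)^2*x*(x - q)*(x - p) \<noteq> 0" using that p0 pq by simp
        have "poly ?P x - poly ?Q x = 0"
          by (rule disjE[OF mult_eq_0_iff[THEN iffD1, OF 0] notE[OF nz]])
        then show ?thesis by (simp only: right_minus_eq)
      qed
      then have "UNIV - {0, p, q} \<subseteq> {x. poly ?P x = poly ?Q x}" by blast
      with inf show "infinite {x. poly ?P x = poly ?Q x}" using infinite_super by blast
    qed
    \<comment> \<open>In terms of the remaining roots r1 and r2, the leading coefficients say (p -
      r1)(p - r2) = p(p - q), which is the condition that the involution exchanges them.\<close>
    then have "coeff ?P 2 = coeff ?Q 2" by simp
    then have "p^2 - s*p + t = p*(p - q)" by (simp add: numeral_eq_Suc mult.commute)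
    then have "t + p*q = s*p" by algebra
    moreover have "a = - (p + q + s)" by (simp add: s_def)
    moreover have "b = p*q + t + (p + q)*s" using B by (simp only: right_minus_eq)
    moreover have "c = - (p*q*s + (p + q)*t)" using C by (simp only: eq_neg_iff_add_eq_0)
    ultimately have "F1 (a*c) ((a^2 + c^2)*b) (a^4 + c^4) = 0"
      using F1_eq_0_of_partition t by blast
    then show ?thesis by blast
  qed
qed

section \<open>Automorphisms of the octic curve\<close>

lemma poly2_0 [simp]: "poly2 0 z = 0"
  by (simp add: poly2_def)

lemma poly2_1 [simp]: "poly2 1 z = 1"
  by (simp add: poly2_def)

lemma poly2_pCons [simp]: "poly2 (pCons a F) z = poly a (fst z) + snd z * poly2 F z"
  by (simp add: poly2_def)

lemma poly2_rescale:
  "\<exists>G'. \<forall>x y. poly2 G' (x, y) = poly2 G (\<kappa>*x, \<nu>*y)"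
proof (induction G)
  case 0
  show ?case by (rule exI[of _ 0]) simp
next
  case (pCons a G)
  then obtain G' where "\<forall>x y. poly2 G' (x, y) = poly2 G (\<kappa>*x, \<nu>*y)" by blast
  then show ?case
    by (intro exI[of _ "pCons (pcompose a [:0, \<kappa>:]) (smult [:\<nu>:] G')"])
      (simp add: poly_pcompose poly2_def algebra_simps)
qed

text \<open>If a map is diagonal between charts, polynomials pull back to polynomials, so basic open
  sets pull back to basic open sets and quotients to quotients. The source chart may differ from the
  target chart, as it does for the inversion.\<close>

lemma hyp_morphism_diagonal:
  fixes \<phi> :: "'k::field hpoint \<Rightarrow> 'k hpoint"
  assumes maps: "\<And>P. P \<in> hyp_points g f \<Longrightarrow> \<phi> P \<in> hyp_points g' f'"
    and diag: "\<And>\<chi>. \<chi> \<in> charts g' \<Longrightarrow> \<exists>\<chi>'\<in>charts g. \<exists>\<kappa> \<nu>. \<forall>P\<in>hyp_points g f.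
      \<chi> (\<phi> P) = map_option (\<lambda>(x, y). (\<kappa>*x, \<nu>*y)) (\<chi>' P)"
  shows "hyp_morphism g f g' f' \<phi>"
proof -
  let ?X = "hyp_points g f"
  \<comment> \<open>\<open>F'\<close> in the chart \<open>\<chi>'\<close> is the pullback of
    \<open>F\<close> in the chart \<open>\<chi>\<close>; \<open>rel_option\<close> also records that
    the two charts are defined at corresponding points.\<close>
  define pulled where "pulled \<chi> \<chi>' F F' \<longleftrightarrow> (\<forall>P\<in>?X. rel_option (\<lambda>z' z. poly2 F' z' = poly2 F z) (\<chi>' P) (\<chi> (\<phi> P)))"
    for \<chi> \<chi>' :: "'k hpoint \<Rightarrow> ('k \<times> 'k) option" and F F'
  have pull: "\<exists>\<chi>'\<in>charts g. \<forall>F. \<exists>F'. pulled \<chi> \<chi>' F F'" if \<chi>: "\<chi> \<in> charts g'" for \<chi>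
  proof -
    obtain \<chi>' \<kappa> \<nu> where *: "\<chi>' \<in> charts g"
        "\<And>P. P \<in> ?X \<Longrightarrow> \<chi> (\<phi> P) = map_option (\<lambda>(x, y). (\<kappa>*x, \<nu>*y)) (\<chi>' P)"
      using diag[OF \<chi>] by blast
    have "\<exists>F'. pulled \<chi> \<chi>' F F'" for F
    proof -
      obtain F' where F': "\<And>x y. poly2 F' (x, y) = poly2 F (\<kappa>*x, \<nu>*y)"
        using poly2_rescale by blast
      have "rel_option (\<lambda>z' z. poly2 F' z' = poly2 F z) (\<chi>' P) (\<chi> (\<phi> P))" if "P \<in> ?X" for P
        unfolding *(2)[OF that] by (cases "\<chi>' P") (auto simp: F')
      then show ?thesis unfolding pulled_def by blast
    qed
    with *(1) show ?thesis by blast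
  qed
  have nonvan: "\<phi> P \<in> nonvanishing \<chi> G \<longleftrightarrow> P \<in> nonvanishing \<chi>' G'"
    if "pulled \<chi> \<chi>' G G'" "P \<in> ?X" for \<chi> \<chi>' G G' P
  proof -
    have "rel_option (\<lambda>z' z. poly2 G' z' = poly2 G z) (\<chi>' P) (\<chi> (\<phi> P))"
      using that by (simp add: pulled_def)
    then show ?thesis by (cases rule: option.rel_cases) (auto simp: nonvanishing_def)
  qed
  have cont: "continuous_map (zariski g f) (zariski g' f') \<phi>"
    unfolding zariski_def[of g' f']
  proof (rule continuous_on_generated_topo)
    fix U assume "U \<in> {hyp_points g' f' \<inter> nonvanishing \<chi> G |\<chi> G. \<chi> \<in> charts g'}"
    then obtain \<chi> G where U: "U = hyp_points g' f' \<inter> nonvanishing \<chi> G" and \<chi>: "\<chi> \<in> charts g'"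
      by blast
    obtain \<chi>' G' where \<chi>': "\<chi>' \<in> charts g" and "pulled \<chi> \<chi>' G G'"
      using pull[OF \<chi>] by blast
    then have "\<phi> -` U \<inter> topspace (zariski g f) = ?X \<inter> nonvanishing \<chi>' G'"
      using nonvan[of \<chi> \<chi>' G G'] maps by (auto simp: U)
    then show "openin (zariski g f) (\<phi> -` U \<inter> topspace (zariski g f))"
      unfolding zariski_def using \<chi>' by (auto intro!: topology_generated_by_Basis)
  next
    show "\<phi> ` topspace (zariski g f) \<subseteq> \<Union> {hyp_points g' f' \<inter> nonvanishing \<chi> G |\<chi> G. \<chi> \<in> charts g'}"
      using maps topspace_zariski[of g' f'] unfolding zariski_def[of g' f'] by auto
  qed
  moreover have "regular_on g f {P \<in> ?X. \<phi> P \<in> V} (h \<circ> \<phi>)"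
    if V: "openin (zariski g' f') V" "regular_on g' f' V h" for V h
    unfolding regular_on_def
  proof
    fix P assume P: "P \<in> {P \<in> ?X. \<phi> P \<in> V}"
    then have "\<phi> P \<in> V" by simp
    with V(2) obtain U \<chi> F G where U: "openin (zariski g' f') U" "\<phi> P \<in> U" "U \<subseteq> V" "\<chi> \<in> charts g'"
        "U \<subseteq> nonvanishing \<chi> G" "\<forall>Q\<in>U. h Q = poly2 F (the (\<chi> Q)) / poly2 G (the (\<chi> Q))"
      unfolding regular_on_def by meson
    obtain \<chi>' F' G' where \<chi>': "\<chi>' \<in> charts g" and F': "pulled \<chi> \<chi>' F F'"
        and G': "pulled \<chi> \<chi>' G G'"
      using pull[OF U(4)] by blast
    let ?W = "{Q \<in> ?X. \<phi> Q \<in> U}"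
    have W1: "openin (zariski g f) ?W"
      using cont U(1) by (auto simp: continuous_map_def)
    have W2: "P \<in> ?W" "?W \<subseteq> {P \<in> ?X. \<phi> P \<in> V}" using P U by auto
    have W: "?W \<subseteq> nonvanishing \<chi>' G'"
      using U(5) nonvan[OF G'] by auto
    have W3: "(h \<circ> \<phi>) Q = poly2 F' (the (\<chi>' Q)) / poly2 G' (the (\<chi>' Q))" if Q: "Q \<in> ?W" for Q
    proof -
      have "rel_option (\<lambda>z' z. poly2 F' z' = poly2 F z) (\<chi>' Q) (\<chi> (\<phi> Q))"
          "rel_option (\<lambda>z' z. poly2 G' z' = poly2 G z) (\<chi>' Q) (\<chi> (\<phi> Q))"
        using Q F' G' by (simp_all add: pulled_def)
      moreover obtain z where "\<chi>' Q = Some z"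
        using Q W by (auto simp: nonvanishing_def)
      moreover have "h (\<phi> Q) = poly2 F (the (\<chi> (\<phi> Q))) / poly2 G (the (\<chi> (\<phi> Q)))"
        using Q U(6) by blast
      ultimately show ?thesis by (cases "\<chi> (\<phi> Q)") auto
    qed
    show "\<exists>W. openin (zariski g f) W \<and> P \<in> W \<and> W \<subseteq> {P \<in> ?X. \<phi> P \<in> V} \<and>
        (\<exists>\<chi>\<in>charts g. \<exists>F G. W \<subseteq> nonvanishing \<chi> G \<and>
           (\<forall>Q\<in>W. (h \<circ> \<phi>) Q = poly2 F (the (\<chi> Q)) / poly2 G (the (\<chi> Q))))"
      by (rule exI[of _ ?W], intro conjI bexI[of _ \<chi>'] exI[of _ F'] exI[of _ G'] ballI)
        (fact W1 W2 W W3 \<chi>')+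
  qed
  ultimately show ?thesis unfolding hyp_morphism_def by blast
qed

lemma carrier_hyp_Aut: "carrier (hyp_Aut g f) = hyp_automorphisms g f"
  by (simp add: hyp_Aut_def)

lemma mult_hyp_Aut:
  assumes "\<phi> \<in> carrier (hyp_Aut g f)" "\<psi> \<in> carrier (hyp_Aut g f)"
  shows "\<phi> \<otimes>\<^bsub>hyp_Aut g f\<^esub> \<psi> = compose (hyp_points g f) \<phi> \<psi>"
  using assms by (simp add: hyp_Aut_def BijGroup_def hyp_automorphisms_def)

lemma one_hyp_Aut: "\<one>\<^bsub>hyp_Aut g f\<^esub> = (\<lambda>P\<in>hyp_points g f. P)"
  by (simp add: hyp_Aut_def BijGroup_def)

text \<open>An involution is its own inverse, so one morphism check serves both directions. The
  restriction is there because elements of \<open>Bij\<close> are extensional.\<close>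

lemma involution_in_hyp_Aut:
  assumes "hyp_morphism g f g f \<phi>"
    and maps: "\<And>P. P \<in> hyp_points g f \<Longrightarrow> \<phi> P \<in> hyp_points g f"
    and inv: "\<And>P. P \<in> hyp_points g f \<Longrightarrow> \<phi> (\<phi> P) = P"
  shows "restrict \<phi> (hyp_points g f) \<in> carrier (hyp_Aut g f)"
proof -
  let ?X = "hyp_points g f"
  have bij: "bij_betw (restrict \<phi> ?X) ?X ?X"
    by (rule bij_betw_byWitness[where f' = \<phi>]) (use maps inv in auto)
  have "inv_into ?X (restrict \<phi> ?X) P = \<phi> P" if "P \<in> ?X" for P
    using bij_betw_inv_into_left[OF bij maps[OF that]] inv[OF that] maps[OF that] by simp
  then have "hyp_morphism g f g f (inv_into ?X (restrict \<phi> ?X))"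
    using hyp_morphism_cong[OF assms(1)] by metis
  moreover have "hyp_morphism g f g f (restrict \<phi> ?X)"
    by (rule hyp_morphism_cong[OF assms(1)]) simp
  ultimately show ?thesis
    using bij by (simp add: carrier_hyp_Aut hyp_automorphisms_def Bij_def)
qed

lemma (in group) embeds_in_Z2_cubed:
  assumes xyz: "x \<in> carrier G" "y \<in> carrier G" "z \<in> carrier G"
    and sq: "x \<otimes> x = \<one>" "y \<otimes> y = \<one>" "z \<otimes> z = \<one>"
    and comm: "y \<otimes> x = x \<otimes> y" "z \<otimes> x = x \<otimes> z" "z \<otimes> y = y \<otimes> z"
    and indep: "\<And>(i::nat) (j::nat) (k::nat). i < 2 \<Longrightarrow> j < 2 \<Longrightarrow> k < 2 \<Longrightarrow>
      x [^] i \<otimes> (y [^] j \<otimes> z [^] k) = \<one> \<Longrightarrow> i = 0 \<and> j = 0 \<and> k = 0"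
  shows "embeds_in Z2_cubed G"
proof -
  define h where "h = (\<lambda>(i, j, k). x [^] nat i \<otimes> (y [^] nat j \<otimes> z [^] nat k))"
  have c2: "i = 0 \<or> i = 1" if "i \<in> {0..<int 2}" for i using that by auto
  have car: "carrier Z2_cubed = {0..<int 2} \<times> {0..<int 2} \<times> {0..<int 2}"
    by (simp add: carrier_integer_mod_group)
  have pow2: "w [^] nat ((i + i') mod 2) = w [^] nat i \<otimes> w [^] nat i'"
    if "w \<in> carrier G" "w \<otimes> w = \<one>" "i \<in> {0..<int 2}" "i' \<in> {0..<int 2}" for w i i'
    using c2[OF that(3)] c2[OF that(4)] that(1,2) by (elim disjE) simp_all
  have swap: "v [^] m \<otimes> (w [^] n \<otimes> r) = w [^] n \<otimes> (v [^] m \<otimes> r)"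
    if "v \<in> carrier G" "w \<in> carrier G" "v \<otimes> w = w \<otimes> v" "r \<in> carrier G"
    for v w r and m n :: nat
  proof -
    have "v [^] m \<otimes> w [^] n = w [^] n \<otimes> v [^] m"
      using that group_commutes_pow[of v w m] group_commutes_pow[of w "v [^] m" n] by simp
    then show ?thesis
      using that by (simp add: m_assoc[symmetric])
  qed
  have "h \<in> hom Z2_cubed G"
  proof (rule homI)
    fix u assume "u \<in> carrier Z2_cubed"
    then show "h u \<in> carrier G" using xyz by (auto simp: h_def split: prod.splits)
  next
    fix u v assume u: "u \<in> carrier Z2_cubed" and v: "v \<in> carrier Z2_cubed"
    obtain i j k i' j' k' where uv: "u = (i, j, k)" "v = (i', j', k')"
      by (metis prod_cases3)
    have mem: "i \<in> {0..<int 2}" "j \<in> {0..<int 2}" "k \<in> {0..<int 2}"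
       "i' \<in> {0..<int 2}" "j' \<in> {0..<int 2}" "k' \<in> {0..<int 2}"
      using u v unfolding car uv by auto
    have "h (u \<otimes>\<^bsub>Z2_cubed\<^esub> v) =
        (x [^] nat i \<otimes> x [^] nat i') \<otimes> ((y [^] nat j \<otimes> y [^] nat j') \<otimes> (z [^] nat k \<otimes> z [^] nat k'))"
      using pow2 mem xyz sq by (simp add: h_def uv)
    also have "\<dots> = h u \<otimes> h v"
      using xyz by (simp add: h_def uv m_assoc swap[OF _ _ comm(1)] swap[OF _ _ comm(2)]
          swap[OF _ _ comm(3)])
    finally show "h (u \<otimes>\<^bsub>Z2_cubed\<^esub> v) = h u \<otimes> h v" .
  qed
  moreover have "u = \<one>\<^bsub>Z2_cubed\<^esub>" if "u \<in> carrier Z2_cubed" "h u = \<one>" for u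
  proof -
    obtain i j k where u: "u = (i, j, k)" by (metis prod_cases3)
    then have ijk: "i \<in> {0..<int 2}" "j \<in> {0..<int 2}" "k \<in> {0..<int 2}"
      using that(1) unfolding car by auto
    have "nat i = 0 \<and> nat j = 0 \<and> nat k = 0"
      by (rule indep) (use ijk that(2) in \<open>simp_all add: h_def u nat_less_iff\<close>)
    then show ?thesis using ijk by (simp add: u)
  qed
  ultimately have "h \<in> mon Z2_cubed G"
    by (subst mon_iff_hom_one) (auto intro!: DirProd_group is_group)
  then show ?thesis by (auto simp: embeds_in_def)
qed


section \<open>Three commuting involutions of the octic curve\<close>

lemma poly_octic: "poly (octic a b c) x = x^8 + a*x^6 + b*x^4 + c*x^2 + 1"
  by (simp add: octic_def poly_monom)

lemma Affine_in_octic_points [simp]: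
  "Affine x y \<in> hyp_points 3 (octic a b c) \<longleftrightarrow> y^2 = x^8 + a*x^6 + b*x^4 + c*x^2 + 1"
  by (auto simp: hyp_points_def poly_octic)

lemma AtInfinity_in_octic_points [simp]:
  "AtInfinity v \<in> hyp_points 3 (octic a b c) \<longleftrightarrow> v^2 = 1"
  by (auto simp: hyp_points_def octic_def)

text \<open>At infinity the coordinate is v = y / x^4, which is multiplied by \<eta> alone when
  \<epsilon>^2 = 1.\<close>

fun sign_map :: "'k::field \<Rightarrow> 'k \<Rightarrow> 'k hpoint \<Rightarrow> 'k hpoint" where
  "sign_map \<epsilon> \<eta> (Affine x y) = Affine (\<epsilon>*x) (\<eta>*y)"
| "sign_map \<epsilon> \<eta> (AtInfinity v) = AtInfinity (\<eta>*v)"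

text \<open>In the chart u = 1/x, v = y / x^4 this map is (u, v) -> (\<mu> u, v) into the finite
  chart, which gives the value at infinity. At x = 0 the image has u = 0 and v = y / \<mu>^4, that
  is y when \<mu>^4 = 1.\<close>

fun inversion_map :: "'k::field \<Rightarrow> 'k hpoint \<Rightarrow> 'k hpoint" where
  "inversion_map \<mu> (Affine x y) = (if x = 0 then AtInfinity y else Affine (\<mu>/x) (y/x^4))"
| "inversion_map \<mu> (AtInfinity v) = Affine 0 v"

lemma sign_map_in_Aut_X:
  fixes a b c :: "'k::field"
  assumes "\<epsilon>^2 = 1" "\<eta>^2 = 1"
  shows "restrict (sign_map \<epsilon> \<eta>) (hyp_points 3 (octic a b c)) \<in> carrier (Aut_X a b c)"
  unfolding Aut_X_def
proof (rule involution_in_hyp_Aut)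
  have e0: "\<epsilon> \<noteq> 0" using assms(1) by auto
  have e1: "\<epsilon>*\<epsilon> = 1" "\<eta>*\<eta> = 1" using assms by (simp_all add: power2_eq_square)
  have "\<epsilon>^4 = (\<epsilon>^2)^2" "\<epsilon>^6 = (\<epsilon>^2)^3" "\<epsilon>^8 = (\<epsilon>^2)^4" by (simp_all flip: power_mult)
  then have e4: "\<epsilon>^4 = 1" "\<epsilon>^6 = 1" "\<epsilon>^8 = 1" by (simp_all add: assms)
  show maps: "sign_map \<epsilon> \<eta> P \<in> hyp_points 3 (octic a b c)" if "P \<in> hyp_points 3 (octic a b c)" for P
    using that by (cases P) (simp_all add: power_mult_distrib assms e4)
  show "sign_map \<epsilon> \<eta> (sign_map \<epsilon> \<eta> P) = P" for P
    by (cases P) (simp_all add: mult.assoc[symmetric] e1)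
  show "hyp_morphism 3 (octic a b c) 3 (octic a b c) (sign_map \<epsilon> \<eta>)"
  proof (rule hyp_morphism_diagonal[OF maps])
    fix \<chi> :: "'k hpoint \<Rightarrow> ('k \<times> 'k) option" assume "\<chi> \<in> charts 3"
    then consider "\<chi> = chart_finite" | "\<chi> = chart_infinity 3" by (auto simp: charts_def)
    then show "\<exists>\<chi>'\<in>charts 3. \<exists>\<kappa> \<nu>. \<forall>P\<in>hyp_points 3 (octic a b c).
        \<chi> (sign_map \<epsilon> \<eta> P) = map_option (\<lambda>(x, y). (\<kappa>*x, \<nu>*y)) (\<chi>' P)"
    proof cases
      case 1
      have "\<chi> (sign_map \<epsilon> \<eta> P) = map_option (\<lambda>(x, y). (\<epsilon>*x, \<eta>*y)) (\<chi> P)" for P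
        unfolding 1 by (cases P) simp_all
      with \<open>\<chi> \<in> charts 3\<close> show ?thesis by blast
    next
      case 2
      have "\<chi> (sign_map \<epsilon> \<eta> P) = map_option (\<lambda>(x, y). ((1/\<epsilon>)*x, \<eta>*y)) (\<chi> P)" for P
        unfolding 2 by (cases P) (simp_all add: e0 power_mult_distrib e4)
      with \<open>\<chi> \<in> charts 3\<close> show ?thesis by blast
    qed
  qed
qed

text \<open>Substituting \<mu>/x and multiplying by x^8 reverses the coefficients of the octic and
  scales \<open>a\<close> and \<open>c\<close> by \<mu>^2. As \<mu>^4 = 1, the condition c = \<mu>^2
  a is symmetric in \<open>a\<close> and \<open>c\<close>.\<close>

lemma inversion_map_in_Aut_X:
  fixes a b c :: "'k::field"
  assumes "\<mu>^4 = 1" "c = \<mu>^2*a"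
  shows "restrict (inversion_map \<mu>) (hyp_points 3 (octic a b c)) \<in> carrier (Aut_X a b c)"
  unfolding Aut_X_def
proof (rule involution_in_hyp_Aut)
  have m0: "\<mu> \<noteq> 0" using assms(1) by auto
  have "\<mu>^6 = \<mu>^4*\<mu>^2" "\<mu>^8 = \<mu>^4*\<mu>^4" by (simp_all flip: power_add)
  then have m: "\<mu>^6 = \<mu>^2" "\<mu>^8 = 1" by (simp_all add: assms(1))
  have a: "a = \<mu>^2*c" using assms by (simp add: mult.assoc[symmetric] flip: power_add)
  show maps: "inversion_map \<mu> P \<in> hyp_points 3 (octic a b c)"
    if "P \<in> hyp_points 3 (octic a b c)" for P
  proof (cases P)
    case (Affine x y)
    have "(y/x^4)^2 = (\<mu>/x)^8 + a*(\<mu>/x)^6 + b*(\<mu>/x)^4 + c*(\<mu>/x)^2 + 1" if "x \<noteq> 0"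
    proof -
      have "(\<mu>/x)^8 + a*(\<mu>/x)^6 + b*(\<mu>/x)^4 + c*(\<mu>/x)^2 + 1 =
          1/x^8 + (\<mu>^2*a)/x^6 + b/x^4 + (\<mu>^2*c)/x^2 + 1"
        by (simp add: power_divide assms(1) m mult.commute)
      also have "\<dots> = (x^8 + a*x^6 + b*x^4 + c*x^2 + 1)/x^8"
        unfolding assms(2)[symmetric] a[symmetric] using that
        by (simp add: field_simps power_add[symmetric])
      also have "\<dots> = (y/x^4)^2"
        using \<open>P \<in> _\<close> by (simp add: Affine power_divide flip: power_mult)
      finally show ?thesis by simp
    qed
    with that show ?thesis unfolding Affine by (cases "x = 0") simp_all
  next
    case (AtInfinity v)
    with that show ?thesis by simp
  qed
  show inv: "inversion_map \<mu> (inversion_map \<mu> P) = P" for P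
    by (cases P) (simp_all add: m0 power_divide assms(1))
  show "hyp_morphism 3 (octic a b c) 3 (octic a b c) (inversion_map \<mu>)"
  proof (rule hyp_morphism_diagonal[OF maps])
    fix \<chi> :: "'k hpoint \<Rightarrow> ('k \<times> 'k) option" assume "\<chi> \<in> charts 3"
    then consider "\<chi> = chart_finite" | "\<chi> = chart_infinity 3" by (auto simp: charts_def)
    then show "\<exists>\<chi>'\<in>charts 3. \<exists>\<kappa> \<nu>. \<forall>P\<in>hyp_points 3 (octic a b c).
        \<chi> (inversion_map \<mu> P) = map_option (\<lambda>(x, y). (\<kappa>*x, \<nu>*y)) (\<chi>' P)"
    proof cases
      case 1
      have "\<chi> (inversion_map \<mu> P) = map_option (\<lambda>(x, y). (\<mu>*x, 1*y)) (chart_infinity 3 P)" for P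
        unfolding 1 by (cases P) simp_all
      then show ?thesis unfolding charts_def by blast
    next
      case 2
      have "\<chi> (inversion_map \<mu> P) = map_option (\<lambda>(x, y). ((1/\<mu>)*x, 1*y)) (chart_finite P)" for P
        unfolding 2 by (cases P) (simp_all add: m0 power_divide assms(1))
      then show ?thesis unfolding charts_def by blast
    qed
  qed
qed

lemma embeds_Z2_cubed_Aut_X:
  fixes a b c :: "'k::{alg_closed_field, field_char_0}"
  assumes "a = c \<or> a = - c"
  shows "embeds_in Z2_cubed (Aut_X a b c)"
proof -
  let ?X = "hyp_points 3 (octic a b c)"
  obtain i :: 'k where i: "i^2 = -1"
    using nth_root_exists[of 2 "-1 :: 'k"] by auto
  obtain \<mu> :: 'k where \<mu>: "\<mu>^4 = 1" "c = \<mu>^2*a"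
  proof (cases "a = c")
    case True
    then show ?thesis using that[of 1] by simp
  next
    case False
    have "i^4 = (i^2)^2" by (simp flip: power_mult)
    with False assms i show ?thesis using that[of i] by simp
  qed
  define \<sigma> \<iota> \<tau> where "\<sigma> = restrict (sign_map (-1) 1) ?X" and "\<iota> = restrict (sign_map 1 (-1)) ?X"
    and "\<tau> = restrict (inversion_map \<mu>) ?X"
  note car = sign_map_in_Aut_X[of "-1" 1 a b c, folded \<sigma>_def]
    sign_map_in_Aut_X[of 1 "-1" a b c, folded \<iota>_def]
    inversion_map_in_Aut_X[OF \<mu>, of b, folded \<tau>_def]
  have car: "\<sigma> \<in> carrier (Aut_X a b c)" "\<iota> \<in> carrier (Aut_X a b c)" "\<tau> \<in> carrier (Aut_X a b c)"
    using car by simp_all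
  have mult: "\<phi> \<otimes>\<^bsub>Aut_X a b c\<^esub> \<psi> = compose ?X \<phi> \<psi>"
    if "\<phi> \<in> carrier (Aut_X a b c)" "\<psi> \<in> carrier (Aut_X a b c)" for \<phi> \<psi>
    using that mult_hyp_Aut unfolding Aut_X_def by blast
  have one: "\<one>\<^bsub>Aut_X a b c\<^esub> = (\<lambda>P\<in>?X. P)"
    by (simp add: Aut_X_def one_hyp_Aut)
  have maps: "\<phi> P \<in> ?X" if "\<phi> \<in> carrier (Aut_X a b c)" "P \<in> ?X" for \<phi> P
    using that by (auto simp: Aut_X_def carrier_hyp_Aut hyp_automorphisms_def dest: Bij_imp_funcset)
  have \<mu>0: "\<mu> \<noteq> 0" using \<mu>(1) by auto
  interpret group "Aut_X a b c" unfolding Aut_X_def by (rule group_hyp_Aut)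
  \<comment> \<open>A point with x \<noteq> 0, y \<noteq> 0 and x^4 \<noteq> \<mu>^2 has x different
    from \<mu>/x and -\<mu>/x. It is moved by every nontrivial product of the three involutions, so
    evaluation at this one point shows their independence.\<close>
  let ?bad = "{x. poly (octic a b c) x = 0} \<union> {x. poly (monom 1 4 - [:\<mu>^2:]) x = 0} \<union> {0}"
  have "octic a b c \<noteq> 0"
    using poly_octic[of a b c 0] by auto
  moreover have "monom 1 4 - [:\<mu>^2:] \<noteq> (0 :: 'k poly)"
  proof
    assume "monom 1 4 - [:\<mu>^2:] = (0 :: 'k poly)"
    then have "coeff (monom 1 4 - [:\<mu>^2:]) 4 = (0 :: 'k)" by simp
    then show False by (simp add: coeff_pCons numeral_eq_Suc)
  qed
  ultimately have "finite ?bad" by (intro finite_UnI poly_roots_finite) simp_all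
  from ex_new_if_finite[OF infinite_UNIV_char_0 this] obtain x where x: "x \<notin> ?bad" ..
  obtain y where y: "y^2 = poly (octic a b c) x"
    using nth_root_exists[of 2 "poly (octic a b c) x"] by auto
  have x0: "x \<noteq> 0" and y0: "y \<noteq> 0" and x4: "x^4 \<noteq> \<mu>^2" using x y by (auto simp: poly_monom)
  have P: "Affine x y \<in> ?X" using y by (simp add: poly_octic)
  have ev: "\<sigma> Q = sign_map (-1) 1 Q" "\<iota> Q = sign_map 1 (-1) Q" "\<tau> Q = inversion_map \<mu> Q"
    if "Q \<in> ?X" for Q using that by (simp_all add: \<sigma>_def \<iota>_def \<tau>_def)
  have mem: "sign_map (-1) 1 Q \<in> ?X" "sign_map 1 (-1) Q \<in> ?X" "inversion_map \<mu> Q \<in> ?X" if "Q \<in> ?X" for Q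
    using maps[OF car(1) that] maps[OF car(2) that] maps[OF car(3) that] by (simp_all add: ev[OF that])
  have ext: "compose ?X \<phi> \<psi> = compose ?X \<phi>' \<psi>'" if "\<And>Q. Q \<in> ?X \<Longrightarrow> \<phi> (\<psi> Q) = \<phi>' (\<psi>' Q)"
    for \<phi> \<psi> \<phi>' \<psi>' :: "'k hpoint \<Rightarrow> 'k hpoint"
    unfolding compose_def using that by (intro restrict_ext) simp
  have ext1: "compose ?X \<phi> \<psi> = (\<lambda>P\<in>?X. P)" if "\<And>Q. Q \<in> ?X \<Longrightarrow> \<phi> (\<psi> Q) = Q"
    for \<phi> \<psi> :: "'k hpoint \<Rightarrow> 'k hpoint"
    unfolding compose_def using that by (intro restrict_ext) simp
  have s: "sign_map \<epsilon> \<eta> (sign_map \<epsilon>' \<eta>' Q) = sign_map (\<epsilon>*\<epsilon>') (\<eta>*\<eta>') Q" for \<epsilon> \<eta> \<epsilon>' \<eta>' :: 'k and Q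
    by (cases Q) (simp_all add: mult.assoc)
  have s1: "sign_map 1 1 Q = Q" for Q :: "'k hpoint" by (cases Q) simp_all
  have t: "inversion_map \<mu> (inversion_map \<mu> Q) = Q" for Q
    by (cases Q) (simp_all add: \<mu>0 power_divide \<mu>(1))
  have ts: "inversion_map \<mu> (sign_map \<epsilon> \<eta> Q) = sign_map \<epsilon> \<eta> (inversion_map \<mu> Q)"
    if "\<epsilon> = 1 \<or> \<epsilon> = -1" for \<epsilon> \<eta> :: 'k and Q
    using that by (cases Q) auto
  show ?thesis
  proof (rule embeds_in_Z2_cubed[OF car])
    show "\<sigma> \<otimes>\<^bsub>Aut_X a b c\<^esub> \<sigma> = \<one>\<^bsub>Aut_X a b c\<^esub>" "\<iota> \<otimes>\<^bsub>Aut_X a b c\<^esub> \<iota> = \<one>\<^bsub>Aut_X a b c\<^esub>"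
      "\<tau> \<otimes>\<^bsub>Aut_X a b c\<^esub> \<tau> = \<one>\<^bsub>Aut_X a b c\<^esub>"
      unfolding one using car by (simp_all add: mult ext1 ev mem s s1 t)
    show "\<iota> \<otimes>\<^bsub>Aut_X a b c\<^esub> \<sigma> = \<sigma> \<otimes>\<^bsub>Aut_X a b c\<^esub> \<iota>" "\<tau> \<otimes>\<^bsub>Aut_X a b c\<^esub> \<sigma> = \<sigma> \<otimes>\<^bsub>Aut_X a b c\<^esub> \<tau>"
      "\<tau> \<otimes>\<^bsub>Aut_X a b c\<^esub> \<iota> = \<iota> \<otimes>\<^bsub>Aut_X a b c\<^esub> \<tau>"
      using car by (simp_all add: mult) (auto simp: ev mem s s1 ts intro!: ext)
  next
    fix i j k :: nat
    assume lt: "i < 2" "j < 2" "k < 2"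
      and eq: "\<sigma> [^]\<^bsub>Aut_X a b c\<^esub> i \<otimes>\<^bsub>Aut_X a b c\<^esub>
        (\<iota> [^]\<^bsub>Aut_X a b c\<^esub> j \<otimes>\<^bsub>Aut_X a b c\<^esub> \<tau> [^]\<^bsub>Aut_X a b c\<^esub> k) = \<one>\<^bsub>Aut_X a b c\<^esub>"
    have pow: "(\<phi> [^]\<^bsub>Aut_X a b c\<^esub> n) Q = (if n = 0 then Q else \<phi> Q)"
      if "\<phi> \<in> carrier (Aut_X a b c)" "n < 2" "Q \<in> ?X" for \<phi> Q and n :: nat
    proof -
      from that(2) consider "n = 0" | "n = 1" by linarith
      then show ?thesis
      proof cases
        case 1
        with that show ?thesis by (simp add: one)
      next
        case 2
        have "\<phi> [^]\<^bsub>Aut_X a b c\<^esub> n = \<phi>"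
          unfolding 2 using that(1) by (metis One_nat_def nat_pow_0 nat_pow_Suc l_one)
        then show ?thesis using 2 by simp
      qed
    qed
    have app: "(\<phi> \<otimes>\<^bsub>Aut_X a b c\<^esub> \<psi>) Q = \<phi> (\<psi> Q)"
      if "\<phi> \<in> carrier (Aut_X a b c)" "\<psi> \<in> carrier (Aut_X a b c)" "Q \<in> ?X" for \<phi> \<psi> Q
      using that by (simp add: mult compose_eq)
    let ?P = "Affine x y"
    let ?R = "if k = 0 then ?P else inversion_map \<mu> ?P"
    have R: "?R \<in> ?X" using maps[OF car(3) P] P ev(3)[OF P] by simp
    let ?S = "if j = 0 then ?R else sign_map 1 (-1) ?R"
    have S: "?S \<in> ?X" using maps[OF car(2) R] R ev(2)[OF R] by simp
    have "?P = (if i = 0 then ?S else sign_map (-1) 1 ?S)"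
    proof -
      have "?P = (\<lambda>P\<in>?X. P) ?P" using P by simp
      also have "\<dots> = (\<sigma> [^]\<^bsub>Aut_X a b c\<^esub> i) ((\<iota> [^]\<^bsub>Aut_X a b c\<^esub> j) ((\<tau> [^]\<^bsub>Aut_X a b c\<^esub> k) ?P))"
        unfolding one[symmetric] eq[symmetric] using car P by (simp add: app maps)
      also have "(\<tau> [^]\<^bsub>Aut_X a b c\<^esub> k) ?P = ?R" using pow[OF car(3) lt(3) P] ev(3)[OF P] by simp
      also have "(\<iota> [^]\<^bsub>Aut_X a b c\<^esub> j) ?R = ?S" using pow[OF car(2) lt(2) R] ev(2)[OF R] by simp
      also have "(\<sigma> [^]\<^bsub>Aut_X a b c\<^esub> i) ?S = (if i = 0 then ?S else sign_map (-1) 1 ?S)"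
        using pow[OF car(1) lt(1) S] ev(1)[OF S] by simp
      finally show ?thesis .
    qed
    moreover have "x \<noteq> \<mu>/x" "x \<noteq> - (\<mu>/x)"
    proof -
      have "x^4 = \<mu>^2" if "x*x = \<mu> \<or> x*x = - \<mu>"
      proof -
        have "x^4 = (x*x)^2" by (simp add: power_mult_distrib flip: power_add)
        with that show ?thesis by auto
      qed
      then show "x \<noteq> \<mu>/x" "x \<noteq> - (\<mu>/x)" using x0 x4 by (auto simp: field_simps)
    qed
    ultimately show "i = 0 \<and> j = 0 \<and> k = 0"
      using x0 y0 by (auto split: if_splits)
  qed
qed

section \<open>The function field of the curve\<close>

text \<open>Eventually means at all but finitely many points of the affine curve. Functions that
  agree eventually represent the same element of the function field, so poles and the value of a
  division by 0 do not matter.\<close>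

definition generic :: "'k::field poly \<Rightarrow> ('k \<times> 'k) filter" where
  "generic f = inf cofinite (principal {(x, y). y^2 = poly f x})"

lemma eventually_generic:
  "eventually Q (generic f) \<longleftrightarrow> finite {z. (snd z)^2 = poly f (fst z) \<and> \<not> Q z}"
  unfolding generic_def eventually_inf_principal eventually_cofinite
  by (rule arg_cong[of _ _ finite]) auto

lemma eventually_generic_curve: "\<forall>\<^sub>F z in generic f. (snd z)^2 = poly f (fst z)"
  by (simp add: eventually_generic)

text \<open>The two sides would have degrees of different parity. So the norm p^2 - q^2 f of p + q y
  is zero only for p + q y = 0.\<close>

lemma norm_eq_0_odd_degree:
  fixes f p q :: "'k::idom poly"
  assumes "odd (degree f)" "p^2 = q^2 * f"
  shows "p = 0 \<and> q = 0"
proof (rule ccontr)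
  assume "\<not> ?thesis"
  moreover have "f \<noteq> 0" using assms(1) by auto
  ultimately have "p \<noteq> 0" "q \<noteq> 0" "f \<noteq> 0" using assms(2) by auto
  then have "2 * degree p = 2 * degree q + degree f"
    using arg_cong[OF assms(2), of degree] by (simp add: degree_mult_eq degree_power_eq)
  with assms(1) show False by presburger
qed

text \<open>Over an algebraically closed field every x carries a point of the curve, so the norm
  vanishes at almost every x. This is the linear independence of 1 and y over k(x).\<close>

lemma generic_zero_imp_0:
  fixes f p q :: "'k::{alg_closed_field, field_char_0} poly"
  assumes odd: "odd (degree f)"
    and ev: "\<forall>\<^sub>F z in generic f. poly p (fst z) + poly q (fst z) * snd z = 0"
  shows "p = 0 \<and> q = 0"
proof -
  let ?B = "{z. (snd z)^2 = poly f (fst z) \<and> \<not> poly p (fst z) + poly q (fst z) * snd z = 0}"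
  have "x \<in> fst ` ?B" if "poly (p^2) x \<noteq> poly (q^2 * f) x" for x
  proof -
    obtain y where y: "y^2 = poly f x" using nth_root_exists[of 2 "poly f x"] by auto
    have "poly p x + poly q x * y \<noteq> 0"
    proof
      assume "poly p x + poly q x * y = 0"
      then have "(poly p x)^2 = (poly q x)^2 * y^2" by algebra
      with that y show False by simp
    qed
    with y have "(x, y) \<in> ?B" by simp
    then show ?thesis by (rule image_eqI[rotated]) simp
  qed
  then have "{x. poly (p^2) x \<noteq> poly (q^2 * f) x} \<subseteq> fst ` ?B" by blast
  moreover have "finite ?B" using ev by (simp add: eventually_generic)
  ultimately have fin: "finite {x. poly (p^2) x \<noteq> poly (q^2 * f) x}"
    by (rule finite_subset[OF _ finite_imageI])
  have "infinite {x. poly (p^2) x = poly (q^2 * f) x}"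
  proof
    assume "finite {x. poly (p^2) x = poly (q^2 * f) x}"
    with fin have "finite ({x. poly (p^2) x = poly (q^2 * f) x} \<union> {x. poly (p^2) x \<noteq> poly (q^2 * f) x})"
      by (intro finite_UnI)
    moreover have "{x. poly (p^2) x = poly (q^2 * f) x} \<union> {x. poly (p^2) x \<noteq> poly (q^2 * f) x} = UNIV"
      by blast
    ultimately show False using infinite_UNIV_char_0[where ?'a = 'k] by (simp only:)
  qed
  then have "p^2 = q^2 * f" by (rule poly_eqI_infinite)
  with odd show ?thesis by (rule norm_eq_0_odd_degree)
qed

lemma finite_square_roots: "finite {y :: 'k::idom. y^2 = r}"
proof (cases "\<exists>y. y^2 = r")
  case True
  then obtain y where "y^2 = r" by blast
  then have "{y. y^2 = r} \<subseteq> {y, - y}" by (auto simp: power2_eq_iff)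
  then show ?thesis by (rule finite_subset) simp
qed simp

text \<open>The zeros lie over the finitely many roots of the norm, with at most two points over
  each.\<close>

lemma generic_nonzero:
  fixes f p q :: "'k::field poly"
  assumes odd: "odd (degree f)" and "p \<noteq> 0 \<or> q \<noteq> 0"
  shows "\<forall>\<^sub>F z in generic f. poly p (fst z) + poly q (fst z) * snd z \<noteq> 0"
proof -
  have n: "p^2 - q^2 * f \<noteq> 0"
    using norm_eq_0_odd_degree[OF odd] assms(2) by (metis right_minus_eq)
  have "{z. (snd z)^2 = poly f (fst z) \<and> \<not> poly p (fst z) + poly q (fst z) * snd z \<noteq> 0}
     \<subseteq> Sigma {x. poly (p^2 - q^2 * f) x = 0} (\<lambda>x. {y. y^2 = poly f x})"
  proof
    fix z assume "z \<in> {z. (snd z)^2 = poly f (fst z) \<and> \<not> poly p (fst z) + poly q (fst z) * snd z \<noteq> 0}"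
    then have z: "(snd z)^2 = poly f (fst z)" "poly p (fst z) + poly q (fst z) * snd z = 0" by auto
    have "(poly p (fst z))^2 - (poly q (fst z))^2 * (snd z)^2 =
        (poly p (fst z) + poly q (fst z) * snd z) * (poly p (fst z) - poly q (fst z) * snd z)"
      by algebra
    with z show "z \<in> Sigma {x. poly (p^2 - q^2 * f) x = 0} (\<lambda>x. {y. y^2 = poly f x})"
      by (cases z) simp
  qed
  moreover have "finite (Sigma {x. poly (p^2 - q^2 * f) x = 0} (\<lambda>x. {y. y^2 = poly f x}))"
    using n by (intro finite_SigmaI poly_roots_finite finite_square_roots)
  ultimately show ?thesis
    unfolding eventually_generic by (rule finite_subset)
qed

lemma generic_poly_nonzero:
  fixes f p :: "'k::field poly"
  assumes "odd (degree f)" "p \<noteq> 0"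
  shows "\<forall>\<^sub>F z in generic f. poly p (fst z) \<noteq> 0"
  using generic_nonzero[OF assms(1), of p 0] assms(2) by simp

lemma generic_neq_bot:
  fixes f :: "'k::{alg_closed_field, field_char_0} poly"
  assumes "odd (degree f)"
  shows "generic f \<noteq> bot"
proof
  assume "generic f = bot"
  then have "(1 :: 'k poly) = 0 \<and> (0 :: 'k poly) = 0"
    by (intro generic_zero_imp_0[OF assms]) simp
  then show False by simp
qed

lemma poly2_on_curve:
  fixes f :: "'k::field poly"
  shows "\<exists>p q. \<forall>x y. y^2 = poly f x \<longrightarrow> poly2 F (x, y) = poly p x + poly q x * y"
proof (induction F)
  case 0
  show ?case by (intro exI[of _ 0]) simp
next
  case (pCons r F)
  then obtain p q where pq: "\<And>x y. y^2 = poly f x \<Longrightarrow> poly2 F (x, y) = poly p x + poly q x * y" by blast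
  have "poly2 (pCons r F) (x, y) = poly (r + q * f) x + poly p x * y" if "y^2 = poly f x" for x y
  proof -
    have "poly2 (pCons r F) (x, y) = poly r x + y * (poly p x + poly q x * y)"
      using pq[OF that] by simp
    also have "\<dots> = poly r x + poly q x * y^2 + poly p x * y" by algebra
    finally show ?thesis using that by simp
  qed
  then show ?case by blast
qed

lemma poly2_generic_zero:
  fixes f :: "'k::{alg_closed_field, field_char_0} poly"
  assumes "odd (degree f)" "\<forall>\<^sub>F z in generic f. poly2 F z = 0" "y^2 = poly f x"
  shows "poly2 F (x, y) = 0"
proof -
  obtain p q where pq: "\<And>x y. y^2 = poly f x \<Longrightarrow> poly2 F (x, y) = poly p x + poly q x * y"
    using poly2_on_curve by blast
  have "\<forall>\<^sub>F z in generic f. poly p (fst z) + poly q (fst z) * snd z = 0"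
    using assms(2) eventually_generic_curve[of f]
    by eventually_elim (use pq in fastforce)
  with assms(1) have "p = 0 \<and> q = 0" by (rule generic_zero_imp_0)
  with pq[OF assms(3)] show ?thesis by simp
qed

text \<open>Irreducibility of the affine curve: a polynomial reduces to p + q y on it, which is
  either zero or has finitely many zeros.\<close>

lemma poly2_generic_cases:
  fixes f :: "'k::{alg_closed_field, field_char_0} poly"
  assumes "odd (degree f)"
  obtains "\<And>x y. y^2 = poly f x \<Longrightarrow> poly2 F (x, y) = 0"
    | "\<forall>\<^sub>F z in generic f. poly2 F z \<noteq> 0"
proof -
  obtain p q where pq: "\<And>x y. y^2 = poly f x \<Longrightarrow> poly2 F (x, y) = poly p x + poly q x * y"
    using poly2_on_curve by blast
  show ?thesis
  proof (cases "p = 0 \<and> q = 0")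
    case True
    with pq that(1) show ?thesis by simp
  next
    case False
    then have "\<forall>\<^sub>F z in generic f. poly p (fst z) + poly q (fst z) * snd z \<noteq> 0"
      by (intro generic_nonzero[OF assms]) blast
    then have "\<forall>\<^sub>F z in generic f. poly2 F z \<noteq> 0"
      using eventually_generic_curve[of f] by eventually_elim (use pq in fastforce)
    then show ?thesis by (rule that(2))
  qed
qed

text \<open>Functions on the curve that generically agree with an element \<open>(p + q y) / d\<close> of the function field.\<close>

definition rational_on :: "'k::field poly \<Rightarrow> ('k \<times> 'k \<Rightarrow> 'k) \<Rightarrow> bool" where
  "rational_on f h \<longleftrightarrow> (\<exists>d p q. d \<noteq> 0 \<and>
     (\<forall>\<^sub>F z in generic f. poly d (fst z) * h z = poly p (fst z) + poly q (fst z) * snd z))"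

lemma rational_onI:
  assumes "d \<noteq> 0" "\<forall>\<^sub>F z in generic f. poly d (fst z) * h z = poly p (fst z) + poly q (fst z) * snd z"
  shows "rational_on f h"
  using assms unfolding rational_on_def by blast

lemma rational_on_cong:
  assumes "rational_on f h" "\<forall>\<^sub>F z in generic f. h' z = h z"
  shows "rational_on f h'"
proof -
  obtain d p q where d: "d \<noteq> 0"
    and ev: "\<forall>\<^sub>F z in generic f. poly d (fst z) * h z = poly p (fst z) + poly q (fst z) * snd z"
    using assms(1) unfolding rational_on_def by blast
  from ev assms(2) have "\<forall>\<^sub>F z in generic f. poly d (fst z) * h' z = poly p (fst z) + poly q (fst z) * snd z"
    by eventually_elim simp
  with d show ?thesis by (rule rational_onI)
qed

lemma rational_on_poly: "rational_on f (\<lambda>z. poly p (fst z))"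
  by (rule rational_onI[where d = 1 and p = p and q = 0]) simp_all

lemma rational_on_snd: "rational_on f snd"
  by (rule rational_onI[where d = 1 and p = 0 and q = 1]) simp_all

lemma rational_on_add:
  assumes "rational_on f h" "rational_on f h'"
  shows "rational_on f (\<lambda>z. h z + h' z)"
proof -
  obtain d p q where d: "d \<noteq> 0"
    and ev: "\<forall>\<^sub>F z in generic f. poly d (fst z) * h z = poly p (fst z) + poly q (fst z) * snd z"
    using assms(1) unfolding rational_on_def by blast
  obtain d' p' q' where d': "d' \<noteq> 0"
    and ev': "\<forall>\<^sub>F z in generic f. poly d' (fst z) * h' z = poly p' (fst z) + poly q' (fst z) * snd z"
    using assms(2) unfolding rational_on_def by blast
  have "\<forall>\<^sub>F z in generic f. poly (d * d') (fst z) * (h z + h' z) =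
      poly (d' * p + d * p') (fst z) + poly (d' * q + d * q') (fst z) * snd z"
    using ev ev' by eventually_elim (simp only: poly_mult poly_add, algebra)
  moreover have "d * d' \<noteq> 0" using d d' by simp
  ultimately show ?thesis by (rule rational_onI[rotated])
qed

lemma rational_on_mult:
  assumes "rational_on f h" "rational_on f h'"
  shows "rational_on f (\<lambda>z. h z * h' z)"
proof -
  obtain d p q where d: "d \<noteq> 0"
    and ev: "\<forall>\<^sub>F z in generic f. poly d (fst z) * h z = poly p (fst z) + poly q (fst z) * snd z"
    using assms(1) unfolding rational_on_def by blast
  obtain d' p' q' where d': "d' \<noteq> 0"
    and ev': "\<forall>\<^sub>F z in generic f. poly d' (fst z) * h' z = poly p' (fst z) + poly q' (fst z) * snd z"
    using assms(2) unfolding rational_on_def by blast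
  have "\<forall>\<^sub>F z in generic f. poly (d * d') (fst z) * (h z * h' z) =
      poly (p * p' + q * q' * f) (fst z) + poly (p * q' + q * p') (fst z) * snd z"
    using ev ev' eventually_generic_curve[of f]
    by eventually_elim (simp only: poly_mult poly_add, algebra)
  moreover have "d * d' \<noteq> 0" using d d' by simp
  ultimately show ?thesis by (rule rational_onI[rotated])
qed

lemma rational_on_inverse:
  fixes f :: "'k::field poly"
  assumes odd: "odd (degree f)" and "rational_on f h"
  shows "rational_on f (\<lambda>z. inverse (h z))"
proof -
  obtain d p q where d: "d \<noteq> 0"
    and ev: "\<forall>\<^sub>F z in generic f. poly d (fst z) * h z = poly p (fst z) + poly q (fst z) * snd z"
    using assms(2) unfolding rational_on_def by blast
  have dz: "\<forall>\<^sub>F z in generic f. poly d (fst z) \<noteq> 0" by (rule generic_poly_nonzero[OF odd d])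
  show ?thesis
  proof (cases "p = 0 \<and> q = 0")
    \<comment> \<open>Here \<open>h\<close> vanishes generically, and \<open>inverse 0 = 0\<close>
      makes its inverse the zero function.\<close>
    case True
    have "\<forall>\<^sub>F z in generic f. inverse (h z) = poly 0 (fst z)"
      using ev dz by eventually_elim (use True in simp)
    with rational_on_poly show ?thesis by (rule rational_on_cong)
  next
    \<comment> \<open>The denominator is rationalised with the conjugate p - q y: from d h = p + q y
      follows (p^2 - q^2 f) / h = d (p - q y).\<close>
    case False
    then have nz: "\<forall>\<^sub>F z in generic f. poly p (fst z) + poly q (fst z) * snd z \<noteq> 0"
      by (intro generic_nonzero[OF odd]) blast
    have "\<forall>\<^sub>F z in generic f. poly (p^2 - q^2 * f) (fst z) * inverse (h z) =
        poly (d * p) (fst z) + poly (- (d * q)) (fst z) * snd z"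
      using ev nz dz eventually_generic_curve[of f]
    proof eventually_elim
      case (elim z)
      have hz: "h z \<noteq> 0" using elim by auto
      have "poly (p^2 - q^2 * f) (fst z) =
          (poly d (fst z) * h z) * (poly p (fst z) - poly q (fst z) * snd z)"
        unfolding elim(1) by (simp only: poly_diff poly_mult poly_power elim(4)[symmetric]) algebra
      then have "poly (p^2 - q^2 * f) (fst z) * inverse (h z) =
          poly d (fst z) * (poly p (fst z) - poly q (fst z) * snd z) * (h z * inverse (h z))"
        by (simp only: mult_ac)
      also have "\<dots> = poly (d * p) (fst z) + poly (- (d * q)) (fst z) * snd z"
        using hz by (simp add: algebra_simps)
      finally show ?case .
    qed
    moreover have "p^2 - q^2 * f \<noteq> 0"
      using norm_eq_0_odd_degree[OF odd] False by (metis right_minus_eq)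
    ultimately show ?thesis by (intro rational_onI)
  qed
qed

lemma rational_on_poly_comp:
  assumes "rational_on f u"
  shows "rational_on f (\<lambda>z. poly p (u z))"
proof (induction p)
  case 0
  show ?case using rational_on_poly[of f 0] by simp
next
  case (pCons c p)
  have "rational_on f (\<lambda>z. poly [:c:] (fst z) + u z * poly p (u z))"
    by (intro rational_on_add rational_on_poly rational_on_mult assms pCons)
  then show ?case by simp
qed

lemma rational_on_poly2:
  assumes "rational_on f u" "rational_on f v"
  shows "rational_on f (\<lambda>z. poly2 F (u z, v z))"
proof (induction F)
  case 0
  show ?case using rational_on_poly[of f 0] by simp
next
  case (pCons r F)
  have "rational_on f (\<lambda>z. poly r (u z) + v z * poly2 F (u z, v z))"
    by (intro rational_on_add rational_on_poly_comp rational_on_mult assms pCons)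
  then show ?case by simp
qed

section \<open>Automorphisms of the quintic curve\<close>

lemma quintic_eq_pCons: "quintic a b c = [:0, 1, c, b, a, 1:]"
  for a b c :: "'k::field_char_0"
  by (rule poly_eqI_nonzero) (simp add: quintic_def poly_monom algebra_simps power_numeral_reduce)

lemma odd_degree_quintic [simp]: "odd (degree (quintic a b c))"
  for a b c :: "'k::field_char_0"
  by (simp add: quintic_eq_pCons)

text \<open>The transition to the chart at infinity in genus 2. There the curve has the same form
  with \<open>a\<close> and \<open>c\<close> exchanged, so every statement about the finite chart
  serves for both.\<close>

definition flip :: "'k::field \<times> 'k \<Rightarrow> 'k \<times> 'k" where
  "flip z = (1 / fst z, snd z / fst z ^ 3)"

lemma flip_flip: "fst z \<noteq> 0 \<Longrightarrow> flip (flip z) = z"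
  by (cases z) (simp add: flip_def power_divide)

lemma fst_flip_eq_0_iff [simp]: "fst (flip z) = 0 \<longleftrightarrow> fst z = 0"
  by (simp add: flip_def)

lemma flip_curve:
  fixes a b c :: "'k::field"
  assumes "(snd z)^2 = poly (quintic a b c) (fst z)" "fst z \<noteq> 0"
  shows "(snd (flip z))^2 = poly (quintic c b a) (fst (flip z))"
proof -
  have "poly (quintic c b a) (1 / fst z) = sextic_form c b a (1 / fst z * 1) (1 / fst z * fst z)"
    using assms(2) by (simp add: poly_quintic)
  also have "\<dots> = (1 / fst z)^6 * sextic_form c b a 1 (fst z)"
    by (rule sextic_form_scale)
  also have "sextic_form c b a 1 (fst z) = sextic_form a b c (fst z) 1"
    unfolding sextic_form_def by algebra
  also have "\<dots> = (snd z)^2" by (simp add: assms(1) poly_quintic)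
  also have "(1 / fst z)^6 * (snd z)^2 = (snd (flip z))^2"
    by (simp add: flip_def power_divide flip: power_mult)
  finally show ?thesis by (simp add: flip_def)
qed

lemma generic_fst_nonzero:
  fixes a b c :: "'k::field_char_0"
  shows "\<forall>\<^sub>F z in generic (quintic a b c). fst z \<noteq> 0"
  using generic_poly_nonzero[of "quintic a b c" "[:0, 1:]"] by simp

lemma generic_flip:
  fixes a b c :: "'k::field_char_0"
  assumes "\<forall>\<^sub>F z in generic (quintic c b a). Q z"
  shows "\<forall>\<^sub>F z in generic (quintic a b c). Q (flip z)"
proof -
  let ?B = "\<lambda>a b c Q. {z :: 'k \<times> 'k. (snd z)^2 = poly (quintic a b c) (fst z) \<and> \<not> Q z}"
  have "?B a b c (\<lambda>z. Q (flip z)) \<subseteq> ?B a b c (\<lambda>z. fst z \<noteq> 0) \<union> flip ` ?B c b a Q"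
  proof
    fix z assume z: "z \<in> ?B a b c (\<lambda>z. Q (flip z))"
    show "z \<in> ?B a b c (\<lambda>z. fst z \<noteq> 0) \<union> flip ` ?B c b a Q"
    proof (cases "fst z = 0")
      case True
      with z show ?thesis by simp
    next
      case False
      then have "flip z \<in> ?B c b a Q" "z = flip (flip z)"
        using z flip_curve[of z a b c] by (simp_all add: flip_flip)
      then show ?thesis by blast
    qed
  qed
  moreover have "finite (?B a b c (\<lambda>z. fst z \<noteq> 0))"
    using generic_fst_nonzero[of a b c] unfolding eventually_generic .
  moreover have "finite (flip ` ?B c b a Q)"
    using assms unfolding eventually_generic by (rule finite_imageI)
  ultimately show ?thesis
    unfolding eventually_generic by (meson finite_UnI finite_subset)
qed

lemma generic_flip_iff:
  fixes a b c :: "'k::field_char_0"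
  shows "(\<forall>\<^sub>F z in generic (quintic a b c). Q (flip z)) \<longleftrightarrow> (\<forall>\<^sub>F z in generic (quintic c b a). Q z)"
proof
  assume "\<forall>\<^sub>F z in generic (quintic a b c). Q (flip z)"
  then have "\<forall>\<^sub>F z in generic (quintic c b a). Q (flip (flip z))" by (rule generic_flip)
  then show "\<forall>\<^sub>F z in generic (quintic c b a). Q z"
    using generic_fst_nonzero[of c b a] by eventually_elim (simp add: flip_flip)
qed (rule generic_flip)

section \<open>Open sets and regular functions on the quintic curve\<close>

definition affine_point :: "'k \<times> 'k \<Rightarrow> 'k hpoint" where
  "affine_point z = Affine (fst z) (snd z)"

lemma inj_affine_point: "inj affine_point"
  by (auto simp: inj_def affine_point_def prod_eq_iff)

lemma affine_point_eq_iff [simp]: "affine_point z = affine_point w \<longleftrightarrow> z = w"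
  using inj_affine_point by (auto dest: injD)

lemma affine_point_in_quintic_points [simp]:
  "affine_point z \<in> hyp_points 2 (quintic a b c) \<longleftrightarrow> (snd z)^2 = poly (quintic a b c) (fst z)"
  by (auto simp: hyp_points_def affine_point_def)

lemma quintic_points_cases:
  fixes a b c :: "'k::field_char_0"
  assumes "P \<in> hyp_points 2 (quintic a b c)"
  obtains z where "P = affine_point z" "(snd z)^2 = poly (quintic a b c) (fst z)"
    | "P = AtInfinity 0"
proof (cases P)
  case (Affine x y)
  then have "P = affine_point (x, y)" by (simp add: affine_point_def)
  with assms that(1) show ?thesis by simp
next
  case (AtInfinity v)
  with assms that(2) show ?thesis by (auto simp: hyp_points_def quintic_eq_pCons numeral_eq_Suc)
qed

lemma chart_finite_affine_point [simp]: "chart_finite (affine_point z) = Some z"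
  by (simp add: affine_point_def)

lemma chart_infinity_affine_point [simp]:
  "chart_infinity 2 (affine_point z) = (if fst z = 0 then None else Some (flip z))"
  by (simp add: affine_point_def flip_def numeral_eq_Suc)

lemma chart_infinity_curve:
  fixes a b c :: "'k::field_char_0"
  assumes "P \<in> hyp_points 2 (quintic a b c)" "chart_infinity 2 P = Some w"
  shows "(snd w)^2 = poly (quintic c b a) (fst w)"
  using assms(1)
proof (cases rule: quintic_points_cases)
  case (1 z)
  with assms(2) show ?thesis using flip_curve[of z a b c] by (auto split: if_splits)
next
  case 2
  with assms(2) show ?thesis by (auto simp: quintic_eq_pCons)
qed

text \<open>Each basic open set is empty or cofinite by irreducibility, and this alternative
  survives finite intersections and arbitrary unions.\<close>

lemma open_imp_generic:
  fixes a b c :: "'k::{alg_closed_field, field_char_0}"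
  assumes "openin (zariski 2 (quintic a b c)) U" "U \<noteq> {}"
  shows "\<forall>\<^sub>F z in generic (quintic a b c). affine_point z \<in> U"
proof -
  let ?X = "hyp_points 2 (quintic a b c)"
  have "generate_topology_on {?X \<inter> nonvanishing \<chi> G | \<chi> G. \<chi> \<in> charts 2} U"
    using assms(1) by (simp add: zariski_def openin_topology_generated_by_iff)
  then have "U = {} \<or> (\<forall>\<^sub>F z in generic (quintic a b c). affine_point z \<in> U)"
  proof (induction rule: generate_topology_on.induct)
    case (Int U V)
    then show ?case by (auto intro: eventually_conj)
  next
    case (UN K)
    show ?case
    proof (cases "\<Union>K = {}")
      case False
      then obtain k where "k \<in> K" "k \<noteq> {}" by auto
      with UN.IH have "\<forall>\<^sub>F z in generic (quintic a b c). affine_point z \<in> k" by blast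
      then have "\<forall>\<^sub>F z in generic (quintic a b c). affine_point z \<in> \<Union>K"
        by eventually_elim (use \<open>k \<in> K\<close> in blast)
      then show ?thesis ..
    qed simp
  next
    case (Basis U)
    then obtain \<chi> G where U: "U = ?X \<inter> nonvanishing \<chi> G" and "\<chi> \<in> charts 2" by blast
    then consider "\<chi> = chart_finite" | "\<chi> = chart_infinity 2" by (auto simp: charts_def)
    then show ?case
    proof cases
      case 1
      show ?thesis
      proof (rule poly2_generic_cases[OF odd_degree_quintic, of a b c G])
        assume 2: "\<And>x y. y^2 = poly (quintic a b c) x \<Longrightarrow> poly2 G (x, y) = 0"
        have "P \<notin> U" for P
        proof
          assume "P \<in> U"
          then have P: "P \<in> ?X" "P \<in> nonvanishing \<chi> G" by (auto simp: U)
          from P(1) show False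
            by (cases rule: quintic_points_cases) (use P(2) 1 2 in \<open>auto simp: nonvanishing_def\<close>)
        qed
        then show ?thesis by blast
      next
        assume 3: "\<forall>\<^sub>F z in generic (quintic a b c). poly2 G z \<noteq> 0"
        have "\<forall>\<^sub>F z in generic (quintic a b c). affine_point z \<in> U"
          using 3 eventually_generic_curve[of "quintic a b c"]
          by eventually_elim (simp add: U 1 nonvanishing_def del: split_paired_Ex)
        then show ?thesis ..
      qed
    next
      case 2
      show ?thesis
      proof (rule poly2_generic_cases[OF odd_degree_quintic, of c b a G])
        assume 3: "\<And>x y. y^2 = poly (quintic c b a) x \<Longrightarrow> poly2 G (x, y) = 0"
        have "P \<notin> U" for P
        proof
          assume "P \<in> U"
          then obtain w where "P \<in> ?X" "chart_infinity 2 P = Some w" "poly2 G w \<noteq> 0"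
            by (auto simp: U \<open>\<chi> = _\<close> nonvanishing_def)
          with chart_infinity_curve[of P a b c w] 3[of "snd w" "fst w"] show False by simp
        qed
        then show ?thesis by blast
      next
        assume "\<forall>\<^sub>F z in generic (quintic c b a). poly2 G z \<noteq> 0"
        then have "\<forall>\<^sub>F z in generic (quintic a b c). poly2 G (flip z) \<noteq> 0" by (rule generic_flip)
        then have "\<forall>\<^sub>F z in generic (quintic a b c). affine_point z \<in> U"
          using eventually_generic_curve[of "quintic a b c"] generic_fst_nonzero[of a b c]
          by eventually_elim (simp add: U 2 nonvanishing_def del: split_paired_Ex)
        then show ?thesis ..
      qed
    qed
  qed simp
  with assms(2) show ?thesis by blast
qed

text \<open>A single local expression as a quotient suffices: it is valid on a nonempty open set,
  hence generically.\<close>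

lemma regular_imp_rational:
  fixes a b c :: "'k::{alg_closed_field, field_char_0}"
  assumes "regular_on 2 (quintic a b c) W h" "W \<noteq> {}"
  shows "rational_on (quintic a b c) (\<lambda>z. h (affine_point z))"
proof -
  let ?f = "quintic a b c"
  obtain P where "P \<in> W" using assms(2) by blast
  with assms(1) obtain V \<chi> F G where V: "openin (zariski 2 ?f) V" "P \<in> V" "\<chi> \<in> charts 2"
      "\<forall>Q\<in>V. h Q = poly2 F (the (\<chi> Q)) / poly2 G (the (\<chi> Q))"
    unfolding regular_on_def by meson
  have gen: "\<forall>\<^sub>F z in generic ?f. affine_point z \<in> V"
    using V(1,2) by (intro open_imp_generic) auto
  have fst: "rational_on ?f fst" using rational_on_poly[of ?f "[:0, 1:]"] by simp
  have inv: "rational_on ?f (\<lambda>z. 1 / fst z)"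
    using rational_on_inverse[OF _ fst] by (simp add: inverse_eq_divide)
  have flip2: "rational_on ?f (\<lambda>z. snd z / fst z ^ 3)"
  proof -
    have "rational_on ?f (\<lambda>z. snd z * ((1 / fst z) * ((1 / fst z) * (1 / fst z))))"
      by (intro rational_on_mult rational_on_snd inv)
    then show ?thesis by (simp add: power3_eq_cube mult.assoc)
  qed
  \<comment> \<open>The coordinates of the chart \<open>\<chi>\<close> as functions of the affine
    coordinates.\<close>
  define \<zeta> where "\<zeta> = (if \<chi> = chart_finite then id else flip :: 'k \<times> 'k \<Rightarrow> 'k \<times> 'k)"
  have \<zeta>: "\<forall>\<^sub>F z in generic ?f. \<chi> (affine_point z) = Some (\<zeta> z)"
    using generic_fst_nonzero[of a b c]
    by eventually_elim (use V(3) in \<open>auto simp: \<zeta>_def charts_def\<close>)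
  have "rational_on ?f (\<lambda>z. poly2 F (\<zeta> z))" for F
  proof (cases "\<chi> = chart_finite")
    case True
    then show ?thesis using rational_on_poly2[OF fst rational_on_snd] by (simp add: \<zeta>_def)
  next
    case False
    then show ?thesis using rational_on_poly2[OF inv flip2] by (simp add: \<zeta>_def flip_def)
  qed
  then have "rational_on ?f (\<lambda>z. poly2 F (\<zeta> z) * inverse (poly2 G (\<zeta> z)))"
    by (intro rational_on_mult rational_on_inverse odd_degree_quintic)
  moreover have "\<forall>\<^sub>F z in generic ?f. h (affine_point z) = poly2 F (\<zeta> z) * inverse (poly2 G (\<zeta> z))"
    using gen \<zeta> by eventually_elim (use V(4) in \<open>simp add: divide_inverse\<close>)
  ultimately show ?thesis by (rule rational_on_cong)
qed

text \<open>The value at infinity is a default; regularity is claimed on the affine part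
  only.\<close>

fun xcoord :: "'k::zero hpoint \<Rightarrow> 'k" where
  "xcoord (Affine x y) = x"
| "xcoord (AtInfinity v) = 0"

fun ycoord :: "'k::zero hpoint \<Rightarrow> 'k" where
  "ycoord (Affine x y) = y"
| "ycoord (AtInfinity v) = 0"

lemma coord_affine_point [simp]: "xcoord (affine_point z) = fst z" "ycoord (affine_point z) = snd z"
  by (simp_all add: affine_point_def)

lemma affine_part_open: "openin (zariski g f) (hyp_points g f \<inter> nonvanishing chart_finite 1)"
  unfolding zariski_def by (rule topology_generated_by_Basis) (auto simp: charts_def)

lemma affine_point_in_affine_part: "affine_point z \<in> nonvanishing chart_finite 1"
  by (simp add: nonvanishing_def)

lemma coord_regular:
  fixes f :: "'k::field poly"
  assumes "h = xcoord \<or> h = ycoord"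
  shows "regular_on g f (hyp_points g f \<inter> nonvanishing chart_finite 1) h"
proof -
  obtain F where F: "\<And>x y. poly2 F (x, y) = h (Affine x y)"
  proof (cases "h = xcoord")
    case True
    then show ?thesis using that[of "[:[:0, 1:]:]"] by simp
  next
    case False
    with assms show ?thesis using that[of "[:0, 1:]"] by (simp add: poly2_def)
  qed
  let ?V = "hyp_points g f \<inter> nonvanishing chart_finite 1"
  have *: "h Q = poly2 F (the (chart_finite Q)) / poly2 1 (the (chart_finite Q))" if "Q \<in> ?V" for Q
    using that by (cases Q) (auto simp: nonvanishing_def F)
  show ?thesis
    unfolding regular_on_def
  proof
    fix P assume P: "P \<in> ?V"
    show "\<exists>V. openin (zariski g f) V \<and> P \<in> V \<and> V \<subseteq> ?V \<and>
        (\<exists>\<chi>\<in>charts g. \<exists>F G. V \<subseteq> nonvanishing \<chi> G \<and>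
           (\<forall>Q\<in>V. h Q = poly2 F (the (\<chi> Q)) / poly2 G (the (\<chi> Q))))"
      by (rule exI[of _ ?V], intro conjI bexI[of _ chart_finite] exI[of _ F] exI[of _ 1] ballI)
        (use P * affine_part_open in \<open>auto simp: charts_def\<close>)
  qed
qed

section \<open>Pullback of functions under an automorphism\<close>

locale quintic_automorphism =
  fixes a b c :: "'k::{alg_closed_field, field_char_0}" and \<phi>
  assumes aut: "\<phi> \<in> hyp_automorphisms 2 (quintic a b c)"
begin

abbreviation "f \<equiv> quintic a b c"
abbreviation "X \<equiv> hyp_points 2 f"

lemma bij: "bij_betw \<phi> X X"
  using aut by (simp add: hyp_automorphisms_def Bij_def)

lemma maps: "P \<in> X \<Longrightarrow> \<phi> P \<in> X"
  using bij by (auto simp: bij_betw_def)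

text \<open>By injectivity a finite exceptional set, together with the point at infinity, has a
  finite preimage. This is what allows generic equations to be composed with \<phi>.\<close>

lemma generic_image:
  assumes "\<forall>\<^sub>F z in generic f. Q z"
  shows "\<forall>\<^sub>F z in generic f. \<exists>w. \<phi> (affine_point z) = affine_point w \<and> (snd w)^2 = poly f (fst w) \<and> Q w"
proof -
  let ?B = "{z. (snd z)^2 = poly f (fst z) \<and>
    \<not> (\<exists>w. \<phi> (affine_point z) = affine_point w \<and> (snd w)^2 = poly f (fst w) \<and> Q w)}"
  let ?C = "insert (AtInfinity 0) (affine_point ` {z. (snd z)^2 = poly f (fst z) \<and> \<not> Q z})"
  have "\<phi> (affine_point z) \<in> ?C" if "z \<in> ?B" for z
  proof -
    have "\<phi> (affine_point z) \<in> X" using that by (intro maps) simp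
    then show ?thesis
    proof (cases rule: quintic_points_cases)
      case (1 w)
      with that have "\<not> Q w" by blast
      with 1 show ?thesis by simp
    qed simp
  qed
  then have "(\<phi> \<circ> affine_point) ` ?B \<subseteq> ?C" by auto
  moreover have "finite ?C"
    using assms unfolding eventually_generic by simp
  ultimately have "finite ((\<phi> \<circ> affine_point) ` ?B)" by (rule finite_subset)
  moreover have "inj_on (\<phi> \<circ> affine_point) ?B"
  proof (rule inj_onI)
    fix z w assume "z \<in> ?B" "w \<in> ?B" "(\<phi> \<circ> affine_point) z = (\<phi> \<circ> affine_point) w"
    then show "z = w"
      using bij_betw_imp_inj_on[OF bij] inj_onD[of \<phi> X "affine_point z" "affine_point w"] by simp
  qed
  ultimately show ?thesis
    unfolding eventually_generic by (rule finite_imageD)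
qed

lemma generic_transfer:
  assumes "\<forall>\<^sub>F z in generic f. Q z"
  shows "\<forall>\<^sub>F z in generic f. Q (xcoord (\<phi> (affine_point z)), ycoord (\<phi> (affine_point z)))"
  using generic_image[OF assms] by eventually_elim auto

lemma generic_affine:
  "\<forall>\<^sub>F z in generic f. \<phi> (affine_point z) =
     affine_point (xcoord (\<phi> (affine_point z)), ycoord (\<phi> (affine_point z)))"
  using generic_image[OF eventually_True] by eventually_elim auto

lemma pullback_coord_regular:
  assumes "h = xcoord \<or> h = ycoord"
  shows "regular_on 2 f {P \<in> X. \<phi> P \<in> X \<inter> nonvanishing chart_finite 1} (h \<circ> \<phi>)"
proof -
  have "hyp_morphism 2 f 2 f \<phi>" using aut by (simp add: hyp_automorphisms_def)
  with affine_part_open coord_regular[OF assms] show ?thesis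
    unfolding hyp_morphism_def by blast
qed

lemma coord_rational:
  assumes "h = xcoord \<or> h = ycoord"
  shows "rational_on f (\<lambda>z. h (\<phi> (affine_point z)))"
proof -
  have "\<forall>\<^sub>F z in generic f. \<exists>w. (snd z)^2 = poly f (fst z) \<and> \<phi> (affine_point z) = affine_point w \<and> (snd w)^2 = poly f (fst w)"
    using generic_image[OF eventually_True] eventually_generic_curve[of f] by eventually_elim blast
  then obtain z w where "(snd z)^2 = poly f (fst z)" "\<phi> (affine_point z) = affine_point w" "(snd w)^2 = poly f (fst w)"
    using eventually_happens'[OF generic_neq_bot[OF odd_degree_quintic]] by blast
  then have "affine_point z \<in> {P \<in> X. \<phi> P \<in> X \<inter> nonvanishing chart_finite 1}"
    by (simp add: affine_point_in_affine_part)
  then have "{P \<in> X. \<phi> P \<in> X \<inter> nonvanishing chart_finite 1} \<noteq> {}" by blast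
  with regular_imp_rational[OF pullback_coord_regular[OF assms]] show ?thesis by simp
qed

text \<open>Near \<open>P\<close> a pulled-back coordinate is F/G with G nonzero at
  \<open>P\<close>. As \<phi> is generically the identity, F/G is generically the coordinate itself,
  and the polynomial form of this equation holds at every point of the curve, also at
  \<open>P\<close>.\<close>

lemma generic_id_imp_fixed_point:
  assumes id: "\<forall>\<^sub>F z in generic f. \<phi> (affine_point z) = affine_point z"
    and P: "P \<in> X" "\<phi> P = affine_point w"
  shows "P = affine_point w"
proof -
  let ?W = "{P \<in> X. \<phi> P \<in> X \<inter> nonvanishing chart_finite 1}"
  have PW: "P \<in> ?W" using P maps[OF P(1)] by (simp add: affine_point_in_affine_part)
  \<comment> \<open>The local expression at \<open>P\<close> together with its generic equation,
    split by the chart in which it is given.\<close>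
  have local: thesis
    if h: "h = xcoord \<or> h = ycoord"
      and fin: "\<And>z F G. P = affine_point z \<Longrightarrow> poly2 G z \<noteq> 0 \<Longrightarrow> h (affine_point w) = poly2 F z / poly2 G z \<Longrightarrow>
        \<forall>\<^sub>F z in generic f. h (affine_point z) * poly2 G z = poly2 F z \<Longrightarrow> thesis"
      and inf: "\<And>u F G. chart_infinity 2 P = Some u \<Longrightarrow> poly2 G u \<noteq> 0 \<Longrightarrow> h (affine_point w) = poly2 F u / poly2 G u \<Longrightarrow>
        \<forall>\<^sub>F z in generic (quintic c b a). fst z \<noteq> 0 \<and> h (affine_point (flip z)) * poly2 G z = poly2 F z \<Longrightarrow> thesis"
    for h thesis
  proof -
    from pullback_coord_regular[OF h] PW
    obtain V \<chi> F G where V: "openin (zariski 2 f) V" "P \<in> V" "\<chi> \<in> charts 2" "V \<subseteq> nonvanishing \<chi> G"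
        "\<forall>Q\<in>V. (h \<circ> \<phi>) Q = poly2 F (the (\<chi> Q)) / poly2 G (the (\<chi> Q))"
      unfolding regular_on_def by meson
    have gen: "\<forall>\<^sub>F z in generic f. affine_point z \<in> V"
      using V(1,2) by (intro open_imp_generic) auto
    obtain u where u: "\<chi> P = Some u" "poly2 G u \<noteq> 0"
      using V(2,4) unfolding nonvanishing_def by blast
    have hw: "h (affine_point w) = poly2 F u / poly2 G u"
      using V(2,5) P(2) u(1) by (metis comp_apply option.sel)
    have eq: "h (affine_point z) * poly2 G v = poly2 F v"
      if "affine_point z \<in> V" "\<phi> (affine_point z) = affine_point z" "\<chi> (affine_point z) = Some v" for z v
    proof -
      have "poly2 G v \<noteq> 0" using that(1,3) V(4) unfolding nonvanishing_def by auto
      moreover have "h (affine_point z) = poly2 F v / poly2 G v"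
        using V(5)[rule_format, OF that(1)] that(2,3) by simp
      ultimately show ?thesis by simp
    qed
    from V(3) consider "\<chi> = chart_finite" | "\<chi> = chart_infinity 2" by (auto simp: charts_def)
    then show thesis
    proof cases
      case 1
      have "P = affine_point u"
        using u(1) unfolding 1 by (cases P) (auto simp: affine_point_def)
      moreover have "\<forall>\<^sub>F z in generic f. h (affine_point z) * poly2 G z = poly2 F z"
        using gen id by eventually_elim (rule eq, simp_all add: 1)
      ultimately show thesis using fin u(2) hw by blast
    next
      case 2
      have "\<forall>\<^sub>F z in generic f. fst (flip z) \<noteq> 0 \<and> h (affine_point (flip (flip z))) * poly2 G (flip z) = poly2 F (flip z)"
        using gen id generic_fst_nonzero[of a b c]
        by eventually_elim (use eq 2 in \<open>simp add: flip_flip\<close>)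
      then have "\<forall>\<^sub>F z in generic (quintic c b a). fst z \<noteq> 0 \<and> h (affine_point (flip z)) * poly2 G z = poly2 F z"
        by (rule generic_flip_iff[where Q = "\<lambda>z. fst z \<noteq> 0 \<and> h (affine_point (flip z)) * poly2 G z = poly2 F z", THEN iffD1])
      then show thesis using inf u hw unfolding 2 by blast
    qed
  qed
  have x: "\<exists>z. P = affine_point z \<and> fst z = fst w"
  proof (rule local[of xcoord])
    fix z F G assume z: "P = affine_point z" and G: "poly2 G z \<noteq> 0" "xcoord (affine_point w) = poly2 F z / poly2 G z"
      and ev: "\<forall>\<^sub>F z in generic f. xcoord (affine_point z) * poly2 G z = poly2 F z"
    have "poly2 (smult [:0, 1:] G - F) (fst z, snd z) = 0"
      by (rule poly2_generic_zero[OF odd_degree_quintic])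
        (use ev P(1) in \<open>simp_all add: z poly2_def\<close>)
    then have "fst z * poly2 G z = poly2 F z" by (simp add: poly2_def)
    then have "poly2 F z / poly2 G z = fst z" using G(1) by (simp add: divide_eq_eq)
    with G(2) z show ?thesis by auto
  next
    fix u F G assume u: "chart_infinity 2 P = Some u" and G: "poly2 G u \<noteq> 0" "xcoord (affine_point w) = poly2 F u / poly2 G u"
      and ev: "\<forall>\<^sub>F z in generic (quintic c b a). fst z \<noteq> 0 \<and> xcoord (affine_point (flip z)) * poly2 G z = poly2 F z"
    \<comment> \<open>In the chart at infinity x is 1/u, so the polynomial equation is u F = G. It
      also excludes the point u = 0, where G would vanish.\<close>
    have "poly2 (smult [:0, 1:] F - G) (fst u, snd u) = 0"
    proof (rule poly2_generic_zero[OF odd_degree_quintic])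
      show "\<forall>\<^sub>F z in generic (quintic c b a). poly2 (smult [:0, 1:] F - G) z = 0"
        using ev by eventually_elim (auto simp: poly2_def flip_def field_simps)
      show "(snd u)^2 = poly (quintic c b a) (fst u)"
        using chart_infinity_curve[OF P(1) u] .
    qed
    then have *: "fst u * poly2 F u = poly2 G u" by (simp add: poly2_def)
    from P(1) show ?thesis
    proof (cases rule: quintic_points_cases)
      case (1 z)
      with u have "fst z \<noteq> 0" "u = flip z" by (auto split: if_splits)
      with * have "fst z * poly2 G u = poly2 F u" by (auto simp: flip_def field_simps)
      then have "poly2 F u / poly2 G u = fst z" using G(1) by (simp add: divide_eq_eq)
      with G(2) 1(1) show ?thesis by auto
    next
      case 2
      with u have "fst u = 0" by auto
      with * G(1) show ?thesis by simp
    qed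
  qed simp
  have y: "ycoord P = snd w"
  proof (rule local[of ycoord])
    fix z F G assume z: "P = affine_point z" and G: "poly2 G z \<noteq> 0" "ycoord (affine_point w) = poly2 F z / poly2 G z"
      and ev: "\<forall>\<^sub>F z in generic f. ycoord (affine_point z) * poly2 G z = poly2 F z"
    have "poly2 (pCons 0 G - F) (fst z, snd z) = 0"
      by (rule poly2_generic_zero[OF odd_degree_quintic])
        (use ev P(1) in \<open>simp_all add: z poly2_def\<close>)
    then have "snd z * poly2 G z = poly2 F z" by (simp add: poly2_def)
    then have "poly2 F z / poly2 G z = snd z" using G(1) by (simp add: divide_eq_eq)
    with G(2) z show ?thesis by auto
  next
    fix u F G assume u: "chart_infinity 2 P = Some u" and G: "poly2 G u \<noteq> 0" "ycoord (affine_point w) = poly2 F u / poly2 G u"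
      and ev: "\<forall>\<^sub>F z in generic (quintic c b a). fst z \<noteq> 0 \<and> ycoord (affine_point (flip z)) * poly2 G z = poly2 F z"
    \<comment> \<open>The same for y = v / u^3, giving u^3 F = v G.\<close>
    have "poly2 (smult [:0, 0, 0, 1:] F - pCons 0 G) (fst u, snd u) = 0"
    proof (rule poly2_generic_zero[OF odd_degree_quintic])
      show "\<forall>\<^sub>F z in generic (quintic c b a). poly2 (smult [:0, 0, 0, 1:] F - pCons 0 G) z = 0"
        using ev by eventually_elim (auto simp: poly2_def flip_def field_simps power3_eq_cube)
      show "(snd u)^2 = poly (quintic c b a) (fst u)"
        using chart_infinity_curve[OF P(1) u] .
    qed
    then have *: "fst u ^ 3 * poly2 F u = snd u * poly2 G u" by (simp add: poly2_def power3_eq_cube mult.assoc)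
    obtain z where z: "P = affine_point z" using x by blast
    with u have "fst z \<noteq> 0" "u = flip z" by (auto split: if_splits)
    with * have "snd z * poly2 G u = poly2 F u" by (auto simp: flip_def field_simps)
    then have "poly2 F u / poly2 G u = snd z" using G(1) by (simp add: divide_eq_eq)
    with G(2) z show ?thesis by auto
  qed simp
  from x y show ?thesis by (auto simp: prod_eq_iff)
qed

text \<open>The preceding lemma fixes every point with affine image. If P is affine, it applies to
  the preimage of P and shows that this preimage is P; so P cannot be sent to infinity.\<close>

lemma generic_id_imp_id:
  assumes id: "\<forall>\<^sub>F z in generic f. \<phi> (affine_point z) = affine_point z" and P: "P \<in> X"
  shows "\<phi> P = P"
  using maps[OF P]
proof (cases rule: quintic_points_cases)
  case (1 z)
  with generic_id_imp_fixed_point[OF id P] show ?thesis by simp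
next
  case 2
  show ?thesis
    using P
  proof (cases rule: quintic_points_cases)
    case (1 w)
    obtain R where R: "R \<in> X" "\<phi> R = P" using bij_betw_imp_surj_on[OF bij] P by (metis imageE)
    with generic_id_imp_fixed_point[OF id R(1)] 1 show ?thesis by auto
  next
    case 2
    with \<open>\<phi> P = AtInfinity 0\<close> show ?thesis by simp
  qed
qed

end

section \<open>Relations between two functions on the curve\<close>

text \<open>At a root of \<open>d\<close> the left side has order at least 2, to which a squarefree
  \<open>f\<close> contributes at most 1, so \<open>g\<close> vanishes there as well; the linear
  factor is cancelled and the argument repeated.\<close>

lemma square_dvd_square_times_rsquarefree:
  fixes d f g h :: "'k::alg_closed_field poly"
  assumes f: "rsquarefree f" and "d \<noteq> 0" "d^2 * h = g^2 * f"
  shows "d dvd g"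
  using assms(2,3)
proof (induction "degree d" arbitrary: d g)
  case 0
  then show ?case by (metis is_unit_iff_degree unit_imp_dvd)
next
  case (Suc n)
  obtain r where "poly d r = 0" using alg_closed_imp_poly_has_root[of d] Suc.hyps(2) by auto
  then obtain d1 where d1: "d = [:-r, 1:] * d1" by (auto simp: poly_eq_0_iff_dvd elim: dvdE)
  have d1': "d1 \<noteq> 0" "n = degree d1" using Suc.prems(1) Suc.hyps(2) by (auto simp: d1 degree_mult_eq simp del: mult_pCons_left)
  have "poly g r = 0"
  proof (rule ccontr)
    assume g: "poly g r \<noteq> 0"
    have "f \<noteq> 0" "order r f = 0 \<or> order r f = 1" using f unfolding rsquarefree_def by blast+
    then have f0: "f \<noteq> 0" "order r f \<le> 1" by auto
    have "g^2 * f \<noteq> 0" using g f0 by auto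
    moreover have "g^2 * f = [:-r, 1:]^2 * (d1^2 * h)"
      using Suc.prems(2) unfolding d1 power_mult_distrib by (simp only: mult.assoc)
    then have "[:-r, 1:]^2 dvd g^2 * f" by (simp only: dvd_triv_left)
    ultimately have "2 \<le> order r (g^2 * f)" by (simp only: order_divides) simp
    also have "\<dots> = order r (g^2) + order r f" by (rule order_mult[OF \<open>g^2 * f \<noteq> 0\<close>])
    also have "order r (g^2) = 0" using g by (intro order_0I) simp
    finally show False using f0 by simp
  qed
  then obtain g1 where g1: "g = [:-r, 1:] * g1" by (auto simp: poly_eq_0_iff_dvd elim: dvdE)
  have "[:-r, 1:]^2 * (d1^2 * h) = [:-r, 1:]^2 * (g1^2 * f)"
    using Suc.prems(2) unfolding d1 g1 power_mult_distrib by (simp only: mult.assoc)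
  moreover have "[:-r, 1:]^2 \<noteq> 0" by simp
  ultimately have "d1^2 * h = g1^2 * f" using mult_left_cancel by blast
  with Suc.hyps(1) d1' have "d1 dvd g1" by blast
  then show ?case unfolding d1 g1 by (rule mult_dvd_mono[OF dvd_refl])
qed

section \<open>Gauss's lemma for polynomials over k[x]\<close>

abbreviation eval_coeffs :: "'k::comm_ring_1 \<Rightarrow> 'k poly poly \<Rightarrow> 'k poly" where
  "eval_coeffs r P \<equiv> map_poly (\<lambda>c. poly c r) P"

lemma poly_eval_coeffs: "poly (eval_coeffs r P) u = poly2 P (r, u)"
  by (induction P) (simp_all add: map_poly_pCons)

lemma eval_coeffs_mult:
  fixes P S :: "'k::field_char_0 poly poly"
  shows "eval_coeffs r (P * S) = eval_coeffs r P * eval_coeffs r S"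
  by (rule poly_eqI_nonzero) (simp add: poly_eval_coeffs poly2_def)

lemma eval_coeffs_eq_0_imp_dvd:
  fixes P :: "'k::field poly poly"
  assumes "eval_coeffs r P = 0"
  shows "\<exists>P'. P = smult [:-r, 1:] P'"
proof
  show "P = smult [:-r, 1:] (map_poly (\<lambda>c. c div [:-r, 1:]) P)"
  proof (rule poly_eqI)
    fix i
    have "poly (coeff P i) r = 0" using arg_cong[OF assms, of "\<lambda>p. coeff p i"] by (simp add: coeff_map_poly)
    then have "[:-r, 1:] dvd coeff P i" by (simp only: poly_eq_0_iff_dvd)
    then show "coeff P i = coeff (smult [:-r, 1:] (map_poly (\<lambda>c. c div [:-r, 1:]) P)) i"
      by (simp only: coeff_smult coeff_map_poly div_0 dvd_mult_div_cancel)
  qed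
qed

text \<open>Over an algebraically closed field the primes of \<open>k[x]\<close> are linear, so a polynomial over
  \<open>k[x]\<close> is primitive iff no evaluation of \<open>x\<close> kills it.\<close>

definition primitive :: "'k::field poly poly \<Rightarrow> bool" where
  "primitive P \<longleftrightarrow> (\<forall>r. eval_coeffs r P \<noteq> 0)"

text \<open>A value r that kills P gives a factor x - r common to all coefficients. Removing it
  lowers the degree of the leading coefficient.\<close>

lemma primitive_part:
  fixes P :: "'k::alg_closed_field poly poly"
  assumes "P \<noteq> 0"
  shows "\<exists>e P'. e \<noteq> 0 \<and> P = smult e P' \<and> primitive P'"
  using assms
proof (induction "degree (lead_coeff P)" arbitrary: P rule: less_induct)
  case less
  show ?case
  proof (cases "primitive P")
    case True
    then show ?thesis by (intro exI[of _ 1] exI[of _ P]) simp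
  next
    case False
    then obtain r where "eval_coeffs r P = 0" by (auto simp: primitive_def)
    then obtain P1 where P1: "P = smult [:-r, 1:] P1" using eval_coeffs_eq_0_imp_dvd by blast
    have "P1 \<noteq> 0" using less.prems P1 by auto
    have "lead_coeff P = [:-r, 1:] * lead_coeff P1" unfolding P1 by (rule lead_coeff_smult)
    then have "degree (lead_coeff P) = Suc (degree (lead_coeff P1))"
      using \<open>P1 \<noteq> 0\<close> by (simp add: degree_mult_eq del: mult_pCons_left)
    then obtain e P' where e: "e \<noteq> 0" "P1 = smult e P'" "primitive P'"
      using less.hyps[of P1] \<open>P1 \<noteq> 0\<close> by auto
    have "P = smult ([:-r, 1:] * e) P'" unfolding P1 e(2) by (rule smult_smult)
    moreover have "[:-r, 1:] * e \<noteq> 0" using e(1) by (simp only: mult_eq_0_iff) simp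
    ultimately show ?thesis using e(3) by blast
  qed
qed

text \<open>At a root r of \<open>e\<close> the product of the specialised P and S is zero. A
  primitive P stays nonzero, so x - r divides S and can be cancelled.\<close>

lemma primitive_dvd_smult:
  fixes P Q S :: "'k::{alg_closed_field, field_char_0} poly poly"
  assumes P: "primitive P" and "e \<noteq> 0" "smult e Q = P * S"
  shows "P dvd Q"
  using assms(2,3)
proof (induction "degree e" arbitrary: e S)
  case 0
  then obtain k where k: "e = [:k:]" "k \<noteq> 0" by (metis degree_eq_zeroE pCons_0_0)
  have "Q = smult ([:1 / k:] * e) Q" using k by (simp add: pCons_one)
  also have "\<dots> = smult [:1 / k:] (P * S)" by (simp only: smult_smult[symmetric] 0(3))
  also have "\<dots> = P * smult [:1 / k:] S" by simp
  finally show ?case by (rule dvdI)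
next
  case (Suc n)
  obtain r where "poly e r = 0" using alg_closed_imp_poly_has_root[of e] Suc.hyps(2) by auto
  then obtain e1 where e1: "e = [:-r, 1:] * e1" by (auto simp: poly_eq_0_iff_dvd elim: dvdE)
  have e1': "e1 \<noteq> 0" "n = degree e1" using Suc.prems(1) Suc.hyps(2) by (auto simp: e1 degree_mult_eq simp del: mult_pCons_left)
  have "eval_coeffs r (smult e Q) = 0"
    by (rule poly_eqI) (simp add: coeff_map_poly \<open>poly e r = 0\<close>)
  then have "eval_coeffs r P * eval_coeffs r S = 0" unfolding Suc.prems(2) eval_coeffs_mult .
  then have "eval_coeffs r S = 0" using P unfolding primitive_def by simp
  then obtain S1 where S1: "S = smult [:-r, 1:] S1" using eval_coeffs_eq_0_imp_dvd by blast
  have "smult [:-r, 1:] (smult e1 Q) = smult [:-r, 1:] (P * S1)"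
    using Suc.prems(2) unfolding e1 S1 by (simp only: smult_smult mult_smult_right)
  moreover have "[:-r, 1:] \<noteq> 0" by simp
  ultimately have "smult e1 Q = P * S1" by (metis smult_cancel)
  with Suc.hyps(1) e1' show ?case by blast
qed

text \<open>Exchanges the two variables: the coefficient of x^j, read as a polynomial in the outer
  variable.\<close>

lemma coeff_poly_const: "coeff (poly P [:t:]) j = poly (map_poly (\<lambda>c. coeff c j) P) t"
  by (induction P) (simp_all add: map_poly_pCons)

text \<open>After substituting t for the outer variable, degrees in x add up whenever Q stays
  nonzero. So each higher coefficient of P in x vanishes at infinitely many t.\<close>

lemma degree_coeff_le_of_dvd:
  fixes P Q :: "'k::field_char_0 poly poly"
  assumes "P dvd Q" "Q \<noteq> 0" and deg: "\<And>t. degree (poly Q [:t:]) \<le> m"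
  shows "degree (coeff P i) \<le> m"
proof (rule degree_le, intro allI impI)
  fix j assume j: "m < j"
  obtain S where S: "Q = P * S" using assms(1) by (rule dvdE)
  have "inj (\<lambda>t :: 'k. [:t:])" by (auto simp: inj_def)
  then have fin: "finite {t. poly Q [:t:] = 0}"
    using finite_vimageI[OF poly_roots_finite[OF assms(2)]] by (simp add: vimage_def)
  have "map_poly (\<lambda>c. coeff c j) P = 0"
  proof (rule poly_eqI_infinite)
    have "coeff (poly P [:t:]) j = 0" if "poly Q [:t:] \<noteq> 0" for t
    proof -
      have "poly Q [:t:] = poly P [:t:] * poly S [:t:]" by (simp add: S)
      then have "degree (poly P [:t:]) \<le> degree (poly Q [:t:])"
        using that by (simp add: degree_mult_eq)
      with deg[of t] j show ?thesis by (intro coeff_eq_0) simp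
    qed
    then have "- {t. poly Q [:t:] = 0} \<subseteq> {t. poly (map_poly (\<lambda>c. coeff c j) P) t = poly 0 t}"
      unfolding coeff_poly_const by auto
    moreover have "infinite (- {t. poly Q [:t:] = 0})"
      using fin infinite_UNIV_char_0[where ?'a = 'k] by (simp add: Compl_eq_Diff_UNIV)
    ultimately show "infinite {t. poly (map_poly (\<lambda>c. coeff c j) P) t = poly 0 t}"
      using infinite_super by blast
  qed
  then have "coeff (map_poly (\<lambda>c. coeff c j) P) i = 0" by simp
  then show "coeff (coeff P i) j = 0" by (simp add: coeff_map_poly)
qed

definition const_coeffs :: "'k::comm_ring_1 poly \<Rightarrow> 'k poly poly" where
  "const_coeffs p = map_poly (\<lambda>c. [:c:]) p"

lemma poly_const_coeffs [simp]: "poly (const_coeffs p) [:u:] = [:poly p u:]"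
  unfolding const_coeffs_def by (induction p) (simp_all add: map_poly_pCons)

lemma poly2_const_coeffs [simp]: "poly2 (const_coeffs p) (x, u) = poly p u"
  by (simp add: poly2_def)

text \<open>A relation of least degree between \<open>x\<close> and a function \<open>u\<close> on the curve divides every other one,
  so bounds on the degree in \<open>x\<close> of any relation carry over to it.\<close>

lemma minimal_relation_degree_le:
  fixes f :: "'k::{alg_closed_field, field_char_0} poly" and u :: "'k \<times> 'k \<Rightarrow> 'k"
  assumes odd: "odd (degree f)"
    and P0: "P0 \<noteq> 0" "\<forall>\<^sub>F z in generic f. poly2 P0 (fst z, u z) = 0"
    and min: "\<And>R. \<forall>\<^sub>F z in generic f. poly2 R (fst z, u z) = 0 \<Longrightarrow> degree R < degree P0 \<Longrightarrow> R = 0"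
    and Q: "Q \<noteq> 0" "\<forall>\<^sub>F z in generic f. poly2 Q (fst z, u z) = 0" "\<And>t. degree (poly Q [:t:]) \<le> m"
  obtains e P where "e \<noteq> 0" "P0 = smult e P" "\<forall>i. degree (coeff P i) \<le> m"
proof -
  obtain e P where e: "e \<noteq> 0" "P0 = smult e P" "primitive P"
    using primitive_part[OF P0(1)] by blast
  have P: "P \<noteq> 0" and degP: "degree P = degree P0" using P0(1) e by auto
  have vanP: "\<forall>\<^sub>F z in generic f. poly2 P (fst z, u z) = 0"
    using P0(2) generic_poly_nonzero[OF odd e(1)]
    by eventually_elim (simp add: e(2) poly2_def)
  \<comment> \<open>Pseudo-division stays inside k[x]; the remainder is a relation of smaller
    degree, hence 0, and Gauss's lemma removes the factor \<open>l\<close>.\<close>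
  obtain S R where SR: "pseudo_divmod Q P = (S, R)" by (cases "pseudo_divmod Q P")
  define l where "l = coeff P (degree P) ^ (Suc (degree Q) - degree P)"
  have l: "smult l Q = P * S + R" "R = 0 \<or> degree R < degree P" and "l \<noteq> 0"
    using pseudo_divmod[OF P SR] P by (simp_all add: l_def)
  have "\<forall>\<^sub>F z in generic f. poly2 R (fst z, u z) = 0"
    using Q(2) vanP
  proof eventually_elim
    case (elim z)
    have "poly2 (smult l Q) (fst z, u z) = poly2 (P * S + R) (fst z, u z)" by (simp only: l(1))
    with elim show ?case by (simp add: poly2_def)
  qed
  then have "R = 0" using min l(2) degP by auto
  with l(1) have "P dvd Q" using primitive_dvd_smult[OF e(3) \<open>l \<noteq> 0\<close>] by simp
  then have "\<forall>i. degree (coeff P i) \<le> m" using degree_coeff_le_of_dvd[OF _ Q(1,3)] by blast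
  with e(1,2) show thesis by (rule that)
qed

section \<open>Automorphisms act on the line by Moebius transformations\<close>

lemma degree_le_1E:
  assumes "degree p \<le> 1"
  obtains c0 c1 where "p = [:c0, c1:]"
proof -
  obtain c0 q where q: "p = pCons c0 q" by (cases p)
  with assms have "degree q = 0" by (auto split: if_splits)
  then obtain c1 where "q = [:c1:]" by (rule degree_eq_zeroE)
  with q that show thesis by blast
qed

lemma generic_conj:
  assumes "\<forall>\<^sub>F z in generic f. Q z"
  shows "\<forall>\<^sub>F z in generic f. Q (fst z, - snd z)"
proof -
  let ?B = "{z. (snd z)^2 = poly f (fst z) \<and> \<not> Q z}"
  have "{z. (snd z)^2 = poly f (fst z) \<and> \<not> Q (fst z, - snd z)} \<subseteq> (\<lambda>z. (fst z, - snd z)) ` ?B"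
  proof
    fix z assume "z \<in> {z. (snd z)^2 = poly f (fst z) \<and> \<not> Q (fst z, - snd z)}"
    then have "(fst z, - snd z) \<in> ?B" by simp
    then show "z \<in> (\<lambda>z. (fst z, - snd z)) ` ?B" by (rule image_eqI[rotated]) simp
  qed
  moreover have "finite ((\<lambda>z. (fst z, - snd z)) ` ?B)"
    using assms unfolding eventually_generic by (rule finite_imageI)
  ultimately show ?thesis unfolding eventually_generic by (rule finite_subset)
qed

lemma degree_quintic: "degree (quintic a b c) = 5" for a b c :: "'k::field_char_0"
  by (simp add: quintic_eq_pCons)

locale genus2_automorphism = quintic_automorphism +
  assumes sqfree: "rsquarefree (quintic a b c)"
begin

definition u where "u z = xcoord (\<phi> (affine_point z))"
definition w where "w z = ycoord (\<phi> (affine_point z))"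

lemma image_affine: "\<forall>\<^sub>F z in generic f. \<phi> (affine_point z) = affine_point (u z, w z)"
  using generic_affine unfolding u_def w_def .

lemma transfer: "\<forall>\<^sub>F z in generic f. Q z \<Longrightarrow> \<forall>\<^sub>F z in generic f. Q (u z, w z)"
  unfolding u_def w_def by (rule generic_transfer)

lemma image_curve: "\<forall>\<^sub>F z in generic f. (w z)^2 = poly f (u z)"
  using transfer[OF eventually_generic_curve] by simp

lemma u_rational: "\<exists>d p q. d \<noteq> 0 \<and> (\<forall>\<^sub>F z in generic f. poly d (fst z) * u z = poly p (fst z) + poly q (fst z) * snd z)"
  using coord_rational[of xcoord] unfolding rational_on_def u_def by simp

lemma w_rational: "\<exists>d p q. d \<noteq> 0 \<and> (\<forall>\<^sub>F z in generic f. poly d (fst z) * w z = poly p (fst z) + poly q (fst z) * snd z)"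
  using coord_rational[of ycoord] unfolding rational_on_def w_def by simp

lemma obtain_inverse:
  obtains \<psi> where "genus2_automorphism a b c \<psi>" "\<forall>P\<in>X. \<psi> (\<phi> P) = P"
proof -
  interpret G: group "hyp_Aut 2 f" by (rule group_hyp_Aut)
  have \<phi>: "\<phi> \<in> carrier (hyp_Aut 2 f)" using aut by (simp add: carrier_hyp_Aut)
  then obtain \<psi> where \<psi>: "\<psi> \<in> carrier (hyp_Aut 2 f)" "\<psi> \<otimes>\<^bsub>hyp_Aut 2 f\<^esub> \<phi> = \<one>\<^bsub>hyp_Aut 2 f\<^esub>"
    using G.l_inv_ex by blast
  have "\<forall>P\<in>X. \<psi> (\<phi> P) = P"
  proof
    fix P assume "P \<in> X"
    then show "\<psi> (\<phi> P) = P"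
      using fun_cong[OF \<psi>(2), of P] by (simp add: mult_hyp_Aut[OF \<psi>(1) \<phi>] one_hyp_Aut compose_eq)
  qed
  moreover have "genus2_automorphism a b c \<psi>"
    using \<psi>(1) sqfree by unfold_locales (simp_all add: carrier_hyp_Aut)
  ultimately show thesis by (rule that[rotated])
qed

lemma generic_inverse:
  assumes "\<forall>P\<in>X. \<psi> (\<phi> P) = P"
  shows "\<forall>\<^sub>F z in generic f. \<psi> (affine_point (u z, w z)) = affine_point z"
  using image_affine eventually_generic_curve[of f]
proof eventually_elim
  case (elim z)
  then have "affine_point z \<in> X" by simp
  with assms elim(1) show ?case by metis
qed

text \<open>The relation comes from the inverse automorphism: \<open>x\<close> is a root of a quadratic polynomial over \<open>k(u)\<close>.\<close>

lemma quadratic_relation: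
  obtains Q where "Q \<noteq> 0" "\<forall>\<^sub>F z in generic f. poly2 Q (fst z, u z) = 0" "\<forall>t. degree (poly Q [:t:]) \<le> 2"
proof -
  obtain \<psi> where \<psi>: "genus2_automorphism a b c \<psi>" "\<forall>P\<in>X. \<psi> (\<phi> P) = P"
    by (rule obtain_inverse)
  interpret inv: genus2_automorphism a b c \<psi> by (rule \<psi>(1))
  obtain d p q where d: "d \<noteq> 0"
    and ev: "\<forall>\<^sub>F z in generic f. poly d (fst z) * inv.u z = poly p (fst z) + poly q (fst z) * snd z"
    using inv.u_rational by blast
  let ?x = "[:[:0, 1 :: 'a:]:]"
  \<comment> \<open>The inverse automorphism gives d(u) x = p(u) + q(u) w. Squaring after isolating
    w and using w^2 = f(u) leaves an equation of degree 2 in x.\<close>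
  let ?Q = "(const_coeffs d * ?x - const_coeffs p)^2 - const_coeffs (q^2 * f)"
  have "\<forall>\<^sub>F z in generic f. poly2 ?Q (fst z, u z) = 0"
    using transfer[OF ev] generic_inverse[OF \<psi>(2)] image_curve
  proof eventually_elim
    case (elim z)
    have "inv.u (u z, w z) = fst z" unfolding inv.u_def elim(2) by simp
    with elim(1) have "poly d (u z) * fst z - poly p (u z) = poly q (u z) * w z" by simp
    moreover have "poly2 ?Q (fst z, u z) =
        (poly d (u z) * fst z - poly p (u z))^2 - (poly q (u z))^2 * poly f (u z)"
      by (simp add: poly2_def mult.commute)
    ultimately show ?case by (simp add: power_mult_distrib elim(3))
  qed
  moreover have Qt: "poly ?Q [:t:] = [:- poly p t, poly d t:]^2 - [:poly (q^2 * f) t:]" for t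
    by simp
  moreover have "degree (poly ?Q [:t:]) \<le> 2" for t
    unfolding Qt by (intro degree_diff_le order_trans[OF degree_power_le]) simp_all
  moreover have "?Q \<noteq> 0"
  proof
    assume Q0: "?Q = 0"
    have "finite {t. poly d t = 0}" using d by (rule poly_roots_finite)
    from ex_new_if_finite[OF infinite_UNIV_char_0 this] obtain t where t: "poly d t \<noteq> 0" by auto
    have "coeff ([:- poly p t, poly d t:]^2 - [:poly (q^2 * f) t:]) 2 = (poly d t)^2"
      by (simp add: power2_eq_square numeral_eq_Suc)
    moreover have "[:- poly p t, poly d t:]^2 - [:poly (q^2 * f) t:] = 0"
      unfolding Qt[symmetric] Q0 by simp
    ultimately show False using t by simp
  qed
  ultimately show thesis using that by blast
qed

text \<open>If \<open>u\<close> involved \<open>y\<close>, its minimal polynomial over \<open>k(x)\<close> would have coefficients of degree at most 2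
  and hence a discriminant of degree at most 4; but the discriminant is \<open>f\<close> times a square.\<close>

lemma u_in_base_field:
  assumes d: "d \<noteq> 0"
    and ev: "\<forall>\<^sub>F z in generic f. poly d (fst z) * u z = poly p (fst z) + poly q (fst z) * snd z"
  shows "q = 0"
proof (rule ccontr)
  assume q: "q \<noteq> 0"
  \<comment> \<open>The norm (d U - p)^2 - q^2 f of d U - (p + q y); for q \<noteq> 0 no linear
    relation exists, since 1 and y are independent over k(x).\<close>
  let ?P0 = "[:p^2 - q^2 * f, - 2 * p * d, d^2:]"
  obtain Q where Q: "Q \<noteq> 0" "\<forall>\<^sub>F z in generic f. poly2 Q (fst z, u z) = 0" "\<forall>t. degree (poly Q [:t:]) \<le> 2"
    by (rule quadratic_relation)
  have van: "\<forall>\<^sub>F z in generic f. poly2 ?P0 (fst z, u z) = 0"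
    using ev eventually_generic_curve[of f]
  proof eventually_elim
    case (elim z)
    have "poly2 ?P0 (fst z, u z) =
        (poly d (fst z) * u z - poly p (fst z))^2 - (poly q (fst z))^2 * poly f (fst z)"
      by (simp add: algebra_simps power2_eq_square)
    also have "poly d (fst z) * u z - poly p (fst z) = poly q (fst z) * snd z" using elim(1) by simp
    finally show ?case by (simp add: power_mult_distrib elim(2))
  qed
  have min: "R = 0" if R: "\<forall>\<^sub>F z in generic f. poly2 R (fst z, u z) = 0" "degree R < degree ?P0" for R
  proof -
    have "degree R \<le> 1" using R(2) d by (simp split: if_splits)
    then obtain r0 r1 where R': "R = [:r0, r1:]" by (rule degree_le_1E) 
    have "\<forall>\<^sub>F z in generic f. poly (d * r0 + r1 * p) (fst z) + poly (r1 * q) (fst z) * snd z = 0"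
      using R(1) ev
    proof eventually_elim
      case (elim z)
      have "poly (d * r0 + r1 * p) (fst z) + poly (r1 * q) (fst z) * snd z =
          poly d (fst z) * poly r0 (fst z) + poly r1 (fst z) * (poly p (fst z) + poly q (fst z) * snd z)"
        by (simp add: algebra_simps)
      also have "\<dots> = poly d (fst z) * poly2 R (fst z, u z)"
        unfolding elim(2)[symmetric] by (simp add: R' algebra_simps)
      finally show ?case by (simp add: elim(1))
    qed
    then have "d * r0 + r1 * p = 0 \<and> r1 * q = 0"
      by (rule generic_zero_imp_0[OF odd_degree_quintic])
    with q d show ?thesis by (auto simp: R')
  qed
  have "?P0 \<noteq> 0" using d by simp
  then obtain e P where e: "e \<noteq> 0" "?P0 = smult e P" "\<forall>i. degree (coeff P i) \<le> 2"
    by (rule minimal_relation_degree_le[OF odd_degree_quintic _ van min Q(1,2) Q(3)[rule_format]])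
  have coeffs: "coeff ?P0 i = e * coeff P i" for i by (simp only: e(2) coeff_smult)
  let ?n = "coeff P 0" and ?m = "coeff P 1" and ?l = "coeff P 2"
  have c: "p^2 - q^2 * f = e * ?n" "- 2 * p * d = e * ?m" "d^2 = e * ?l"
    using coeffs[of 0] coeffs[of 1] coeffs[of 2] by (simp_all add: numeral_eq_Suc)
  have "e^2 * (?m^2 - 4 * ?l * ?n) = (e * ?m)^2 - 4 * (e * ?l) * (e * ?n)"
    by (simp add: algebra_simps power2_eq_square)
  also have "\<dots> = (2 * d * q)^2 * f"
    unfolding c[symmetric] by (simp add: algebra_simps power2_eq_square)
  finally have disc: "e^2 * (?m^2 - 4 * ?l * ?n) = (2 * d * q)^2 * f" .
  \<comment> \<open>Squarefreeness of f lets the content \<open>e\<close> be divided out, so the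
    discriminant of the primitive relation is still f times a square.\<close>
  then have "e dvd 2 * d * q"
    by (rule square_dvd_square_times_rsquarefree[OF sqfree e(1)])
  then obtain k where k: "2 * d * q = e * k" by (rule dvdE)
  have "e^2 * (?m^2 - 4 * ?l * ?n) = e^2 * (k^2 * f)"
    using disc unfolding k power_mult_distrib by (simp only: mult.assoc)
  moreover have "e^2 \<noteq> 0" using e(1) by simp
  ultimately have eq: "?m^2 - 4 * ?l * ?n = k^2 * f" using mult_left_cancel by blast
  have "degree (?m^2) \<le> 4"
    using degree_power_le[of ?m 2] e(3)[rule_format, of 1] by simp
  moreover have "degree (4 * ?l * ?n) \<le> 4"
  proof -
    have "4 * ?l * ?n = smult 4 (?l * ?n)" by (simp add: numeral_mult_conv_smult)
    then show ?thesis
      using degree_mult_le[of ?l ?n] e(3)[rule_format, of 0] e(3)[rule_format, of 2] by (simp add: order_trans)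
  qed
  ultimately have "degree (k^2 * f) \<le> 4" unfolding eq[symmetric] by (rule degree_diff_le)
  moreover have "k \<noteq> 0" using k q d by auto
  ultimately show False
    using degree_mult_eq[of "k^2" f] by (simp add: degree_quintic quintic_eq_pCons)
qed

lemma u_even:
  obtains d p where "d \<noteq> 0" "\<forall>\<^sub>F z in generic f. poly d (fst z) * u z = poly p (fst z)"
proof -
  obtain d p q where d: "d \<noteq> 0"
    and ev: "\<forall>\<^sub>F z in generic f. poly d (fst z) * u z = poly p (fst z) + poly q (fst z) * snd z"
    using u_rational by blast
  have "q = 0" using d ev by (rule u_in_base_field)
  with ev have "\<forall>\<^sub>F z in generic f. poly d (fst z) * u z = poly p (fst z)" by simp
  with d show thesis by (rule that)
qed

text \<open>Both u lies in k(x) and, through the inverse automorphism, x lies in k(u). The latter is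
  a relation of degree 1 in x, so the primitive relation for u has coefficients of degree at most
  1.\<close>

lemma u_Moebius:
  obtains \<alpha> \<beta> \<gamma> \<delta> where "[:\<delta>, \<gamma>:] \<noteq> 0"
    "\<forall>\<^sub>F z in generic f. (\<gamma> * fst z + \<delta>) * u z = \<alpha> * fst z + \<beta>"
proof -
  obtain \<psi> where \<psi>: "genus2_automorphism a b c \<psi>" "\<forall>P\<in>X. \<psi> (\<phi> P) = P"
    by (rule obtain_inverse)
  interpret inv: genus2_automorphism a b c \<psi> by (rule \<psi>(1))
  obtain d' p' where d': "d' \<noteq> 0" and ev': "\<forall>\<^sub>F z in generic f. poly d' (fst z) * inv.u z = poly p' (fst z)"
    by (rule inv.u_even)
  obtain d p where d: "d \<noteq> 0" and ev: "\<forall>\<^sub>F z in generic f. poly d (fst z) * u z = poly p (fst z)"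
    by (rule u_even)
  let ?x = "[:[:0, 1 :: 'a:]:]"
  let ?Q = "const_coeffs d' * ?x - const_coeffs p'"
  have Q: "\<forall>\<^sub>F z in generic f. poly2 ?Q (fst z, u z) = 0"
    using transfer[OF ev'] generic_inverse[OF \<psi>(2)]
  proof eventually_elim
    case (elim z)
    have "inv.u (u z, w z) = fst z" unfolding inv.u_def elim(2) by simp
    with elim(1) show ?case by (simp add: poly2_def mult.commute)
  qed
  have Qt: "poly ?Q [:t:] = [:- poly p' t, poly d' t:]" for t by simp
  have degQ: "degree (poly ?Q [:t:]) \<le> 1" for t unfolding Qt by simp
  have Q0: "?Q \<noteq> 0"
  proof
    assume Q0: "?Q = 0"
    have "finite {t. poly d' t = 0}" using d' by (rule poly_roots_finite)
    from ex_new_if_finite[OF infinite_UNIV_char_0 this] obtain t where t: "poly d' t \<noteq> 0" by auto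
    have "[:- poly p' t, poly d' t:] = 0" unfolding Qt[symmetric] Q0 by simp
    with t show False by simp
  qed
  let ?P0 = "[:- p, d:]"
  have van: "\<forall>\<^sub>F z in generic f. poly2 ?P0 (fst z, u z) = 0"
    using ev by eventually_elim (simp add: algebra_simps)
  have min: "R = 0" if R: "\<forall>\<^sub>F z in generic f. poly2 R (fst z, u z) = 0" "degree R < degree ?P0" for R
  proof -
    have "degree R = 0" using R(2) d by (simp split: if_splits)
    then obtain r where r: "R = [:r:]" by (rule degree_eq_zeroE)
    have "\<forall>\<^sub>F z in generic f. poly r (fst z) + poly 0 (fst z) * snd z = 0"
      using R(1) by eventually_elim (simp add: r)
    then have "r = 0 \<and> (0 :: 'a poly) = 0" by (rule generic_zero_imp_0[OF odd_degree_quintic])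
    then show ?thesis by (simp add: r)
  qed
  have "?P0 \<noteq> 0" using d by simp
  then obtain e P where e: "e \<noteq> 0" "?P0 = smult e P" "\<forall>i. degree (coeff P i) \<le> 1"
    by (rule minimal_relation_degree_le[OF odd_degree_quintic _ van min Q0 Q degQ])
  have coeffs: "coeff ?P0 i = e * coeff P i" for i by (simp only: e(2) coeff_smult)
  have c: "- p = e * coeff P 0" "d = e * coeff P 1"
    using coeffs[of 0] coeffs[of 1] by simp_all
  obtain \<beta> \<alpha> where n: "coeff P 0 = [:\<beta>, \<alpha>:]" using e(3)[rule_format] by (rule degree_le_1E)
  obtain \<delta> \<gamma> where m: "coeff P 1 = [:\<delta>, \<gamma>:]" using e(3)[rule_format] by (rule degree_le_1E)
  have "[:\<delta>, \<gamma>:] \<noteq> 0" using c(2) d m by auto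
  moreover have "\<forall>\<^sub>F z in generic f. (\<gamma> * fst z + \<delta>) * u z = (- \<alpha>) * fst z + (- \<beta>)"
    using ev generic_poly_nonzero[OF odd_degree_quintic e(1)]
  proof eventually_elim
    case (elim z)
    have "- poly p (fst z) = poly e (fst z) * (\<alpha> * fst z + \<beta>)"
      using arg_cong[OF c(1), of "\<lambda>p. poly p (fst z)"] unfolding n by (simp add: algebra_simps)
    moreover have "poly d (fst z) = poly e (fst z) * (\<gamma> * fst z + \<delta>)"
      using arg_cong[OF c(2), of "\<lambda>p. poly p (fst z)"] unfolding m by (simp add: algebra_simps)
    ultimately have "poly e (fst z) * ((\<gamma> * fst z + \<delta>) * u z) = poly e (fst z) * ((- \<alpha>) * fst z + (- \<beta>))"
      using elim(1) by algebra
    with elim(2) show ?case using mult_left_cancel by blast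
  qed
  ultimately show thesis by (rule that)
qed

text \<open>\<open>F\<close> below is the image of the sextic under the Moebius transformation; it has degree at most 6
  and differs from \<open>f\<close> by a square, so by a constant.\<close>

lemma w_form:
  assumes L: "[:\<delta>, \<gamma>:] \<noteq> 0"
    and ev: "\<forall>\<^sub>F z in generic f. (\<gamma> * fst z + \<delta>) * u z = \<alpha> * fst z + \<beta>"
  obtains \<kappa> where "\<kappa> \<noteq> 0" "\<forall>\<^sub>F z in generic f. (\<gamma> * fst z + \<delta>)^3 * w z = \<kappa> * snd z"
    "\<forall>x. sextic_form a b c (\<alpha> * x + \<beta>) (\<gamma> * x + \<delta>) = \<kappa>^2 * sextic_form a b c x 1"
proof -
  let ?n = "[:\<beta>, \<alpha>:]" and ?L = "[:\<delta>, \<gamma>:]"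
  \<comment> \<open>This is L^6 f(n/L), with the denominator L of the Moebius transformation
    cleared.\<close>
  define F where "F = ?n^5 * ?L^1 + smult a (?n^4 * ?L^2) + smult b (?n^3 * ?L^3) +
    smult c (?n^2 * ?L^4) + ?n^1 * ?L^5"
  have F: "poly F x = sextic_form a b c (\<alpha> * x + \<beta>) (\<gamma> * x + \<delta>)" for x
  proof -
    have "poly F x = (\<alpha>*x + \<beta>)^5*(\<gamma>*x + \<delta>) + a*((\<alpha>*x + \<beta>)^4*(\<gamma>*x + \<delta>)^2) +
        b*((\<alpha>*x + \<beta>)^3*(\<gamma>*x + \<delta>)^3) + c*((\<alpha>*x + \<beta>)^2*(\<gamma>*x + \<delta>)^4) +
        (\<alpha>*x + \<beta>)*(\<gamma>*x + \<delta>)^5"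
      by (simp add: F_def algebra_simps)
    moreover have "sextic_form a b c s t = s^5*t + a*(s^4*t^2) + b*(s^3*t^3) + c*(s^2*t^4) + s*t^5" for s t
      unfolding sextic_form_def by algebra
    ultimately show ?thesis by simp
  qed
  have deg: "degree (?n^i * ?L^j) \<le> i + j" for i j
  proof -
    have "degree (?n^i) \<le> 1 * i" "degree (?L^j) \<le> 1 * j"
      by (rule order_trans[OF degree_power_le mult_right_mono]; simp)+
    then show ?thesis using degree_mult_le[of "?n^i" "?L^j"] by simp
  qed
  have degF: "degree F \<le> 6"
    unfolding F_def
    by (intro degree_add_le order_trans[OF degree_smult_le] order_trans[OF deg]) simp_all
  obtain d p q where d: "d \<noteq> 0"
    and w: "\<forall>\<^sub>F z in generic f. poly d (fst z) * w z = poly p (fst z) + poly q (fst z) * snd z"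
    using w_rational by blast
  have Lev: "\<forall>\<^sub>F z in generic f. \<gamma> * fst z + \<delta> \<noteq> 0"
    using generic_poly_nonzero[OF odd_degree_quintic L] by eventually_elim (simp add: algebra_simps)
  have "\<forall>\<^sub>F z in generic f. poly (?L^6 * (p^2 + q^2 * f) - d^2 * F) (fst z) +
      poly (2 * ?L^6 * p * q) (fst z) * snd z = 0"
    using ev w image_curve eventually_generic_curve[of f]
  proof eventually_elim
    case (elim z)
    let ?l = "\<gamma> * fst z + \<delta>"
    have l: "poly ?L (fst z) = ?l" by (simp add: algebra_simps)
    have "poly F (fst z) = sextic_form a b c (?l * u z) (?l * 1)"
      unfolding F elim(1) by simp
    also have "\<dots> = ?l^6 * (w z)^2"
      unfolding sextic_form_scale elim(3) poly_quintic ..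
    finally have "(poly d (fst z))^2 * poly F (fst z) = ?l^6 * (poly d (fst z) * w z)^2"
      by (simp add: power_mult_distrib)
    also have "\<dots> = ?l^6 * (poly p (fst z) + poly q (fst z) * snd z)^2"
      unfolding elim(2) ..
    also have "\<dots> = ?l^6 * ((poly p (fst z))^2 + (poly q (fst z))^2 * (snd z)^2) +
        2 * ?l^6 * poly p (fst z) * poly q (fst z) * snd z"
      by algebra
    finally show ?case unfolding elim(4) by (simp only: poly_diff poly_add poly_mult poly_power poly_numeral l) simp
  qed
  \<comment> \<open>The parts with and without y vanish separately; the former leaves for w only an
    element of k(x) or y times such an element.\<close>
  from generic_zero_imp_0[OF odd_degree_quintic this]
  have norm_eq: "?L^6 * (p^2 + q^2 * f) - d^2 * F = 0" and pq: "2 * ?L^6 * p * q = 0" by blast+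
  have q: "q \<noteq> 0"
  proof
    assume q: "q = 0"
    \<comment> \<open>If w were in k(x), then \<phi> would send (x, y) and (x, -y) to the same
      point, against injectivity.\<close>
    let ?G = "\<lambda>z. \<phi> (affine_point z) = affine_point (u z, w z) \<and> (\<gamma> * fst z + \<delta>) * u z = \<alpha> * fst z + \<beta> \<and>
        poly d (fst z) * w z = poly p (fst z)"
    have G: "\<forall>\<^sub>F z in generic f. ?G z"
      using image_affine ev w by eventually_elim (simp add: q)
    have "\<forall>\<^sub>F z in generic f. snd z \<noteq> 0"
      using generic_nonzero[OF odd_degree_quintic, of 0 1 a b c] by simp
    with G generic_conj[OF G] Lev generic_poly_nonzero[OF odd_degree_quintic d] eventually_generic_curve[of f]
    have "\<forall>\<^sub>F z in generic f. ?G z \<and> ?G (fst z, - snd z) \<and> \<gamma> * fst z + \<delta> \<noteq> 0 \<and> poly d (fst z) \<noteq> 0 \<and>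
        (snd z)^2 = poly f (fst z) \<and> snd z \<noteq> 0"
      by eventually_elim blast
    then obtain z where z: "?G z" "?G (fst z, - snd z)" "\<gamma> * fst z + \<delta> \<noteq> 0" "poly d (fst z) \<noteq> 0"
        "(snd z)^2 = poly f (fst z)" "snd z \<noteq> 0"
      using eventually_happens'[OF generic_neq_bot[OF odd_degree_quintic]] by blast
    have "(\<gamma> * fst z + \<delta>) * u z = (\<gamma> * fst z + \<delta>) * u (fst z, - snd z)"
        "poly d (fst z) * w z = poly d (fst z) * w (fst z, - snd z)"
      using z(1,2) by simp_all
    then have "u z = u (fst z, - snd z)" "w z = w (fst z, - snd z)"
      using z(3,4) mult_left_cancel by blast+
    then have "\<phi> (affine_point z) = \<phi> (affine_point (fst z, - snd z))" using z(1,2) by simp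
    then have "affine_point z = affine_point (fst z, - snd z)"
      by (rule inj_onD[OF bij_betw_imp_inj_on[OF bij]]) (simp_all add: z(5))
    then have "snd z = - snd z" by (simp add: prod_eq_iff)
    with z(6) show False by simp
  qed
  have p: "p = 0" using pq q L by auto
  have "d^2 * F = (?L^3 * q)^2 * f"
    using norm_eq by (simp add: p power_mult_distrib algebra_simps flip: power_mult)
  moreover from this have "d dvd ?L^3 * q"
    by (rule square_dvd_square_times_rsquarefree[OF sqfree d])
  then obtain k where k: "?L^3 * q = d * k" by (rule dvdE)
  ultimately have "d^2 * F = d^2 * (k^2 * f)" by (simp only: k power_mult_distrib mult.assoc)
  moreover have "d^2 \<noteq> 0" using d by simp
  ultimately have Fk: "F = k^2 * f" using mult_left_cancel by blast
  have "?L^3 * q \<noteq> 0" using q L by simp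
  then have k0: "k \<noteq> 0" using k by auto
  have "f \<noteq> 0" by (simp add: quintic_eq_pCons)
  then have "degree F = 2 * degree k + 5"
    using k0 by (simp add: Fk degree_mult_eq degree_power_eq degree_quintic)
  with degF have "degree k = 0" by simp
  then obtain \<kappa> where \<kappa>: "k = [:\<kappa>:]" by (rule degree_eq_zeroE)
  show thesis
  proof (rule that)
    show "\<kappa> \<noteq> 0" using k0 \<kappa> by simp
    show "\<forall>\<^sub>F z in generic f. (\<gamma> * fst z + \<delta>)^3 * w z = \<kappa> * snd z"
      using w generic_poly_nonzero[OF odd_degree_quintic d]
    proof eventually_elim
      case (elim z)
      have l: "poly ?L (fst z) = \<gamma> * fst z + \<delta>" by (simp add: algebra_simps)
      have lq: "(\<gamma> * fst z + \<delta>)^3 * poly q (fst z) = poly d (fst z) * \<kappa>"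
        using arg_cong[OF k, of "\<lambda>p. poly p (fst z)"] by (simp only: poly_mult poly_power l \<kappa>) simp
      have "poly d (fst z) * ((\<gamma> * fst z + \<delta>)^3 * w z) = (\<gamma> * fst z + \<delta>)^3 * (poly d (fst z) * w z)"
        by (rule mult.left_commute)
      also have "\<dots> = ((\<gamma> * fst z + \<delta>)^3 * poly q (fst z)) * snd z"
        unfolding elim(1) by (simp add: p mult.assoc)
      also have "\<dots> = poly d (fst z) * (\<kappa> * snd z)" unfolding lq by (rule mult.assoc)
      finally have "poly d (fst z) * ((\<gamma> * fst z + \<delta>)^3 * w z) = poly d (fst z) * (\<kappa> * snd z)" .
      with elim(2) show ?case using mult_left_cancel by blast
    qed
    show "\<forall>x. sextic_form a b c (\<alpha> * x + \<beta>) (\<gamma> * x + \<delta>) = \<kappa>^2 * sextic_form a b c x 1"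
      unfolding F[symmetric] poly_quintic[symmetric] Fk \<kappa> by (simp add: power2_eq_square)
  qed
qed

lemma involution_cases:
  assumes inv: "\<forall>P\<in>X. \<phi> (\<phi> P) = P"
  obtains "\<forall>\<^sub>F z in generic f. \<phi> (affine_point z) = affine_point z"
    | "\<forall>\<^sub>F z in generic f. \<phi> (affine_point z) = affine_point (fst z, - snd z)"
    | "a = c \<or> a = - c \<or> F1 (a*c) ((a^2 + c^2)*b) (a^4 + c^4) = 0"
proof -
  obtain \<alpha> \<beta> \<gamma> \<delta> where L: "[:\<delta>, \<gamma>:] \<noteq> 0"
    and eu: "\<forall>\<^sub>F z in generic f. (\<gamma> * fst z + \<delta>) * u z = \<alpha> * fst z + \<beta>"
    by (rule u_Moebius)
  obtain \<kappa> where \<kappa>: "\<kappa> \<noteq> 0" and ew: "\<forall>\<^sub>F z in generic f. (\<gamma> * fst z + \<delta>)^3 * w z = \<kappa> * snd z"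
    and S: "\<forall>x. sextic_form a b c (\<alpha> * x + \<beta>) (\<gamma> * x + \<delta>) = \<kappa>^2 * sextic_form a b c x 1"
    using L eu by (rule w_form)
  have twice: "\<forall>\<^sub>F z in generic f. u (u z, w z) = fst z \<and> w (u z, w z) = snd z"
    using generic_inverse[OF inv] by eventually_elim (simp add: u_def w_def)
  have eu': "\<forall>\<^sub>F z in generic f. (\<gamma> * u z + \<delta>) * fst z = \<alpha> * u z + \<beta>"
    using transfer[OF eu] twice by eventually_elim simp
  have ew': "\<forall>\<^sub>F z in generic f. (\<gamma> * u z + \<delta>)^3 * snd z = \<kappa> * w z"
    using transfer[OF ew] twice by eventually_elim simp
  have "\<forall>\<^sub>F z in generic f. poly [:- (\<beta>*(\<alpha> + \<delta>)), (\<delta> - \<alpha>)*(\<alpha> + \<delta>), \<gamma>*(\<alpha> + \<delta>):] (fst z) + poly 0 (fst z) * snd z = 0"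
    using eu eu'
  proof eventually_elim
    case (elim z)
    let ?l = "\<gamma> * fst z + \<delta>"
    have "?l * ((\<gamma> * u z + \<delta>) * fst z) = ?l * (\<alpha> * u z + \<beta>)" unfolding elim(2) ..
    then have "(\<gamma> * (?l * u z) + \<delta> * ?l) * fst z = \<alpha> * (?l * u z) + \<beta> * ?l" by algebra
    then show ?case unfolding elim(1) by (simp add: algebra_simps)
  qed
  \<comment> \<open>These are the coefficients of u(u(x)) = x, cleared of denominators: either the
    trace \<alpha> + \<delta> vanishes or the matrix is scalar.\<close>
  from generic_zero_imp_0[OF odd_degree_quintic this]
  have co: "\<beta>*(\<alpha> + \<delta>) = 0" "(\<delta> - \<alpha>)*(\<alpha> + \<delta>) = 0" "\<gamma>*(\<alpha> + \<delta>) = 0" by (auto split: if_splits)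
  show thesis
  proof (cases "\<alpha> + \<delta> = 0")
    case True
    then have \<delta>: "\<delta> = - \<alpha>" by (simp add: eq_neg_iff_add_eq_0 add.commute)
    let ?D = "\<alpha>^2 + \<beta>*\<gamma>"
    have "\<forall>\<^sub>F z in generic f. snd z \<noteq> 0"
      using generic_nonzero[OF odd_degree_quintic, of 0 1 a b c] by simp
    \<comment> \<open>Applying \<phi> twice to y multiplies it by \<kappa>^2 / (l(x) l(u))^3 with
      l(x) = \<gamma> x + \<delta>, and l(x) l(u) = ?D. So order 2 of \<phi> itself fixes the sign
      in \<kappa>^2 = ?D^3.\<close>
    with eu ew ew' have "\<forall>\<^sub>F z in generic f. ?D^3 = \<kappa>^2"
    proof eventually_elim
      case (elim z)
      let ?l = "\<gamma> * fst z + \<delta>"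
      have "?l * (\<gamma> * u z + \<delta>) = \<gamma> * (?l * u z) + \<delta> * ?l" by algebra
      also have "\<dots> = ?D" unfolding elim(1) unfolding \<delta> by algebra
      finally have D: "?l * (\<gamma> * u z + \<delta>) = ?D" .
      have "?D^3 * snd z = ?l^3 * ((\<gamma> * u z + \<delta>)^3 * snd z)"
        unfolding D[symmetric] by (simp add: power_mult_distrib mult.assoc)
      also have "\<dots> = \<kappa> * (?l^3 * w z)" unfolding elim(3) by (rule mult.left_commute)
      also have "\<dots> = \<kappa>^2 * snd z" unfolding elim(2) by (simp add: power2_eq_square)
      finally show ?case using elim(4) by simp
    qed
    then have D: "?D^3 = \<kappa>^2"
      using generic_neq_bot[OF odd_degree_quintic, of a b c] by simp
    with \<kappa> have "?D \<noteq> 0" by auto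
    moreover have "sextic_form a b c (\<alpha> * x + \<beta>) (\<gamma> * x - \<alpha>) = ?D^3 * sextic_form a b c x 1" for x
      using S[rule_format, of x] unfolding D \<delta> by simp
    ultimately have "a = c \<or> a = - c \<or> F1 (a*c) ((a^2 + c^2)*b) (a^4 + c^4) = 0"
      by (rule sextic_involution_cases)
    then show thesis by (rule that(3))
  next
    case False
    \<comment> \<open>The transformation is the identity on the line, and \<kappa> = \<alpha>^3 or
      -\<alpha>^3 separates the identity from the hyperelliptic involution.\<close>
    with co have z: "\<beta> = 0" "\<gamma> = 0" "\<delta> = \<alpha>" by auto
    with L have \<alpha>: "\<alpha> \<noteq> 0" by auto
    have ux: "\<forall>\<^sub>F z in generic f. u z = fst z"
      using eu by eventually_elim (use \<alpha> in \<open>simp add: z\<close>)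
    have "\<forall>\<^sub>F z in generic f. snd z \<noteq> 0"
      using generic_nonzero[OF odd_degree_quintic, of 0 1 a b c] by simp
    with ew ew' have "\<forall>\<^sub>F z in generic f. (\<alpha>^3)^2 = \<kappa>^2"
    proof eventually_elim
      case (elim z)
      have "(\<alpha>^3)^2 * snd z = \<alpha>^3 * (\<alpha>^3 * snd z)" by (simp only: power2_eq_square mult.assoc)
      also have "\<alpha>^3 * snd z = \<kappa> * w z" using elim(2) by (simp add: z)
      also have "\<alpha>^3 * (\<kappa> * w z) = \<kappa> * (\<alpha>^3 * w z)" by (rule mult.left_commute)
      also have "\<alpha>^3 * w z = \<kappa> * snd z" using elim(1) by (simp add: z)
      also have "\<kappa> * (\<kappa> * snd z) = \<kappa>^2 * snd z" by (simp only: power2_eq_square mult.assoc)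
      finally show ?case using elim(3) by simp
    qed
    then have "(\<alpha>^3)^2 = \<kappa>^2"
      using generic_neq_bot[OF odd_degree_quintic, of a b c] by simp
    then have "\<kappa> = \<alpha>^3 \<or> \<kappa> = - (\<alpha>^3)" by (metis power2_eq_iff)
    then consider "\<kappa> = \<alpha>^3" | "\<kappa> = - (\<alpha>^3)" by blast
    then show thesis
    proof cases
      case 1
      have "\<forall>\<^sub>F z in generic f. \<phi> (affine_point z) = affine_point z"
        using image_affine ux ew by eventually_elim (use \<alpha> in \<open>simp add: z 1\<close>)
      then show thesis by (rule that(1))
    next
      case 2
      have "\<forall>\<^sub>F z in generic f. \<phi> (affine_point z) = affine_point (fst z, - snd z)"
        using image_affine ux ew
      proof eventually_elim
        case (elim x)
        have "\<alpha>^3 * w x = \<alpha>^3 * (- snd x)" using elim(3) by (simp add: z 2)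
        then have "w x = - snd x" using \<alpha> by (simp only: mult_cancel_left) simp
        with elim show ?case by simp
      qed
      then show thesis by (rule that(2))
    qed
  qed
qed

end

text \<open>The octic is g(X^2), where the quintic is x g(x). As g(0) = 1, the root 0 of the quintic
  is simple, and a double root r of g would make a square root of r a double root of the
  octic.\<close>

lemma rsquarefree_octic_imp_quintic:
  fixes a b c :: "'k::{alg_closed_field, field_char_0}"
  assumes "rsquarefree (octic a b c)"
  shows "rsquarefree (quintic a b c)"
  unfolding rsquarefree_roots
proof (intro allI notI)
  fix r
  assume r: "poly (quintic a b c) r = 0 \<and> poly (pderiv (quintic a b c)) r = 0"
  then have r0: "r*(r^4 + a*r^3 + b*r^2 + c*r + 1) = 0"
      "(r^4 + a*r^3 + b*r^2 + c*r + 1) + r*(4*r^3 + 3*a*r^2 + 2*b*r + c) = 0"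
    by (simp_all add: quintic_eq_pCons pderiv_pCons algebra_simps power_numeral_reduce)
  then have "r \<noteq> 0" by auto
  with r0(1) have g: "r^4 + a*r^3 + b*r^2 + c*r + 1 = 0" by simp
  with r0(2) \<open>r \<noteq> 0\<close> have g': "4*r^3 + 3*a*r^2 + 2*b*r + c = 0" by simp
  obtain s where s: "r = s^2" using nth_root_exists[of 2 r] by auto
  have "poly (octic a b c) s = 0"
    using g by (simp add: poly_octic s flip: power_mult)
  moreover have "poly (pderiv (octic a b c)) s = 2*s*(4*r^3 + 3*a*r^2 + 2*b*r + c)"
    by (simp add: octic_def pderiv_add pderiv_monom poly_monom s algebra_simps power_numeral_reduce)
  ultimately show False
    using assms g' unfolding rsquarefree_roots by auto
qed

theorem lemma2:
  fixes a b c s2 s3 s4 :: "'k::{alg_closed_field, field_char_0}"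
  assumes "rsquarefree (octic a b c)"
    and "s2 = inv_s2 a b c" and "s3 = inv_s3 a b c" and "s4 = inv_s4 a b c"
    and "16 * s2 ^ 3 - 40 * s2 ^ 2 + 8 * s2 * s4 - 3 * s3 ^ 2 - 20 * s4 \<noteq> 0"
    and "split_Jacobian_244 a b c"
  shows "embeds_in Z2_cubed (Aut_X a b c) \<or>
         embeds_in Z2_times_Z4 (Aut_X a b c) \<or>
         F1 s2 s3 s4 = 0"
proof -
  let ?f = "quintic a b c" and ?A = "hyp_Aut 2 (quintic a b c)" and ?X = "hyp_points 2 (quintic a b c)"
  let ?goal = "a = c \<or> a = - c \<or> F1 (a*c) ((a^2 + c^2)*b) (a^4 + c^4) = 0"
  obtain h where h: "h \<in> hom Klein_four_group ?A" "inj_on h (carrier Klein_four_group)"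
    using assms(6) by (auto simp: split_Jacobian_244_def embeds_in_def Aut_C_def mon_def)
  interpret A: group ?A by (rule group_hyp_Aut)
  have "group Klein_four_group" by (intro DirProd_group) simp_all
  then have h0: "h (0, 0) = \<one>\<^bsub>?A\<^esub>"
    using hom_one[OF h(1)] A.is_group by simp
  have V: "carrier Klein_four_group = {0, 1} \<times> {0, 1}"
    by (auto simp: carrier_integer_mod_group)
  have hm: "h (0, 1) \<otimes>\<^bsub>?A\<^esub> h (0, 1) = h (0, 0)" "h (1, 0) \<otimes>\<^bsub>?A\<^esub> h (1, 0) = h (0, 0)"
      "h (1, 0) \<otimes>\<^bsub>?A\<^esub> h (0, 1) = h (1, 1)"
    using hom_mult[OF h(1), of "(0, 1)" "(0, 1)"] hom_mult[OF h(1), of "(1, 0)" "(1, 0)"]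
      hom_mult[OF h(1), of "(1, 0)" "(0, 1)"] unfolding V by simp_all
  have car: "h (i, j) \<in> carrier ?A" if "(i, j) \<in> {0, 1} \<times> {0, 1}" for i j
    using hom_in_carrier[OF h(1)] that unfolding V by blast
  have ne: "h (i, j) \<noteq> \<one>\<^bsub>?A\<^esub>" if "(i, j) \<in> {0, 1} \<times> {0, 1}" "(i, j) \<noteq> (0, 0)" for i j
    using inj_onD[OF h(2), of "(i, j)" "(0, 0)"] that h0 unfolding V by auto
  have loc: "genus2_automorphism a b c \<phi>" if "\<phi> \<in> carrier ?A" for \<phi>
    using that rsquarefree_octic_imp_quintic[OF assms(1)]
    by unfold_locales (simp_all add: carrier_hyp_Aut)
  have app: "(\<phi> \<otimes>\<^bsub>?A\<^esub> \<psi>) P = \<phi> (\<psi> P)" if "\<phi> \<in> carrier ?A" "\<psi> \<in> carrier ?A" "P \<in> ?X" for \<phi> \<psi> P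
    using that by (simp add: mult_hyp_Aut compose_eq)
  \<comment> \<open>An element of the group is a map on all points, so it is the neutral element
    only if the generic identity extends to every point.\<close>
  have not_id: "\<not> (\<forall>\<^sub>F z in generic ?f. \<phi> (affine_point z) = affine_point z)"
    if "\<phi> \<in> carrier ?A" "\<phi> \<noteq> \<one>\<^bsub>?A\<^esub>" for \<phi>
  proof
    interpret \<phi>: genus2_automorphism a b c \<phi> by (rule loc[OF that(1)])
    assume ev: "\<forall>\<^sub>F z in generic ?f. \<phi> (affine_point z) = affine_point z"
    have "\<phi> \<in> extensional ?X"
      using that(1) by (auto simp: carrier_hyp_Aut hyp_automorphisms_def Bij_def)
    then have "\<phi> = (\<lambda>P\<in>?X. P)"
      by (rule extensionalityI) (simp_all add: \<phi>.generic_id_imp_id[OF ev])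
    with that(2) show False by (simp add: one_hyp_Aut)
  qed
  have "?goal"
  proof (rule ccontr)
    assume no: "\<not> ?goal"
    have conj: "\<forall>\<^sub>F z in generic ?f. \<phi> (affine_point z) = affine_point (fst z, - snd z)"
      if \<phi>: "\<phi> \<in> carrier ?A" "\<phi> \<noteq> \<one>\<^bsub>?A\<^esub>" "\<phi> \<otimes>\<^bsub>?A\<^esub> \<phi> = \<one>\<^bsub>?A\<^esub>" for \<phi>
    proof -
      interpret \<phi>: genus2_automorphism a b c \<phi> by (rule loc[OF \<phi>(1)])
      have "\<forall>P\<in>?X. \<phi> (\<phi> P) = P"
        using app[OF \<phi>(1,1)] unfolding \<phi>(3) one_hyp_Aut by simp
      then show ?thesis
        by (rule \<phi>.involution_cases) (use not_id[OF \<phi>(1,2)] no in blast)+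
    qed
    have x: "\<forall>\<^sub>F z in generic ?f. h (1, 0) (affine_point z) = affine_point (fst z, - snd z)"
      using conj[of "h (1, 0)"] car ne hm h0 by simp
    have y: "\<forall>\<^sub>F z in generic ?f. h (0, 1) (affine_point z) = affine_point (fst z, - snd z)"
      using conj[of "h (0, 1)"] car ne hm h0 by simp
    have "\<forall>\<^sub>F z in generic ?f. h (1, 1) (affine_point z) = affine_point z"
      using y generic_conj[OF x] eventually_generic_curve[of ?f]
    proof eventually_elim
      case (elim z)
      have "h (1, 1) (affine_point z) = h (1, 0) (h (0, 1) (affine_point z))"
        unfolding hm(3)[symmetric] using elim(3) by (intro app car) simp_all
      with elim show ?case by simp
    qed
    \<comment> \<open>Both generators would be generically the hyperelliptic involution, so their
      product would be trivial although \<open>h\<close> is injective.\<close>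
    with not_id[of "h (1, 1)"] car ne show False by simp
  qed
  then show ?thesis
    using embeds_Z2_cubed_Aut_X[of a c b] by (auto simp: assms(2-4) inv_s2_def inv_s3_def inv_s4_def)
qed

end
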